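(* Let $\mathbf Y\to\mathbf Z$ be a nontrivial relatively weakly mixing extension of ergodic systems and let $G$ be a second countable compact topological group with Haar measure $\lambda_G$. Then for a generic cocycle $\phi\in\mathcal C(Y,G)$, with corresponding skew product $\mathbf Y_\phi$ on $Y\times G$ given by $T_\phi(y,g)=(Ty,\phi(y)g)$, the extension $\mathbf Y_\phi\to\mathbf Z$ is relatively weakly mixing. In particular, when $\mathbf Y$ is weakly mixing (i.e. when $\mathbf Z$ is the trivial one point system), the system $\mathbf Y_\phi$ is weakly mixing for a generic cocycle $\phi\in\mathcal C(Y,G)$.
   Context: A system is a standard probability space with an invertible measure preserving transformation. An extension is nontrivial if it is not an isomorphism. For an extension $\mathbf X\to\mathbf Z$ with disintegration $\mu=\int\mu_z\,d\theta(z)$, the relative product $\mathbf X\underset{\mathbf Z}{\times}\mathbf X$ is the fiber product with measure $\int\mu_z\times\mu_z\,d\theta(z)$ and transformation $T\times T$; the extension is relatively weakly mixing if this relative product is ergodic. $\mathcal C(Y,G)$ is the Polish space of measurable maps $Y\to G$ (mod a.e. equality) with the topology of convergence in measure (with respect to a bi-invariant metric on $G$). $\mathbf Y_\phi=(Y\times G,\mathcal Y\times\mathcal B_G,\mu\times\lambda_G,T_\phi)$ where $\mu$ is the measure of $\mathbf Y$. "Generic" means for all $\phi$ in a set containing a dense $G_\delta$ subset of $\mathcal C(Y,G)$. *)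

theory Defs
  imports "HOL-Probability.Probability" "HOL-Algebra.Group"
begin

definition borel_of :: "'a topology \<Rightarrow> 'a measure" where
  "borel_of X = sigma (topspace X) {U. openin X U}"

definition standard_probability_space :: "'a measure \<Rightarrow> bool" where
  "standard_probability_space M \<longleftrightarrow>
     prob_space M \<and>
     (\<exists>X. completely_metrizable_space X \<and> second_countable X \<and>
          topspace X = space M \<and> sets M = sets (borel_of X))"

definition is_system :: "'a measure \<Rightarrow> ('a \<Rightarrow> 'a) \<Rightarrow> bool" where
  "is_system M T \<longleftrightarrow>
     standard_probability_space M \<and>
     T \<in> measurable M M \<and> bij_betw T (space M) (space M) \<and>
     the_inv_into (space M) T \<in> measurable M M \<and>
     distr M M T = M"

text \<open>Invariance is understood modulo null sets, so that the notion also makes sense for a map that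
  preserves the underlying space only up to a null set.\<close>

definition is_ergodic :: "'a measure \<Rightarrow> ('a \<Rightarrow> 'a) \<Rightarrow> bool" where
  "is_ergodic M T \<longleftrightarrow>
     (\<forall>A\<in>sets M. (AE x in M. T x \<in> A \<longleftrightarrow> x \<in> A) \<longrightarrow> measure M A = 0 \<or> measure M A = 1)"

definition is_extension ::
  "'a measure \<Rightarrow> ('a \<Rightarrow> 'a) \<Rightarrow> 'b measure \<Rightarrow> ('b \<Rightarrow> 'b) \<Rightarrow> ('a \<Rightarrow> 'b) \<Rightarrow> bool" where
  "is_extension M T N S p \<longleftrightarrow>
     is_system M T \<and> is_system N S \<and>
     p \<in> measurable M N \<and> distr M N p = N \<and> (AE x in M. p (T x) = S (p x))"

definition is_isomorphism ::
  "'a measure \<Rightarrow> ('a \<Rightarrow> 'a) \<Rightarrow> 'b measure \<Rightarrow> ('b \<Rightarrow> 'b) \<Rightarrow> ('a \<Rightarrow> 'b) \<Rightarrow> bool" where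
  "is_isomorphism M T N S p \<longleftrightarrow>
     is_extension M T N S p \<and>
     (\<exists>q. is_extension N S M T q \<and> (AE x in M. q (p x) = x) \<and> (AE z in N. p (q z) = z))"

definition nontrivial_extension ::
  "'a measure \<Rightarrow> ('a \<Rightarrow> 'a) \<Rightarrow> 'b measure \<Rightarrow> ('b \<Rightarrow> 'b) \<Rightarrow> ('a \<Rightarrow> 'b) \<Rightarrow> bool" where
  "nontrivial_extension M T N S p \<longleftrightarrow>
     is_extension M T N S p \<and> \<not> is_isomorphism M T N S p"

text \<open>\<open>K z\<close> is the conditional measure \<open>\<mu>\<^sub>z\<close>, a probability measure on the whole space that is
  carried by the fibre over \<open>z\<close>.\<close>

definition is_disintegration ::
  "'a measure \<Rightarrow> 'b measure \<Rightarrow> ('a \<Rightarrow> 'b) \<Rightarrow> ('b \<Rightarrow> 'a measure) \<Rightarrow> bool" where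
  "is_disintegration M N p K \<longleftrightarrow>
     K \<in> measurable N (prob_algebra M) \<and>
     (AE z in N. AE x in K z. p x = z) \<and>
     M = N \<bind> K"

definition relative_product ::
  "'a measure \<Rightarrow> 'b measure \<Rightarrow> ('a \<Rightarrow> 'b) \<Rightarrow> ('b \<Rightarrow> 'a measure) \<Rightarrow> ('a \<times> 'a) measure" where
  "relative_product M N p K =
     restrict_space (N \<bind> (\<lambda>z. K z \<Otimes>\<^sub>M K z))
       {(x, x'). x \<in> space M \<and> x' \<in> space M \<and> p x = p x'}"

text \<open>A disintegration exists and is unique up to a null set of the base, so the choice of \<open>K\<close> is
  immaterial.\<close>

definition relatively_weakly_mixing ::
  "'a measure \<Rightarrow> ('a \<Rightarrow> 'a) \<Rightarrow> 'b measure \<Rightarrow> ('b \<Rightarrow> 'b) \<Rightarrow> ('a \<Rightarrow> 'b) \<Rightarrow> bool" where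
  "relatively_weakly_mixing M T N S p \<longleftrightarrow>
     is_extension M T N S p \<and>
     (\<exists>K. is_disintegration M N p K \<and> is_ergodic (relative_product M N p K) (map_prod T T))"

definition weakly_mixing :: "'a measure \<Rightarrow> ('a \<Rightarrow> 'a) \<Rightarrow> bool" where
  "weakly_mixing M T \<longleftrightarrow> is_system M T \<and> is_ergodic (M \<Otimes>\<^sub>M M) (map_prod T T)"

definition one_point :: "unit measure" where
  "one_point = return (count_space UNIV) ()"

definition topological_group :: "('g, 'm) monoid_scheme \<Rightarrow> 'g topology \<Rightarrow> bool" where
  "topological_group G X \<longleftrightarrow>
     group G \<and> topspace X = carrier G \<and>
     continuous_map (prod_topology X X) X (\<lambda>(g, h). g \<otimes>\<^bsub>G\<^esub> h) \<and>
     continuous_map X X (\<lambda>g. inv\<^bsub>G\<^esub> g)"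

definition haar_measure ::
  "('g, 'm) monoid_scheme \<Rightarrow> 'g topology \<Rightarrow> 'g measure \<Rightarrow> bool" where
  "haar_measure G X L \<longleftrightarrow>
     prob_space L \<and> sets L = sets (borel_of X) \<and>
     (\<forall>g\<in>carrier G. \<forall>A\<in>sets L. emeasure L ((\<lambda>h. g \<otimes>\<^bsub>G\<^esub> h) ` A) = emeasure L A)"

definition bi_invariant_metric ::
  "('g, 'm) monoid_scheme \<Rightarrow> 'g topology \<Rightarrow> ('g \<Rightarrow> 'g \<Rightarrow> real) \<Rightarrow> bool" where
  "bi_invariant_metric G X d \<longleftrightarrow>
     Metric_space (carrier G) d \<and> Metric_space.mtopology (carrier G) d = X \<and>
     (\<forall>g\<in>carrier G. \<forall>h\<in>carrier G. \<forall>k\<in>carrier G.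
        d (k \<otimes>\<^bsub>G\<^esub> g) (k \<otimes>\<^bsub>G\<^esub> h) = d g h \<and> d (g \<otimes>\<^bsub>G\<^esub> k) (h \<otimes>\<^bsub>G\<^esub> k) = d g h)"

text \<open>Points of \<open>\<C>(Y,G)\<close> are almost-everywhere classes of measurable maps, represented as sets of
  functions.\<close>

definition cocycle_class ::
  "'a measure \<Rightarrow> 'g topology \<Rightarrow> ('a \<Rightarrow> 'g) \<Rightarrow> ('a \<Rightarrow> 'g) set" where
  "cocycle_class M X \<phi> = {\<psi> \<in> measurable M (borel_of X). AE y in M. \<psi> y = \<phi> y}"

definition cocycles :: "'a measure \<Rightarrow> 'g topology \<Rightarrow> ('a \<Rightarrow> 'g) set set" where
  "cocycles M X = cocycle_class M X ` measurable M (borel_of X)"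

text \<open>Convergence in measure: the sets
  \<open>{\<psi>. \<mu> {y. d (\<phi> y) (\<psi> y) \<ge> \<epsilon>} < \<epsilon>}\<close> form a neighbourhood base at \<open>\<phi>\<close>.\<close>

definition cocycle_open ::
  "'a measure \<Rightarrow> 'g topology \<Rightarrow> ('g \<Rightarrow> 'g \<Rightarrow> real) \<Rightarrow> ('a \<Rightarrow> 'g) set set \<Rightarrow> bool" where
  "cocycle_open M X d U \<longleftrightarrow>
     U \<subseteq> cocycles M X \<and>
     (\<forall>\<phi>\<in>measurable M (borel_of X). cocycle_class M X \<phi> \<in> U \<longrightarrow>
        (\<exists>\<epsilon>>0. \<forall>\<psi>\<in>measurable M (borel_of X).
           measure M {y \<in> space M. d (\<phi> y) (\<psi> y) \<ge> \<epsilon>} < \<epsilon> \<longrightarrow> cocycle_class M X \<psi> \<in> U))"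

definition cocycle_topology ::
  "'a measure \<Rightarrow> 'g topology \<Rightarrow> ('g \<Rightarrow> 'g \<Rightarrow> real) \<Rightarrow> ('a \<Rightarrow> 'g) set topology" where
  "cocycle_topology M X d = topology (cocycle_open M X d)"

definition generic_cocycle ::
  "'a measure \<Rightarrow> 'g topology \<Rightarrow> ('g \<Rightarrow> 'g \<Rightarrow> real) \<Rightarrow> (('a \<Rightarrow> 'g) \<Rightarrow> bool) \<Rightarrow> bool" where
  "generic_cocycle M X d P \<longleftrightarrow>
     (\<exists>D. gdelta_in (cocycle_topology M X d) D \<and>
          cocycle_topology M X d closure_of D = cocycles M X \<and>
          (\<forall>c\<in>D. \<forall>\<phi>\<in>c. P \<phi>))"

definition skew_product ::
  "('g, 'm) monoid_scheme \<Rightarrow> ('a \<Rightarrow> 'a) \<Rightarrow> ('a \<Rightarrow> 'g) \<Rightarrow> 'a \<times> 'g \<Rightarrow> 'a \<times> 'g" where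
  "skew_product G T \<phi> = (\<lambda>(y, g). (T y, \<phi> y \<otimes>\<^bsub>G\<^esub> g))"

lemma space_borel_of [simp]: "space (borel_of X) = topspace X"
  by (auto simp: borel_of_def space_measure_of_conv)

lemma openin_imp_sets_borel_of: "openin X U \<Longrightarrow> U \<in> sets (borel_of X)"
  unfolding borel_of_def using openin_subset by (subst sets_measure_of) auto

lemma dist_ge_measurable:
  assumes d: "bi_invariant_metric G X d" and sc: "second_countable X"
    and f: "\<phi> \<in> measurable M (borel_of X)" and g: "\<psi> \<in> measurable M (borel_of X)"
  shows "{y \<in> space M. d (\<phi> y) (\<psi> y) \<ge> e} \<in> sets M"
proof -
  interpret Metric_space "carrier G" d
    using d by (simp add: bi_invariant_metric_def)
  have X: "mtopology = X" using d by (simp add: bi_invariant_metric_def)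
  have tX: "topspace X = carrier G" using X topspace_mtopology by metis
  obtain B where B: "countable B" "\<And>V. V \<in> B \<Longrightarrow> openin X V"
      "\<And>U x. openin X U \<Longrightarrow> x \<in> U \<Longrightarrow> \<exists>V\<in>B. x \<in> V \<and> V \<subseteq> U"
    using sc unfolding second_countable_def by metis
  define J where "J = {(U, V) \<in> B \<times> B. \<forall>u\<in>U. \<forall>v\<in>V. d u v < e}"
  have J: "countable J"
    by (rule countable_subset[of _ "B \<times> B"]) (use B(1) in \<open>auto simp: J_def\<close>)
  have "{y \<in> space M. d (\<phi> y) (\<psi> y) < e} =
      (\<Union>(U, V)\<in>J. (\<phi> -` U \<inter> space M) \<inter> (\<psi> -` V \<inter> space M))" (is "?L = ?R")
  proof
    show "?R \<subseteq> ?L" by (auto simp: J_def)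
    show "?L \<subseteq> ?R"
    proof
      fix y assume "y \<in> ?L"
      then have y: "y \<in> space M" and lt: "d (\<phi> y) (\<psi> y) < e" by auto
      have c: "\<phi> y \<in> carrier G" "\<psi> y \<in> carrier G"
        using measurable_space[OF f y] measurable_space[OF g y] tX by auto
      define r where "r = (e - d (\<phi> y) (\<psi> y)) / 2"
      have r: "r > 0" using lt by (simp add: r_def)
      obtain U where U: "U \<in> B" "\<phi> y \<in> U" "U \<subseteq> mball (\<phi> y) r"
        using B(3)[of "mball (\<phi> y) r" "\<phi> y"] c r X by auto
      obtain V where V: "V \<in> B" "\<psi> y \<in> V" "V \<subseteq> mball (\<psi> y) r"
        using B(3)[of "mball (\<psi> y) r" "\<psi> y"] c r X by auto
      have "d u v < e" if "u \<in> U" "v \<in> V" for u v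
      proof -
        have 1: "u \<in> carrier G" "d (\<phi> y) u < r" using that U by auto
        have 2: "v \<in> carrier G" "d (\<psi> y) v < r" using that V by auto
        have "d u v \<le> d u (\<phi> y) + d (\<phi> y) v" using 1 2 c triangle by blast
        also have "d (\<phi> y) v \<le> d (\<phi> y) (\<psi> y) + d (\<psi> y) v" using 1 2 c triangle by blast
        finally show ?thesis using 1 2 commute[of u "\<phi> y"] by (simp add: r_def field_simps)
      qed
      then have "(U, V) \<in> J" using U V by (auto simp: J_def)
      then show "y \<in> ?R" using U V y by blast
    qed
  qed
  also have "\<dots> \<in> sets M"
    using J B(2) openin_imp_sets_borel_of
    by (intro sets.countable_UN') (auto simp: J_def intro!: sets.Int measurable_sets[OF f] measurable_sets[OF g])
  finally have "space M - {y \<in> space M. d (\<phi> y) (\<psi> y) < e} \<in> sets M" by blast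
  also have "space M - {y \<in> space M. d (\<phi> y) (\<psi> y) < e} = {y \<in> space M. d (\<phi> y) (\<psi> y) \<ge> e}"
    by auto
  finally show ?thesis .
qed

lemma istopology_cocycle_open:
  assumes "finite_measure M" "bi_invariant_metric G X d" "second_countable X"
  shows "istopology (cocycle_open M X d)"
  unfolding istopology_def
proof (intro conjI allI impI)
  interpret finite_measure M by fact
  fix U V assume UV: "cocycle_open M X d U" "cocycle_open M X d V"
  show "cocycle_open M X d (U \<inter> V)"
    unfolding cocycle_open_def
  proof (intro conjI ballI impI)
    show "U \<inter> V \<subseteq> cocycles M X" using UV by (auto simp: cocycle_open_def)
    fix \<phi> assume f: "\<phi> \<in> measurable M (borel_of X)" and c: "cocycle_class M X \<phi> \<in> U \<inter> V"
    obtain a where a: "a > 0" "\<And>\<psi>. \<psi> \<in> measurable M (borel_of X) \<Longrightarrow>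
        measure M {y \<in> space M. d (\<phi> y) (\<psi> y) \<ge> a} < a \<Longrightarrow> cocycle_class M X \<psi> \<in> U"
      using UV(1) f c unfolding cocycle_open_def by blast
    obtain b where b: "b > 0" "\<And>\<psi>. \<psi> \<in> measurable M (borel_of X) \<Longrightarrow>
        measure M {y \<in> space M. d (\<phi> y) (\<psi> y) \<ge> b} < b \<Longrightarrow> cocycle_class M X \<psi> \<in> V"
      using UV(2) f c unfolding cocycle_open_def by blast
    show "\<exists>e>0. \<forall>\<psi>\<in>measurable M (borel_of X).
        measure M {y \<in> space M. d (\<phi> y) (\<psi> y) \<ge> e} < e \<longrightarrow> cocycle_class M X \<psi> \<in> U \<inter> V"
    proof (intro exI[of _ "min a b"] conjI ballI impI)
      show "min a b > 0" using a b by simp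
      fix \<psi> assume g: "\<psi> \<in> measurable M (borel_of X)"
        and m: "measure M {y \<in> space M. d (\<phi> y) (\<psi> y) \<ge> min a b} < min a b"
      have mono: "measure M {y \<in> space M. d (\<phi> y) (\<psi> y) \<ge> t}
          \<le> measure M {y \<in> space M. d (\<phi> y) (\<psi> y) \<ge> min a b}" if "min a b \<le> t" for t
        by (rule finite_measure_mono) (use that dist_ge_measurable[OF assms(2,3) f g] in auto)
      show "cocycle_class M X \<psi> \<in> U \<inter> V"
        using a(2)[OF g] b(2)[OF g] mono[of a] mono[of b] m by auto
    qed
  qed
next
  fix \<K> assume K: "\<forall>U\<in>\<K>. cocycle_open M X d U"
  show "cocycle_open M X d (\<Union>\<K>)"
    unfolding cocycle_open_def
  proof (intro conjI ballI impI)
    show "\<Union>\<K> \<subseteq> cocycles M X" using K by (auto simp: cocycle_open_def)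
    fix \<phi> assume f: "\<phi> \<in> measurable M (borel_of X)" and c: "cocycle_class M X \<phi> \<in> \<Union>\<K>"
    then obtain U where "U \<in> \<K>" "cocycle_class M X \<phi> \<in> U" by blast
    with K f show "\<exists>e>0. \<forall>\<psi>\<in>measurable M (borel_of X).
        measure M {y \<in> space M. d (\<phi> y) (\<psi> y) \<ge> e} < e \<longrightarrow> cocycle_class M X \<psi> \<in> \<Union>\<K>"
      unfolding cocycle_open_def by (meson UnionI)
  qed
qed

lemma openin_cocycle_topology:
  assumes "finite_measure M" "bi_invariant_metric G X d" "second_countable X"
  shows "openin (cocycle_topology M X d) U \<longleftrightarrow> cocycle_open M X d U"
  unfolding cocycle_topology_def
  using topology_inverse'[OF istopology_cocycle_open[OF assms]] by simp

lemma topspace_cocycle_topology: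
  assumes "finite_measure M" "bi_invariant_metric G X d" "second_countable X"
  shows "topspace (cocycle_topology M X d) = cocycles M X"
proof -
  have "cocycle_open M X d (cocycles M X)"
    unfolding cocycle_open_def cocycles_def by (auto intro!: exI[of _ 1])
  then show ?thesis
    unfolding topspace_def openin_cocycle_topology[OF assms] by (auto simp: cocycle_open_def)
qed

lemma is_system_one_point: "is_system one_point id"
proof -
  have [simp]: "space one_point = UNIV" "sets one_point = UNIV"
    by (auto simp: one_point_def)
  have "prob_space one_point"
    unfolding one_point_def by (rule prob_space_return) simp
  moreover have "sets (borel_of (discrete_topology (UNIV :: unit set))) = UNIV"
    by (auto intro!: openin_imp_sets_borel_of)
  moreover have "second_countable (discrete_topology (UNIV :: unit set))"
    unfolding second_countable_def by (rule exI[of _ UNIV]) (auto intro: countable_finite)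
  moreover have "completely_metrizable_space (discrete_topology (UNIV :: unit set))"
    by (rule completely_metrizable_space_discrete_topology)
  ultimately have "standard_probability_space one_point"
    unfolding standard_probability_space_def
    by (intro conjI exI[of _ "discrete_topology UNIV"]) auto
  moreover have "distr one_point one_point id = one_point"
    unfolding id_def by (rule distr_id)
  ultimately show ?thesis
    unfolding is_system_def by (auto simp: measurable_def)
qed

lemma is_extension_one_point:
  assumes "is_system M T"
  shows "is_extension M T one_point id (\<lambda>_. ())"
proof -
  interpret prob_space M
    using assms by (simp add: is_system_def standard_probability_space_def)
  have m: "(\<lambda>_. ()) \<in> measurable M one_point"
    by (simp add: one_point_def)
  have "distr M one_point (\<lambda>_. ()) = one_point"
  proof (rule measure_eqI)
    fix A assume "A \<in> sets (distr M one_point (\<lambda>_. ()))"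
    then show "emeasure (distr M one_point (\<lambda>_. ())) A = emeasure one_point A"
      using m emeasure_space_1
      by (cases "A = {}") (auto simp: emeasure_distr one_point_def UNIV_unit vimage_def indicator_def)
  qed simp
  then show ?thesis
    using assms m is_system_one_point by (auto simp: is_extension_def)
qed

end

theory Submission
  imports Defs
begin

text \<open>
  Let \<open>\<nu> = \<integral> \<mu>\<^sub>z \<times> \<mu>\<^sub>z d\<theta>(z)\<close>. The relative product of \<open>Y\<^sub>\<phi>\<close> with itself is the skew product over
  \<open>(Y \<times> Y, \<nu>, T \<times> T)\<close> with fibre \<open>G \<times> G\<close> and cocycle \<open>(\<phi> y, \<phi> y')\<close>. It is ergodic as soon as, for
  countably many functions \<open>1\<^sub>A(y) 1\<^sub>B(y') u(h) v(h')\<close> with Lipschitz \<open>u\<close>, \<open>v\<close>, some Birkhoff averages come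
  arbitrarily close to the mean in \<open>L\<^sup>1\<close>. By bi-invariance of the metric each average depends on \<open>\<phi>\<close> in a
  Lipschitz way, so these conditions are open, and by Baire's theorem it suffices that each of them holds
  on a dense set.

  For density, perturb a given cocycle to a coboundary \<open>\<phi> y = g (T y) (g y)\<inverse>\<close>: over a set \<open>A\<close> of small
  measure, \<open>g\<close> is chosen freely on \<open>A\<close> and transported along the orbits by the given cocycle, which changes
  the cocycle only where \<open>T y \<in> A\<close>. The averages of the skew product then converge to the integral of
  the function twisted by \<open>(g y, g y')\<close> over \<open>\<nu>\<close>. If \<open>g\<close> takes independent Haar-distributed values on
  the cells of a fine partition, a second moment estimate shows that this integral is close to the mean,
  because almost no pair \<open>(y, y')\<close> has both base points in the same cell: \<open>\<nu>\<close> does not charge the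
  diagonal, since otherwise the invariant diagonal would have full measure and the extension would be
  trivial.
\<close>

section \<open>Borel structure of second countable spaces\<close>

text \<open>A coboundary never solves the problem when \<open>G\<close> has more than one element:
  its skew product is conjugate to \<open>T\<close> times the identity, so its averages tend to a
  twisted integral and not to the mean. But density has to meet only one condition at a time, up to
  a tolerance \<open>e\<close>, and for that a near miss suffices; Baire's theorem then combines the
  conditions into ergodicity. This is why each condition asks for a single \<open>n\<close> with
  defect below \<open>e\<close> instead of a limit: such a condition is open in the cocycle, even
  though the Lipschitz constant grows with \<open>n\<close>. The random elements belong to the cell
  of the base point on \<open>A\<close> and not to the cell of \<open>y\<close> itself; otherwise
  they would change along orbits and alter the cocycle far from \<open>A\<close>. The price is that
  equal base points only force two orbits to meet. So the null diagonal is used in a stronger form: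
  almost no pair has orbits that meet. It follows because \<open>T\<close> is injective and the
  conditional measures have no atoms.\<close>

lemma sets_borel_of_base:
  assumes "countable B" "\<And>V. V \<in> B \<Longrightarrow> openin X V"
    "\<And>U x. openin X U \<Longrightarrow> x \<in> U \<Longrightarrow> \<exists>V\<in>B. x \<in> V \<and> V \<subseteq> U"
  shows "sets (borel_of X) = sigma_sets (topspace X) B"
proof -
  have sub: "B \<subseteq> Pow (topspace X)" using assms(2) openin_subset by blast
  have "sets (borel_of X) = sigma_sets (topspace X) {U. openin X U}"
    unfolding borel_of_def using openin_subset by (subst sets_measure_of) auto
  also have "\<dots> = sigma_sets (topspace X) B"
  proof (rule sigma_sets_eqI)
    fix U assume "U \<in> {U. openin X U}"
    then have "U = \<Union>{V\<in>B. V \<subseteq> U}" using assms(3) by blast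
    also have "\<dots> \<in> sigma_sets (topspace X) B"
      by (intro sigma_sets_UNION) (auto intro: countable_subset[OF _ assms(1)])
    finally show "U \<in> sigma_sets (topspace X) B" .
  qed (use assms(2) in auto)
  finally show ?thesis .
qed

text \<open>Closing a countable base under finite intersections keeps it countable and makes it a
  pi-system, as the Dynkin argument in \<open>is_ergodic_generatorI\<close> requires. The factor
  \<open>topspace X\<close> turns the empty intersection into the whole space instead of the whole
  type.\<close>

lemma second_countable_pi_base:
  assumes "second_countable X"
  obtains B where "countable B" "\<And>V. V \<in> B \<Longrightarrow> openin X V"
    "\<And>U x. openin X U \<Longrightarrow> x \<in> U \<Longrightarrow> \<exists>V\<in>B. x \<in> V \<and> V \<subseteq> U"
    "Int_stable B" "topspace X \<in> B" "sets (borel_of X) = sigma_sets (topspace X) B"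
proof -
  obtain B0 where B0: "countable B0" "\<And>V. V \<in> B0 \<Longrightarrow> openin X V"
      "\<And>U x. openin X U \<Longrightarrow> x \<in> U \<Longrightarrow> \<exists>V\<in>B0. x \<in> V \<and> V \<subseteq> U"
    using assms unfolding second_countable_def by metis
  define B where "B = (\<lambda>F. topspace X \<inter> \<Inter>F) ` {F. finite F \<and> F \<subseteq> B0}"
  have c: "countable B"
    unfolding B_def by (intro countable_image countable_Collect_finite_subset B0)
  have o: "openin X V" if V: "V \<in> B" for V
  proof -
    obtain F where F: "finite F" "F \<subseteq> B0" "V = topspace X \<inter> \<Inter>F" using V by (auto simp: B_def)
    have "openin X (topspace X \<inter> \<Inter>F)" using F(1,2)
    proof (induction F)
      case (insert a F)
      have "openin X a" "openin X (topspace X \<inter> \<Inter>F)"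
        using insert.prems insert.IH B0(2)[of a] by simp_all
      then have "openin X (a \<inter> (topspace X \<inter> \<Inter>F))" by (rule openin_Int)
      moreover have "a \<inter> (topspace X \<inter> \<Inter>F) = topspace X \<inter> \<Inter>(insert a F)" by auto
      ultimately show ?case by simp
    qed simp
    then show ?thesis using F by simp
  qed
  have b: "\<exists>V\<in>B. x \<in> V \<and> V \<subseteq> U" if Ux: "openin X U" "x \<in> U" for U x
  proof -
    obtain V where V: "V \<in> B0" "x \<in> V" "V \<subseteq> U" using B0(3)[OF Ux] by blast
    have "V = topspace X \<inter> \<Inter>{V}" using openin_subset[OF B0(2)[OF V(1)]] by auto
    then have "V \<in> B" unfolding B_def using V(1) by blast
    then show ?thesis using V by blast
  qed
  have i: "Int_stable B"
  proof (rule Int_stableI)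
    fix a b assume "a \<in> B" "b \<in> B"
    then obtain F H where "finite F" "F \<subseteq> B0" "a = topspace X \<inter> \<Inter>F"
      "finite H" "H \<subseteq> B0" "b = topspace X \<inter> \<Inter>H" by (auto simp: B_def)
    then have "finite (F \<union> H)" "F \<union> H \<subseteq> B0" "a \<inter> b = topspace X \<inter> \<Inter>(F \<union> H)" by auto
    then show "a \<inter> b \<in> B" unfolding B_def by blast
  qed
  have t: "topspace X \<in> B" unfolding B_def by (rule image_eqI[of _ _ "{}"]) auto
  show thesis by (rule that[OF c o b i t sets_borel_of_base[OF c o b]])
qed

text \<open>Both claims come from the countable base of boxes, which generates the product
  sigma-algebra and the Borel sets of the product topology alike. Multiplication is continuous for
  the product topology; this turns it into a measurable map on
  \<open>L \<Otimes>\<^sub>M L\<close>.\<close>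

lemma second_countable_prod_topology_and_borel:
  assumes "second_countable X" "second_countable Y"
  shows "second_countable (prod_topology X Y) \<and>
    sets (borel_of X \<Otimes>\<^sub>M borel_of Y) = sets (borel_of (prod_topology X Y))"
proof -
  obtain A where A: "countable A" "\<And>V. V \<in> A \<Longrightarrow> openin X V"
    "\<And>U x. openin X U \<Longrightarrow> x \<in> U \<Longrightarrow> \<exists>V\<in>A. x \<in> V \<and> V \<subseteq> U"
    "Int_stable A" "topspace X \<in> A" "sets (borel_of X) = sigma_sets (topspace X) A"
    using second_countable_pi_base[OF assms(1)] by blast
  obtain B where B: "countable B" "\<And>V. V \<in> B \<Longrightarrow> openin Y V"
    "\<And>U x. openin Y U \<Longrightarrow> x \<in> U \<Longrightarrow> \<exists>V\<in>B. x \<in> V \<and> V \<subseteq> U"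
    "Int_stable B" "topspace Y \<in> B" "sets (borel_of Y) = sigma_sets (topspace Y) B"
    using second_countable_pi_base[OF assms(2)] by blast
  define C where "C = {a \<times> b |a b. a \<in> A \<and> b \<in> B}"
  have "C = (\<lambda>(a, b). a \<times> b) ` (A \<times> B)" by (auto simp: C_def)
  then have C1: "countable C" using A(1) B(1) by auto
  have C2: "\<And>V. V \<in> C \<Longrightarrow> openin (prod_topology X Y) V"
    using A(2) B(2) by (auto simp: C_def openin_prod_Times_iff)
  have C3: "\<exists>V\<in>C. x \<in> V \<and> V \<subseteq> U" if Ux: "openin (prod_topology X Y) U" "x \<in> U" for U x
  proof -
    obtain x1 x2 where x: "x = (x1, x2)" by (cases x)
    obtain U1 U2 where U: "openin X U1" "openin Y U2" "x1 \<in> U1" "x2 \<in> U2" "U1 \<times> U2 \<subseteq> U"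
      using Ux(1)[unfolded openin_prod_topology_alt, rule_format, of x1 x2] Ux(2) x by blast
    obtain a where "a \<in> A" "x1 \<in> a" "a \<subseteq> U1"
      using A(3)[OF U(1,3)] by blast
    moreover obtain b where "b \<in> B" "x2 \<in> b" "b \<subseteq> U2"
      using B(3)[OF U(2,4)] by blast
    ultimately show ?thesis using U(5) unfolding C_def x by (intro bexI[of _ "a \<times> b"]) auto
  qed
  have subs: "A \<subseteq> Pow (topspace X)" "B \<subseteq> Pow (topspace Y)"
    using openin_subset[OF A(2)] openin_subset[OF B(2)] by blast+
  have "sets (borel_of X \<Otimes>\<^sub>M borel_of Y) =
     sets (sigma (space (borel_of X) \<times> space (borel_of Y)) {a \<times> b |a b. a \<in> A \<and> b \<in> B})"
    by (rule sets_pair_eq[where Ca="{topspace X}" and Cb="{topspace Y}"])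
       (use A(5,6) B(5,6) subs in auto)
  also have "\<dots> = sigma_sets (topspace (prod_topology X Y)) C"
    using subs unfolding C_def[symmetric] by (subst sets_measure_of) (auto simp: C_def)
  also have "\<dots> = sets (borel_of (prod_topology X Y))"
    using sets_borel_of_base[OF C1 C2 C3] by simp
  finally have b: "sets (borel_of X \<Otimes>\<^sub>M borel_of Y) = sets (borel_of (prod_topology X Y))" .
  have "second_countable (prod_topology X Y)"
    unfolding second_countable_def
    by (intro exI[of _ C] conjI ballI allI impI) (erule C1 C2 conjE C3 | rule C1 C3 | assumption)+
  with b show ?thesis by simp
qed

lemmas second_countable_prod_topology = second_countable_prod_topology_and_borel[THEN conjunct1]
lemmas sets_pair_borel_of = second_countable_prod_topology_and_borel[THEN conjunct2]

lemma continuous_map_measurable_borel_of: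
  assumes "continuous_map X Y f"
  shows "f \<in> measurable (borel_of X) (borel_of Y)"
  unfolding borel_of_def[of Y]
proof (rule measurable_measure_of)
  show "f \<in> space (borel_of X) \<rightarrow> topspace Y"
    using continuous_map_funspace[OF assms] by simp
  fix U assume "U \<in> {U. openin Y U}"
  then have "openin X {x \<in> topspace X. f x \<in> U}"
    using assms openin_continuous_map_preimage by fastforce
  moreover have "f -` U \<inter> space (borel_of X) = {x \<in> topspace X. f x \<in> U}" by auto
  ultimately show "f -` U \<inter> space (borel_of X) \<in> sets (borel_of X)"
    using openin_imp_sets_borel_of by simp
qed (use openin_subset in auto)

text \<open>The Hausdorff property gives the last clause, countably many measurable sets that
  separate points. They make the coincidence of two measurable maps a measurable event and supply
  the partitions into cells.\<close>

lemma standard_probability_space_pi_system: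
  assumes "standard_probability_space M"
  obtains B where "countable B" "Int_stable B" "space M \<in> B" "B \<subseteq> sets M"
    "sets M = sigma_sets (space M) B"
    "\<And>x y. x \<in> space M \<Longrightarrow> y \<in> space M \<Longrightarrow> x \<noteq> y \<Longrightarrow> \<exists>A\<in>B. x \<in> A \<and> y \<notin> A"
proof -
  obtain X where X: "completely_metrizable_space X" "second_countable X"
    "topspace X = space M" "sets M = sets (borel_of X)"
    using assms by (auto simp: standard_probability_space_def)
  obtain B where B: "countable B" "\<And>V. V \<in> B \<Longrightarrow> openin X V"
    "\<And>U x. openin X U \<Longrightarrow> x \<in> U \<Longrightarrow> \<exists>V\<in>B. x \<in> V \<and> V \<subseteq> U"
    "Int_stable B" "topspace X \<in> B" "sets (borel_of X) = sigma_sets (topspace X) B"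
    using second_countable_pi_base[OF X(2)] by blast
  have H: "Hausdorff_space X"
    using X(1) completely_metrizable_imp_metrizable_space metrizable_imp_Hausdorff_space by blast
  have "\<exists>A\<in>B. x \<in> A \<and> y \<notin> A" if xy: "x \<in> space M" "y \<in> space M" "x \<noteq> y" for x y
  proof -
    obtain U V where "openin X U" "openin X V" "x \<in> U" "y \<in> V" "disjnt U V"
      using H xy X(3) unfolding Hausdorff_space_def by metis
    then show ?thesis using B(3)[of U x] by (meson disjnt_iff subset_iff)
  qed
  then show thesis
    using that[of B] B X openin_imp_sets_borel_of by auto
qed

text \<open>Two points differ exactly if some member of the countable separating family contains the
  first and misses the second. Separation holds for ordered pairs, so one-sided differences
  suffice.\<close>

lemma equal_set_measurable:
  assumes "standard_probability_space N"
    and f: "f \<in> measurable M N" and g: "g \<in> measurable M N"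
  shows "{x \<in> space M. f x = g x} \<in> sets M"
proof -
  obtain B where B: "countable B" "B \<subseteq> sets N"
    "\<And>x y. x \<in> space N \<Longrightarrow> y \<in> space N \<Longrightarrow> x \<noteq> y \<Longrightarrow> \<exists>A\<in>B. x \<in> A \<and> y \<notin> A"
    using standard_probability_space_pi_system[OF assms(1)] by metis
  have "{x \<in> space M. f x = g x} =
      space M - (\<Union>A\<in>B. (f -` A \<inter> space M) - (g -` A \<inter> space M))"
  proof (intro equalityI subsetI)
    fix x assume x: "x \<in> space M - (\<Union>A\<in>B. (f -` A \<inter> space M) - (g -` A \<inter> space M))"
    then have "f x = g x"
      using B(3)[of "f x" "g x"] measurable_space[OF f, of x] measurable_space[OF g, of x] by blast
    then show "x \<in> {x \<in> space M. f x = g x}" using x by blast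
  qed auto
  also have "\<dots> \<in> sets M"
    using B(1,2) f g by (intro sets.Diff sets.top sets.countable_UN') (auto intro: measurable_sets)
  finally show ?thesis .
qed

lemma standard_probability_space_pair:
  assumes M: "standard_probability_space M" and N: "standard_probability_space N"
  shows "standard_probability_space (M \<Otimes>\<^sub>M N)"
proof -
  obtain X where X: "completely_metrizable_space X" "second_countable X"
    "topspace X = space M" "sets M = sets (borel_of X)"
    using M by (auto simp: standard_probability_space_def)
  obtain Y where Y: "completely_metrizable_space Y" "second_countable Y"
    "topspace Y = space N" "sets N = sets (borel_of Y)"
    using N by (auto simp: standard_probability_space_def)
  interpret M: prob_space M using M by (simp add: standard_probability_space_def)
  interpret N: prob_space N using N by (simp add: standard_probability_space_def)
  interpret pair_prob_space M N ..
  have "prob_space (M \<Otimes>\<^sub>M N)" by (rule prob_space_axioms)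
  moreover have "sets (M \<Otimes>\<^sub>M N) = sets (borel_of (prod_topology X Y))"
    using sets_pair_borel_of[OF X(2) Y(2)] sets_pair_measure_cong[OF X(4) Y(4)] by simp
  moreover have "completely_metrizable_space (prod_topology X Y)"
    using X(1) Y(1) by (simp add: completely_metrizable_space_prod_topology)
  moreover have "topspace (prod_topology X Y) = space (M \<Otimes>\<^sub>M N)"
    by (simp add: space_pair_measure X(3) Y(3))
  ultimately show ?thesis
    unfolding standard_probability_space_def
    using second_countable_prod_topology[OF X(2) Y(2)] by blast
qed

section \<open>Measure preserving maps and compact metric groups\<close>

text \<open>Invertibility and standardness are dropped from \<open>is_system\<close>, since the
  notion is also applied to the squares \<open>\<nu>\<close> and \<open>V\<close> and to fibre
  translations there.\<close>

definition measure_preserving :: "'a measure \<Rightarrow> ('a \<Rightarrow> 'a) \<Rightarrow> bool" where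
  "measure_preserving M T \<longleftrightarrow> T \<in> measurable M M \<and> distr M M T = M"

lemma measure_preserving_measurable: "measure_preserving M T \<Longrightarrow> T \<in> measurable M M"
  by (simp add: measure_preserving_def)

lemma measure_preserving_space: "measure_preserving M T \<Longrightarrow> x \<in> space M \<Longrightarrow> T x \<in> space M"
  by (metis measure_preserving_measurable measurable_space)

lemma measure_preserving_integral:
  fixes f :: "'a \<Rightarrow> real"
  assumes "measure_preserving M T" "f \<in> borel_measurable M"
  shows "(\<integral>x. f (T x) \<partial>M) = (\<integral>x. f x \<partial>M)"
  using integral_distr[of T M M f] assms by (simp add: measure_preserving_def)

lemma measure_preserving_integrable:
  fixes f :: "'a \<Rightarrow> real"
  assumes "measure_preserving M T" "integrable M f"
  shows "integrable M (\<lambda>x. f (T x))"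
  using integrable_distr[of T M M f] assms by (simp add: measure_preserving_def)

lemma measure_preserving_nn_integral:
  assumes "measure_preserving M T" "f \<in> borel_measurable M"
  shows "(\<integral>\<^sup>+x. f (T x) \<partial>M) = (\<integral>\<^sup>+x. f x \<partial>M)"
  using nn_integral_distr[of T M M f] assms by (simp add: measure_preserving_def)

lemma measure_preserving_AE:
  assumes "measure_preserving M T" "AE x in M. P x"
  shows "AE x in M. P (T x)"
  using AE_distrD[of T M M P] assms unfolding measure_preserving_def by metis

lemma measure_preserving_funpow:
  assumes "measure_preserving M T"
  shows "measure_preserving M (T ^^ n)"
proof (induction n)
  case 0
  show ?case by (simp add: measure_preserving_def distr_id2 id_def)
next
  case (Suc n)
  have "distr M M (T \<circ> (T ^^ n)) = distr (distr M M (T ^^ n)) M T"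
    using Suc assms by (subst distr_distr) (auto simp: measure_preserving_def)
  moreover have "T \<circ> (T ^^ n) \<in> measurable M M"
    using Suc assms by (auto simp: measure_preserving_def intro: measurable_comp)
  ultimately show ?case using Suc assms unfolding measure_preserving_def funpow.simps by metis
qed

text \<open>By Tonelli the fibre maps can be removed for each base point separately, and then the
  base map. Only joint measurability relates the fibre maps over different base points, so every
  measurable cocycle is allowed.\<close>

lemma measure_preserving_skew:
  assumes "prob_space B" "prob_space L" "measure_preserving B S"
    and m: "(\<lambda>(b, x). \<theta> b x) \<in> measurable (B \<Otimes>\<^sub>M L) L"
    and inv: "\<And>b. b \<in> space B \<Longrightarrow> distr L L (\<theta> b) = L"
  shows "measure_preserving (B \<Otimes>\<^sub>M L) (\<lambda>(b, x). (S b, \<theta> b x))"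
proof -
  interpret B: prob_space B by fact
  interpret L: prob_space L by fact
  interpret pair_prob_space B L ..
  have [measurable]: "S \<in> measurable B B" using assms(3) by (rule measure_preserving_measurable)
  have m2[measurable]: "(\<lambda>x. \<theta> (fst x) (snd x)) \<in> measurable (B \<Otimes>\<^sub>M L) L"
    using m by (simp add: case_prod_beta')
  define \<Psi> where "\<Psi> = (\<lambda>(b, x). (S b, \<theta> b x))"
  have \<Psi>[measurable]: "\<Psi> \<in> measurable (B \<Otimes>\<^sub>M L) (B \<Otimes>\<^sub>M L)"
    unfolding \<Psi>_def case_prod_beta' by measurable
  have "distr (B \<Otimes>\<^sub>M L) (B \<Otimes>\<^sub>M L) \<Psi> = B \<Otimes>\<^sub>M L"
  proof (rule measure_eqI)
    fix A assume "A \<in> sets (distr (B \<Otimes>\<^sub>M L) (B \<Otimes>\<^sub>M L) \<Psi>)"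
    then have A[measurable]: "A \<in> sets (B \<Otimes>\<^sub>M L)" by simp
    define F where "F = (indicator A :: _ \<Rightarrow> ennreal)"
    have F[measurable]: "F \<in> borel_measurable (B \<Otimes>\<^sub>M L)" by (simp add: F_def)
    have "emeasure (distr (B \<Otimes>\<^sub>M L) (B \<Otimes>\<^sub>M L) \<Psi>) A = (\<integral>\<^sup>+z. F z \<partial>distr (B \<Otimes>\<^sub>M L) (B \<Otimes>\<^sub>M L) \<Psi>)"
      by (simp add: F_def)
    also have "\<dots> = (\<integral>\<^sup>+z. F (\<Psi> z) \<partial>(B \<Otimes>\<^sub>M L))"
      by (subst nn_integral_distr) auto
    also have "\<dots> = (\<integral>\<^sup>+b. \<integral>\<^sup>+x. F (S b, \<theta> b x) \<partial>L \<partial>B)"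
      by (subst L.nn_integral_fst[symmetric]) (auto simp: \<Psi>_def)
    also have "\<dots> = (\<integral>\<^sup>+b. \<integral>\<^sup>+x. F (S b, x) \<partial>L \<partial>B)"
    proof (rule nn_integral_cong)
      fix b assume b: "b \<in> space B"
      have "\<theta> b \<in> measurable L L" using measurable_Pair2[OF m b] by simp
      moreover have "(\<lambda>x. F (S b, x)) \<in> borel_measurable L"
        using b by measurable
      ultimately have "(\<integral>\<^sup>+x. F (S b, x) \<partial>distr L L (\<theta> b)) = (\<integral>\<^sup>+x. F (S b, \<theta> b x) \<partial>L)"
        by (subst nn_integral_distr) auto
      then show "(\<integral>\<^sup>+x. F (S b, \<theta> b x) \<partial>L) = (\<integral>\<^sup>+x. F (S b, x) \<partial>L)"
        using inv[OF b] by simp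
    qed
    also have "\<dots> = (\<integral>\<^sup>+b. \<integral>\<^sup>+x. F (b, x) \<partial>L \<partial>B)"
      by (rule measure_preserving_nn_integral[OF assms(3), where f="\<lambda>b. \<integral>\<^sup>+x. F (b, x) \<partial>L"])
         measurable
    also have "\<dots> = (\<integral>\<^sup>+z. F z \<partial>(B \<Otimes>\<^sub>M L))"
      by (rule L.nn_integral_fst) measurable
    also have "\<dots> = emeasure (B \<Otimes>\<^sub>M L) A" by (simp add: F_def)
    finally show "emeasure (distr (B \<Otimes>\<^sub>M L) (B \<Otimes>\<^sub>M L) \<Psi>) A = emeasure (B \<Otimes>\<^sub>M L) A" .
  qed simp
  then show ?thesis using \<Psi> unfolding \<Psi>_def measure_preserving_def by simp
qed

section \<open>Compact groups with a bi-invariant metric: Haar measure and measurability\<close>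

locale compact_metric_group =
  fixes G :: "('g, 'm) monoid_scheme" and X :: "'g topology"
    and L :: "'g measure" and d :: "'g \<Rightarrow> 'g \<Rightarrow> real"
  assumes topological_group: "topological_group G X" and compact_space: "compact_space X"
    and second_countable: "second_countable X" and haar: "haar_measure G X L"
    and metric: "bi_invariant_metric G X d"
begin

sublocale group G
  using topological_group by (simp add: topological_group_def)

sublocale L: prob_space L
  using haar by (simp add: haar_measure_def)

sublocale MG: Metric_space "carrier G" d
  using metric by (simp add: bi_invariant_metric_def)

lemma mtopology_eq: "MG.mtopology = X"
  using metric by (simp add: bi_invariant_metric_def)

lemma topspace_X: "topspace X = carrier G"
  using topological_group by (simp add: topological_group_def)

lemma sets_L: "sets L = sets (borel_of X)"
  using haar by (simp add: haar_measure_def)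

lemma space_L: "space L = carrier G"
  using sets_eq_imp_space_eq[OF sets_L] topspace_X by simp

lemma measurable_L_iff: "measurable M L = measurable M (borel_of X)"
  by (rule measurable_cong_sets) (simp_all add: sets_L)

lemma measurable_L_closed: "f \<in> measurable M L \<Longrightarrow> y \<in> space M \<Longrightarrow> f y \<in> carrier G"
  using measurable_space space_L by metis

lemma d_mult_left: "g \<in> carrier G \<Longrightarrow> h \<in> carrier G \<Longrightarrow> k \<in> carrier G \<Longrightarrow> d (k \<otimes>\<^bsub>G\<^esub> g) (k \<otimes>\<^bsub>G\<^esub> h) = d g h"
  and d_mult_right: "g \<in> carrier G \<Longrightarrow> h \<in> carrier G \<Longrightarrow> k \<in> carrier G \<Longrightarrow> d (g \<otimes>\<^bsub>G\<^esub> k) (h \<otimes>\<^bsub>G\<^esub> k) = d g h"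
  using metric by (auto simp: bi_invariant_metric_def)

lemma sets_L_pair: "sets (L \<Otimes>\<^sub>M L) = sets (borel_of (prod_topology X X))"
  using sets_pair_borel_of[OF second_countable second_countable] sets_pair_measure_cong[OF sets_L sets_L]
  by simp

lemma measurable_mult_pair: "(\<lambda>(g, h). g \<otimes>\<^bsub>G\<^esub> h) \<in> measurable (L \<Otimes>\<^sub>M L) L"
proof -
  have "(\<lambda>(g, h). g \<otimes>\<^bsub>G\<^esub> h) \<in> measurable (borel_of (prod_topology X X)) (borel_of X)"
    using topological_group by (intro continuous_map_measurable_borel_of) (simp add: topological_group_def)
  then show ?thesis
    using measurable_cong_sets[OF sets_L_pair sets_L] by simp
qed

lemma measurable_mult[measurable (raw)]:
  assumes "f \<in> measurable M L" "g \<in> measurable M L"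
  shows "(\<lambda>x. f x \<otimes>\<^bsub>G\<^esub> g x) \<in> measurable M L"
  using measurable_compose[OF measurable_Pair[OF assms] measurable_mult_pair] by simp

lemma measurable_inv[measurable (raw)]:
  assumes "f \<in> measurable M L"
  shows "(\<lambda>x. inv\<^bsub>G\<^esub> (f x)) \<in> measurable M L"
proof -
  have "(\<lambda>g. inv\<^bsub>G\<^esub> g) \<in> measurable (borel_of X) (borel_of X)"
    using topological_group by (intro continuous_map_measurable_borel_of) (simp add: topological_group_def)
  then have "(\<lambda>g. inv\<^bsub>G\<^esub> g) \<in> measurable L L"
    using measurable_cong_sets[OF sets_L sets_L] by simp
  then show ?thesis by (rule measurable_compose[OF assms])
qed

lemma measurable_dist[measurable (raw)]:
  assumes "f \<in> measurable M L" "g \<in> measurable M L"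
  shows "(\<lambda>x. d (f x) (g x)) \<in> borel_measurable M"
  unfolding borel_measurable_iff_ge
  using dist_ge_measurable[OF metric second_countable, of f M g] assms measurable_L_iff by blast

lemma const_measurable: "g \<in> carrier G \<Longrightarrow> (\<lambda>_. g) \<in> measurable M L"
  using space_L by simp

lemma haar_left: "g \<in> carrier G \<Longrightarrow> distr L L (\<lambda>h. g \<otimes>\<^bsub>G\<^esub> h) = L"
proof (rule measure_eqI)
  assume g: "g \<in> carrier G"
  have [measurable]: "(\<lambda>_. inv\<^bsub>G\<^esub> g) \<in> measurable L L" "(\<lambda>_. g) \<in> measurable L L"
    using g const_measurable by auto
  fix A assume "A \<in> sets (distr L L (\<lambda>h. g \<otimes>\<^bsub>G\<^esub> h))"
  then have A: "A \<in> sets L" by simp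
  \<comment> \<open>\<open>haar_measure\<close> speaks of images of sets, \<open>distr\<close> of
    preimages; they are exchanged by passing from \<open>g\<close> to its inverse.\<close>
  have "(\<lambda>h. g \<otimes>\<^bsub>G\<^esub> h) -` A \<inter> space L = (\<lambda>h. inv\<^bsub>G\<^esub> g \<otimes>\<^bsub>G\<^esub> h) ` A"
  proof (intro equalityI subsetI)
    fix x assume x: "x \<in> (\<lambda>h. g \<otimes>\<^bsub>G\<^esub> h) -` A \<inter> space L"
    then have "x = inv\<^bsub>G\<^esub> g \<otimes>\<^bsub>G\<^esub> (g \<otimes>\<^bsub>G\<^esub> x)" using g space_L inv_solve_left' by (simp add: m_assoc[symmetric])
    then show "x \<in> (\<lambda>h. inv\<^bsub>G\<^esub> g \<otimes>\<^bsub>G\<^esub> h) ` A" using x by blast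
  next
    fix x assume "x \<in> (\<lambda>h. inv\<^bsub>G\<^esub> g \<otimes>\<^bsub>G\<^esub> h) ` A"
    then obtain a where a: "a \<in> A" "x = inv\<^bsub>G\<^esub> g \<otimes>\<^bsub>G\<^esub> a" by blast
    then have "a \<in> carrier G" using A space_L sets.sets_into_space by blast
    then show "x \<in> (\<lambda>h. g \<otimes>\<^bsub>G\<^esub> h) -` A \<inter> space L"
      using a g space_L by (simp add: m_assoc[symmetric])
  qed
  moreover have "emeasure L ((\<lambda>h. inv\<^bsub>G\<^esub> g \<otimes>\<^bsub>G\<^esub> h) ` A) = emeasure L A"
    using haar g A unfolding haar_measure_def by simp
  ultimately show "emeasure (distr L L (\<lambda>h. g \<otimes>\<^bsub>G\<^esub> h)) A = emeasure L A"
    using A by (subst emeasure_distr) auto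
qed simp

lemma haar_left_nn_integral:
  assumes "g \<in> carrier G" "f \<in> borel_measurable L"
  shows "(\<integral>\<^sup>+h. f (g \<otimes>\<^bsub>G\<^esub> h) \<partial>L) = (\<integral>\<^sup>+h. f h \<partial>L)"
proof -
  have "(\<lambda>h. g \<otimes>\<^bsub>G\<^esub> h) \<in> measurable L L" using const_measurable assms by measurable
  then show ?thesis
    using nn_integral_distr[of "\<lambda>h. g \<otimes>\<^bsub>G\<^esub> h" L L f] haar_left assms by simp
qed

text \<open>Averaging \<open>f (x\<inverse> y)\<close> over both variables in either order identifies \<open>L\<close> with its image under
  inversion; right invariance follows.\<close>

lemma haar_inv_nn_integral:
  assumes f[measurable]: "f \<in> borel_measurable L"
  shows "(\<integral>\<^sup>+h. f (inv\<^bsub>G\<^esub> h) \<partial>L) = (\<integral>\<^sup>+h. f h \<partial>L)"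
proof -
  interpret pair_prob_space L L ..
  have "(\<integral>\<^sup>+h. f h \<partial>L) = (\<integral>\<^sup>+x. \<integral>\<^sup>+y. f (inv\<^bsub>G\<^esub> x \<otimes>\<^bsub>G\<^esub> y) \<partial>L \<partial>L)"
  proof -
    have "(\<integral>\<^sup>+x. \<integral>\<^sup>+y. f (inv\<^bsub>G\<^esub> x \<otimes>\<^bsub>G\<^esub> y) \<partial>L \<partial>L) = (\<integral>\<^sup>+x. (\<integral>\<^sup>+h. f h \<partial>L) \<partial>L)"
      by (rule nn_integral_cong) (rule haar_left_nn_integral, auto simp: space_L)
    then show ?thesis by (simp add: L.emeasure_space_1)
  qed
  also have "\<dots> = (\<integral>\<^sup>+y. \<integral>\<^sup>+x. f (inv\<^bsub>G\<^esub> x \<otimes>\<^bsub>G\<^esub> y) \<partial>L \<partial>L)"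
    by (rule Fubini') measurable
  also have "\<dots> = (\<integral>\<^sup>+y. (\<integral>\<^sup>+h. f (inv\<^bsub>G\<^esub> h) \<partial>L) \<partial>L)"
  proof (rule nn_integral_cong)
    fix y assume "y \<in> space L"
    then have y: "y \<in> carrier G" by (simp add: space_L)
    have "(\<integral>\<^sup>+x. f (inv\<^bsub>G\<^esub> x \<otimes>\<^bsub>G\<^esub> y) \<partial>L) = (\<integral>\<^sup>+x. f (inv\<^bsub>G\<^esub> (inv\<^bsub>G\<^esub> y \<otimes>\<^bsub>G\<^esub> x)) \<partial>L)"
      using y by (intro nn_integral_cong) (simp add: space_L inv_mult_group)
    also have "\<dots> = (\<integral>\<^sup>+h. f (inv\<^bsub>G\<^esub> h) \<partial>L)"
      using y by (intro haar_left_nn_integral) auto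
    finally show "(\<integral>\<^sup>+x. f (inv\<^bsub>G\<^esub> x \<otimes>\<^bsub>G\<^esub> y) \<partial>L) = (\<integral>\<^sup>+h. f (inv\<^bsub>G\<^esub> h) \<partial>L)" .
  qed
  finally show ?thesis by (simp add: L.emeasure_space_1)
qed

lemma haar_right_nn_integral:
  assumes g: "g \<in> carrier G" and f[measurable]: "f \<in> borel_measurable L"
  shows "(\<integral>\<^sup>+h. f (h \<otimes>\<^bsub>G\<^esub> g) \<partial>L) = (\<integral>\<^sup>+h. f h \<partial>L)"
proof -
  have [measurable]: "(\<lambda>_. g) \<in> measurable L L" using g const_measurable by auto
  have "(\<integral>\<^sup>+h. f (h \<otimes>\<^bsub>G\<^esub> g) \<partial>L) = (\<integral>\<^sup>+h. f (inv\<^bsub>G\<^esub> h \<otimes>\<^bsub>G\<^esub> g) \<partial>L)"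
    by (rule haar_inv_nn_integral[symmetric]) measurable
  also have "\<dots> = (\<integral>\<^sup>+h. f (inv\<^bsub>G\<^esub> (inv\<^bsub>G\<^esub> g \<otimes>\<^bsub>G\<^esub> h)) \<partial>L)"
    using g by (intro nn_integral_cong) (simp add: space_L inv_mult_group)
  also have "\<dots> = (\<integral>\<^sup>+h. f (inv\<^bsub>G\<^esub> h) \<partial>L)"
    using g by (intro haar_left_nn_integral) auto
  finally show ?thesis by (simp add: haar_inv_nn_integral)
qed

text \<open>The two-sided form is needed because the random element of the transfer function stands
  between the transported cocycle on its left and the fibre coordinate on its right.\<close>

lemma haar_left_right_integral:
  fixes f :: "'g \<Rightarrow> real"
  assumes g: "g \<in> carrier G" and k: "k \<in> carrier G" and f[measurable]: "f \<in> borel_measurable L"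
  shows "(\<integral>h. f (g \<otimes>\<^bsub>G\<^esub> h \<otimes>\<^bsub>G\<^esub> k) \<partial>L) = (\<integral>h. f h \<partial>L)"
proof -
  have [measurable]: "(\<lambda>_. g) \<in> measurable L L" "(\<lambda>_. k) \<in> measurable L L"
    using g k const_measurable by auto
  have "distr L L (\<lambda>h. g \<otimes>\<^bsub>G\<^esub> h \<otimes>\<^bsub>G\<^esub> k) = L"
  proof (rule measure_eqI)
    fix A assume "A \<in> sets (distr L L (\<lambda>h. g \<otimes>\<^bsub>G\<^esub> h \<otimes>\<^bsub>G\<^esub> k))"
    then have A[measurable]: "A \<in> sets L" by simp
    have "emeasure (distr L L (\<lambda>h. g \<otimes>\<^bsub>G\<^esub> h \<otimes>\<^bsub>G\<^esub> k)) A
        = (\<integral>\<^sup>+x. indicator A x \<partial>distr L L (\<lambda>h. g \<otimes>\<^bsub>G\<^esub> h \<otimes>\<^bsub>G\<^esub> k))"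
      by simp
    also have "\<dots> = (\<integral>\<^sup>+h. indicator A (g \<otimes>\<^bsub>G\<^esub> h \<otimes>\<^bsub>G\<^esub> k) \<partial>L)"
      by (subst nn_integral_distr) auto
    also have "\<dots> = (\<integral>\<^sup>+h. indicator A (h \<otimes>\<^bsub>G\<^esub> k) \<partial>L)"
      using g by (intro haar_left_nn_integral[where f="\<lambda>h. indicator A (h \<otimes>\<^bsub>G\<^esub> k)"]) auto
    also have "\<dots> = (\<integral>\<^sup>+h. indicator A h \<partial>L)"
      using k by (intro haar_right_nn_integral) auto
    finally show "emeasure (distr L L (\<lambda>h. g \<otimes>\<^bsub>G\<^esub> h \<otimes>\<^bsub>G\<^esub> k)) A = emeasure L A" by simp
  qed simp
  then show ?thesis
    using integral_distr[of "\<lambda>h. g \<otimes>\<^bsub>G\<^esub> h \<otimes>\<^bsub>G\<^esub> k" L L f] by simp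
qed

lemma mcomplete: "MG.mcomplete"
  using MG.compact_space_imp_mcomplete compact_space mtopology_eq by simp

lemma dist_bounded: obtains D where "D > 0" "\<And>g h. g \<in> carrier G \<Longrightarrow> h \<in> carrier G \<Longrightarrow> d g h \<le> D"
proof -
  have "MG.mbounded (carrier G)"
    using MG.compactin_imp_mbounded compact_space mtopology_eq topspace_X
    by (simp add: compact_space_def)
  then show thesis using that unfolding MG.mbounded_alt_pos by blast
qed

lemma standard_L: "standard_probability_space L"
  unfolding standard_probability_space_def
  using MG.completely_metrizable_space_mtopology[OF mcomplete] mtopology_eq second_countable
    topspace_X space_L sets_L L.prob_space_axioms by auto

text \<open>Meant for pointwise limits of cocycles, where only the distances to fixed points are
  visibly measurable. Every open set is a countable union of balls centred in a countable dense set,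
  and the preimage of a ball is read off from one distance function.\<close>

lemma measurable_L_distI:
  assumes c: "\<And>y. y \<in> space M \<Longrightarrow> f y \<in> carrier G"
    and m: "\<And>g. g \<in> carrier G \<Longrightarrow> (\<lambda>y. d (f y) g) \<in> borel_measurable M"
  shows "f \<in> measurable M L"
proof -
  obtain B where B: "countable B" "\<And>V. V \<in> B \<Longrightarrow> openin X V"
      "\<And>U x. openin X U \<Longrightarrow> x \<in> U \<Longrightarrow> \<exists>V\<in>B. x \<in> V \<and> V \<subseteq> U"
    using second_countable unfolding second_countable_def by metis
  define q where "q V = (SOME x. x \<in> V)" for V :: "'g set"
  define Q where "Q = q ` (B - {{}})"
  have qV: "q V \<in> V" if "V \<in> B - {{}}" for V
    unfolding q_def using that by (simp add: some_in_eq)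
  have Q: "countable Q" "Q \<subseteq> carrier G"
  proof -
    show "countable Q" using B(1) unfolding Q_def by simp
    have "q V \<in> carrier G" if "V \<in> B - {{}}" for V
      using qV[OF that] openin_subset[OF B(2)[of V]] that topspace_X by auto
    then show "Q \<subseteq> carrier G" unfolding Q_def by blast
  qed
  have dense: "\<exists>g\<in>Q. d x g < e" if x: "x \<in> carrier G" "e > 0" for x e
  proof -
    have "openin X (MG.mball x e)" using MG.openin_mball mtopology_eq by metis
    then obtain V where V: "V \<in> B" "x \<in> V" "V \<subseteq> MG.mball x e"
      using B(3)[of "MG.mball x e" x] x by auto
    then have "V \<in> B - {{}}" by auto
    then have "q V \<in> Q" "q V \<in> MG.mball x e" using qV V(3) unfolding Q_def by blast+
    then show ?thesis by auto
  qed
  have "f \<in> measurable M (borel_of X)"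
    unfolding borel_of_def
  proof (rule measurable_measure_of)
    show "{U. openin X U} \<subseteq> Pow (topspace X)" using openin_subset by blast
    show "f \<in> space M \<rightarrow> topspace X" using c topspace_X by blast
    fix U assume "U \<in> {U. openin X U}"
    then have U: "U \<subseteq> carrier G" "\<And>x. x \<in> U \<Longrightarrow> \<exists>r>0. MG.mball x r \<subseteq> U"
      using MG.openin_mtopology mtopology_eq by auto
    define J where "J = {(g, n). g \<in> Q \<and> MG.mball g (1 / real (Suc n)) \<subseteq> U}"
    have "f -` U \<inter> space M = (\<Union>(g, n)\<in>J. {y \<in> space M. d (f y) g < 1 / real (Suc n)})"
    proof (intro equalityI subsetI)
      fix y assume y: "y \<in> f -` U \<inter> space M"
      then obtain r where r: "r > 0" "MG.mball (f y) r \<subseteq> U" using U(2) by blast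
      \<comment> \<open>Half of \<open>r\<close> for the distance to the centre and half for the
        radius keep the small ball inside the ball of radius \<open>r\<close> about
        \<open>f y\<close>.\<close>
      obtain n where n: "1 / real (Suc n) < r / 2" using r(1) nat_approx_posE[of "r / 2"] by auto
      obtain g where g: "g \<in> Q" "d (f y) g < 1 / real (Suc n)"
        using dense[of "f y" "1 / real (Suc n)"] c y by auto
      have "MG.mball g (1 / real (Suc n)) \<subseteq> MG.mball (f y) r"
      proof
        fix x assume x: "x \<in> MG.mball g (1 / real (Suc n))"
        have "d (f y) x \<le> d (f y) g + d g x" using x c y g Q(2) by (intro MG.triangle) auto
        then show "x \<in> MG.mball (f y) r" using x g n c y by auto
      qed
      then have "(g, n) \<in> J" using g r(2) unfolding J_def by blast
      then show "y \<in> (\<Union>(g, n)\<in>J. {y \<in> space M. d (f y) g < 1 / real (Suc n)})" using y g by blast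
    next
      fix y assume "y \<in> (\<Union>(g, n)\<in>J. {y \<in> space M. d (f y) g < 1 / real (Suc n)})"
      then obtain g n where "(g, n) \<in> J" "y \<in> space M" "d (f y) g < 1 / real (Suc n)" by auto
      moreover then have "f y \<in> MG.mball g (1 / real (Suc n))"
        using c Q(2) MG.commute[of "f y" g] by (auto simp: J_def)
      ultimately show "y \<in> f -` U \<inter> space M" unfolding J_def by blast
    qed
    also have "\<dots> \<in> sets M"
    proof -
      have "countable J" by (rule countable_subset[of _ "Q \<times> UNIV"]) (use Q(1) in \<open>auto simp: J_def\<close>)
      then show ?thesis using m Q(2) by (intro sets.countable_UN') (auto simp: J_def)
    qed
    finally show "f -` U \<inter> space M \<in> sets M" .
  qed
  then show ?thesis by (simp add: measurable_L_iff)
qed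

lemma measurable_lipschitz:
  fixes u :: "'g \<Rightarrow> real"
  assumes "\<And>g h. g \<in> carrier G \<Longrightarrow> h \<in> carrier G \<Longrightarrow> \<bar>u g - u h\<bar> \<le> C * d g h"
  shows "u \<in> borel_measurable L"
proof -
  have "{x \<in> space L. a < u x} \<in> sets L" for a
  proof -
    have "openin MG.mtopology {x \<in> space L. a < u x}"
      unfolding MG.openin_mtopology
    proof (intro conjI allI impI)
      fix x assume x: "x \<in> {x \<in> space L. a < u x}"
      \<comment> \<open>\<open>\<bar>C\<bar> + 1\<close> is positive whatever \<open>C\<close> is,
        so the quotient makes sense even for a constant \<open>u\<close> with
        \<open>C = 0\<close>.\<close>
      define r where "r = (u x - a) / (\<bar>C\<bar> + 1)"
      have "MG.mball x r \<subseteq> {x \<in> space L. a < u x}"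
      proof
        fix y assume y: "y \<in> MG.mball x r"
        have "u x - u y \<le> C * d x y" using assms[of x y] y by auto
        also have "\<dots> \<le> (\<bar>C\<bar> + 1) * d x y" by (intro mult_right_mono) auto
        also have "\<dots> < (\<bar>C\<bar> + 1) * r" using y by (intro mult_strict_left_mono) auto
        also have "\<dots> = u x - a" unfolding r_def by simp
        finally show "y \<in> {x \<in> space L. a < u x}" using y space_L by auto
      qed
      moreover have "r > 0" using x unfolding r_def by auto
      ultimately show "\<exists>r>0. MG.mball x r \<subseteq> {x \<in> space L. a < u x}" by blast
    qed (simp add: space_L)
    then show ?thesis using openin_imp_sets_borel_of mtopology_eq sets_L by metis
  qed
  then show ?thesis unfolding borel_measurable_iff_greater by simp
qed

end

section \<open>Birkhoff averages and ergodicity\<close>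

text \<open>The recursion for \<open>m\<close> computes the maximum of the Birkhoff sums \<open>S\<^sub>k\<close> over \<open>1 \<le> k \<le> n + 1\<close>. If the
  maxima were unbounded almost everywhere then \<open>m (n + 1) - m n \<circ> T\<close> would decrease to \<open>f\<close>, while its
  integral is nonnegative.\<close>

lemma birkhoff_sums_bounded_above:
  fixes f :: "'a \<Rightarrow> real"
  assumes "prob_space M" and mp: "measure_preserving M T" and erg: "is_ergodic M T"
    and f[measurable]: "f \<in> borel_measurable M" and C: "\<And>x. x \<in> space M \<Longrightarrow> \<bar>f x\<bar> \<le> C"
    and neg: "(\<integral>x. f x \<partial>M) < 0"
  shows "AE x in M. \<exists>B. \<forall>n. (\<Sum>k<n. f ((T ^^ k) x)) \<le> B"
proof -
  interpret prob_space M by fact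
  note T[measurable] = measure_preserving_measurable[OF mp]
  note Tsp = measure_preserving_space[OF mp]
  define m where "m = rec_nat f (\<lambda>_ g x. f x + max 0 (g (T x)))"
  have m0: "m 0 = f" and mS: "m (Suc n) = (\<lambda>x. f x + max 0 (m n (T x)))" for n
    by (simp_all add: m_def)
  have mm[measurable]: "m n \<in> borel_measurable M" for n
    by (induction n) (simp_all add: m0 mS)
  have S_le: "(\<Sum>k<Suc n. f ((T ^^ k) x)) \<le> m n x" for n x
  proof (induction n arbitrary: x)
    case (Suc n)
    have "(\<Sum>k<Suc (Suc n). f ((T ^^ k) x)) = f x + (\<Sum>k<Suc n. f ((T ^^ k) (T x)))"
      by (subst sum.lessThan_Suc_shift) (simp add: funpow_swap1)
    then show ?case using Suc[of "T x"] by (simp add: mS)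
  qed (simp add: m0)
  have m_mono: "m n x \<le> m (Suc n) x" for n x
  proof (induction n arbitrary: x)
    case (Suc n)
    show ?case using Suc[of "T x"] by (simp add: mS)
  qed (simp add: m0 mS)
  have m_ge: "m n x \<ge> f x" for n x by (cases n) (simp_all add: m0 mS)
  have m_bd: "\<bar>m n x\<bar> \<le> real (Suc n) * C" if "x \<in> space M" for n x
    using that
  proof (induction n arbitrary: x)
    case (Suc n)
    have "\<bar>m (Suc n) x\<bar> \<le> \<bar>f x\<bar> + \<bar>m n (T x)\<bar>" by (simp add: mS)
    then show ?case using Suc.IH[OF Tsp[OF Suc.prems]] C[OF Suc.prems] by (simp add: algebra_simps)
  qed (use C in \<open>simp add: m0\<close>)
  have mint: "integrable M (m n)" for n
    by (rule integrable_const_bound[of _ "real (Suc n) * C"]) (use m_bd in auto)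
  define A where "A = {x \<in> space M. \<forall>B::nat. \<exists>n. m n x > real B}"
  have A[measurable]: "A \<in> sets M" unfolding A_def by measurable
  \<comment> \<open>By the recursion \<open>m (Suc n) x\<close> is \<open>f x\<close> plus the
    positive part of \<open>m n (T x)\<close>. A summand that does not depend on \<open>n\<close>
    cannot change whether the maxima are unbounded.\<close>
  have Ainv: "T x \<in> A \<longleftrightarrow> x \<in> A" if x: "x \<in> space M" for x
  proof
    assume TA: "T x \<in> A"
    show "x \<in> A" unfolding A_def
    proof (safe intro!: x)
      fix B :: nat
      obtain B' :: nat where B': "real B - f x \<le> real B'" using real_arch_simple by blast
      obtain n where "m n (T x) > real B'" using TA unfolding A_def by blast
      then have "m (Suc n) x > real B" using B' by (simp add: mS)
      then show "\<exists>n. m n x > real B" by blast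
    qed
  next
    assume xA: "x \<in> A"
    show "T x \<in> A" unfolding A_def
    proof (safe intro!: Tsp[OF x])
      fix B :: nat
      obtain B' :: nat where B': "real B + \<bar>f x\<bar> \<le> real B'" using real_arch_simple by blast
      obtain n where n: "m n x > real B'" using xA unfolding A_def by blast
      then have "m (Suc n) x > real B'" using m_mono[of n x] by simp
      then have "m n (T x) > real B" using B' by (auto simp: mS max_def split: if_splits)
      then show "\<exists>n. m n (T x) > real B" by blast
    qed
  qed
  have "AE x in M. T x \<in> A \<longleftrightarrow> x \<in> A" using Ainv by auto
  then have "measure M A = 0 \<or> measure M A = 1" using erg A unfolding is_ergodic_def by blast
  moreover have "measure M A \<noteq> 1"
  proof
    assume "measure M A = 1"
    then have AA: "AE x in M. x \<in> A" using A by (subst prob_eq_1[symmetric]) auto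
    \<comment> \<open>Once \<open>m n (T x)\<close> is positive the difference is exactly
      \<open>f x\<close>; before that it exceeds \<open>f x\<close> by at most \<open>C\<close>,
      because \<open>m n (T x) \<ge> - C\<close>. Hence the dominating constant
      \<open>2 * C\<close>.\<close>
    have lim: "(\<lambda>n. \<integral>x. m (Suc n) x - m n (T x) \<partial>M) \<longlonglongrightarrow> (\<integral>x. f x \<partial>M)"
    proof (rule integral_dominated_convergence[where w="\<lambda>_. 2 * C"])
      show "AE x in M. (\<lambda>n. m (Suc n) x - m n (T x)) \<longlonglongrightarrow> f x"
        using AA AE_space
      proof eventually_elim
        case (elim x)
        then have "T x \<in> A" using Ainv by blast
        then obtain n0 where n0: "m n0 (T x) > 0" unfolding A_def by (force dest: spec[of _ 0])
        have "m n (T x) > 0" if "n \<ge> n0" for n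
          using that n0 by (induction n rule: dec_induct) (use m_mono order_less_le_trans in blast)+
        then have "m (Suc n) x - m n (T x) = f x" if "n \<ge> n0" for n
          using that less_imp_le by (simp add: mS max_absorb2)
        then have "eventually (\<lambda>n. m (Suc n) x - m n (T x) = f x) sequentially"
          unfolding eventually_sequentially by blast
        then show ?case by (rule tendsto_eventually)
      qed
      show "AE x in M. norm (m (Suc n) x - m n (T x)) \<le> 2 * C" for n
        using AE_space
      proof eventually_elim
        case (elim x)
        have "m n (T x) \<ge> - C" using m_ge[of "T x" n] C[OF Tsp[OF elim]] by linarith
        then show ?case using C[OF elim] by (auto simp: mS max_def)
      qed
    qed auto
    \<comment> \<open>Invariance of \<open>M\<close> replaces \<open>m n (T x)\<close> by
      \<open>m n x\<close>, and the maxima increase with \<open>n\<close>.\<close>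
    have "(\<integral>x. m (Suc n) x - m n (T x) \<partial>M) \<ge> 0" for n
    proof -
      have "(\<integral>x. m (Suc n) x - m n (T x) \<partial>M) = (\<integral>x. m (Suc n) x \<partial>M) - (\<integral>x. m n x \<partial>M)"
        using measure_preserving_integral[OF mp mm[of n]] measure_preserving_integrable[OF mp mint[of n]]
          mint by simp
      also have "\<dots> \<ge> 0" using integral_mono[OF mint mint m_mono, of n] by simp
      finally show ?thesis .
    qed
    then have "(\<integral>x. f x \<partial>M) \<ge> 0" using lim LIMSEQ_le_const by blast
    with neg show False by simp
  qed
  ultimately have "measure M A = 0" by blast
  then have "AE x in M. x \<notin> A"
    using A by (subst AE_iff_measurable[of A]) (auto simp: emeasure_eq_measure A_def)
  then show ?thesis using AE_space
  proof eventually_elim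
    case (elim x)
    then obtain B :: nat where B: "\<And>n. m n x \<le> real B" unfolding A_def by (force simp: not_less)
    have "(\<Sum>k<n. f ((T ^^ k) x)) \<le> real B" for n
      using order_trans[OF S_le B] by (cases n) auto
    then show ?case by blast
  qed
qed

definition birkhoff_average :: "('a \<Rightarrow> 'a) \<Rightarrow> ('a \<Rightarrow> real) \<Rightarrow> nat \<Rightarrow> 'a \<Rightarrow> real" where
  "birkhoff_average T f n x = (\<Sum>k<n. f ((T ^^ k) x)) / real n"

lemma birkhoff_average_measurable[measurable]:
  assumes "T \<in> measurable M M" and f: "f \<in> borel_measurable M"
  shows "birkhoff_average T f n \<in> borel_measurable M"
proof -
  have "(\<lambda>x. f ((T ^^ k) x)) \<in> borel_measurable M" for k
    using measurable_compose[OF measurable_compose_n[OF assms(1)] f] .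
  then show ?thesis unfolding birkhoff_average_def by measurable
qed

lemma birkhoff_average_bound:
  assumes "\<And>k. \<bar>f ((T ^^ k) x)\<bar> \<le> C"
  shows "\<bar>birkhoff_average T f n x\<bar> \<le> C"
proof (cases "n = 0")
  case True
  then show ?thesis using assms[of 0] by (simp add: birkhoff_average_def)
next
  case False
  have "\<bar>\<Sum>k<n. f ((T ^^ k) x)\<bar> \<le> (\<Sum>k<n. C)"
    by (rule order_trans[OF sum_abs sum_mono]) (use assms in auto)
  then show ?thesis using False by (simp add: birkhoff_average_def field_simps)
qed

text \<open>Subtracting a constant slightly above the mean makes the integral negative, so the
  centred sums are bounded above almost everywhere, and division by \<open>n\<close> makes the bound
  vanish in the limit. Half of \<open>e\<close> is spent on the constant \<open>c\<close>, half on
  \<open>B / real n\<close>.\<close>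

lemma birkhoff_average_limsup:
  fixes f :: "'a \<Rightarrow> real"
  assumes "prob_space M" and mp: "measure_preserving M T" and erg: "is_ergodic M T"
    and f[measurable]: "f \<in> borel_measurable M" and C: "\<And>x. x \<in> space M \<Longrightarrow> \<bar>f x\<bar> \<le> C"
    and e: "e > 0"
  shows "AE x in M. eventually (\<lambda>n. birkhoff_average T f n x < (\<integral>x. f x \<partial>M) + e) sequentially"
proof -
  interpret prob_space M by fact
  define c where "c = (\<integral>x. f x \<partial>M) + e / 2"
  have fi: "integrable M f" by (rule integrable_const_bound[of _ C]) (use C in auto)
  have "AE x in M. \<exists>B. \<forall>n. (\<Sum>k<n. f ((T ^^ k) x) - c) \<le> B"
  proof (rule birkhoff_sums_bounded_above[OF assms(1-3)])
    show "\<And>x. x \<in> space M \<Longrightarrow> \<bar>f x - c\<bar> \<le> C + \<bar>c\<bar>" using C by fastforce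
    show "(\<integral>x. f x - c \<partial>M) < 0" using fi e by (simp add: c_def prob_space)
  qed simp
  then show ?thesis
  proof eventually_elim
    case (elim x)
    then obtain B where B: "\<And>n. (\<Sum>k<n. f ((T ^^ k) x) - c) \<le> B" by blast
    have "(\<lambda>n. B / real n) \<longlonglongrightarrow> 0" by (rule lim_const_over_n)
    then have "eventually (\<lambda>n. B / real n < e / 2) sequentially"
      using e by (intro order_tendstoD(2)) auto
    then show ?case using eventually_gt_at_top[of 0]
    proof eventually_elim
      case (elim n)
      have "(\<Sum>k<n. f ((T ^^ k) x)) \<le> B + real n * c" using B[of n] by (simp add: sum_subtractf)
      then have "birkhoff_average T f n x \<le> B / real n + c"
        using elim by (simp add: birkhoff_average_def field_simps)
      then show ?case using elim unfolding c_def by linarith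
    qed
  qed
qed

text \<open>The one-sided bound is applied to \<open>f\<close> and to \<open>- f\<close>.
  Restricting the tolerances to \<open>1 / real (Suc j)\<close> leaves only countably many
  exceptional null sets.\<close>

theorem birkhoff_ergodic_bounded:
  fixes f :: "'a \<Rightarrow> real"
  assumes "prob_space M" and mp: "measure_preserving M T" and erg: "is_ergodic M T"
    and f[measurable]: "f \<in> borel_measurable M" and C: "\<And>x. x \<in> space M \<Longrightarrow> \<bar>f x\<bar> \<le> C"
  shows "AE x in M. (\<lambda>n. birkhoff_average T f n x) \<longlonglongrightarrow> (\<integral>x. f x \<partial>M)"
proof -
  let ?I = "\<integral>x. f x \<partial>M"
  have "AE x in M. \<forall>j. eventually (\<lambda>n. birkhoff_average T f n x < ?I + 1 / real (Suc j)) sequentially"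
    unfolding AE_all_countable by (intro allI birkhoff_average_limsup[OF assms]) auto
  moreover have "AE x in M. \<forall>j. eventually
      (\<lambda>n. birkhoff_average T (\<lambda>x. - f x) n x < (\<integral>x. - f x \<partial>M) + 1 / real (Suc j)) sequentially"
    unfolding AE_all_countable
    by (intro allI birkhoff_average_limsup[OF assms(1-3), where C=C]) (use C in auto)
  ultimately show ?thesis
  proof eventually_elim
    case (elim x)
    show ?case
    proof (rule LIMSEQ_I)
      fix r :: real assume "r > 0"
      then obtain j where j: "1 / real (Suc j) < r" using nat_approx_posE by blast
      have "eventually (\<lambda>n. norm (birkhoff_average T f n x - ?I) < r) sequentially"
        using elim(1)[rule_format, of j] elim(2)[rule_format, of j]
        by eventually_elim (use j in \<open>auto simp: birkhoff_average_def sum_negf abs_less_iff\<close>)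
      then show "\<exists>no. \<forall>n\<ge>no. norm (birkhoff_average T f n x - ?I) < r"
        unfolding eventually_sequentially .
    qed
  qed
qed

text \<open>Invariance of \<open>E\<close> and of \<open>M\<close> makes the correlation of
  \<open>E\<close> with \<open>f\<close> after \<open>k\<close> steps independent of
  \<open>k\<close>, hence equal to its correlation with every average. So one average close to the
  mean for each tolerance is enough, and a condition on one average survives small changes of the
  cocycle.\<close>

lemma invariant_set_correlation:
  fixes f :: "'a \<Rightarrow> real"
  assumes "prob_space M" and mp: "measure_preserving M R"
    and E[measurable]: "E \<in> sets M" and inv: "AE x in M. R x \<in> E \<longleftrightarrow> x \<in> E"
    and f[measurable]: "f \<in> borel_measurable M" and C: "\<And>x. x \<in> space M \<Longrightarrow> \<bar>f x\<bar> \<le> C"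
    and avg: "\<And>e. e > 0 \<Longrightarrow> \<exists>n\<ge>1. (\<integral>x. \<bar>birkhoff_average R f n x - (\<integral>x. f x \<partial>M)\<bar> \<partial>M) < e"
  shows "(\<integral>x. indicator E x * f x \<partial>M) = measure M E * (\<integral>x. f x \<partial>M)"
proof -
  interpret prob_space M by fact
  note R[measurable] = measure_preserving_measurable[OF mp]
  have Rk[measurable]: "(R ^^ k) \<in> measurable M M" for k
    by (rule measure_preserving_measurable[OF measure_preserving_funpow[OF mp]])
  have Rsp: "x \<in> space M \<Longrightarrow> (R ^^ k) x \<in> space M" for x k using measurable_space[OF Rk] .
  have Ci: "integrable M (\<lambda>x. indicator E x * f ((R ^^ k) x))" for k
  proof (rule integrable_const_bound[of _ C])
    show "AE x in M. norm (indicator E x * f ((R ^^ k) x)) \<le> C"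
    proof (rule AE_I2)
      fix x assume "x \<in> space M"
      then have "\<bar>f ((R ^^ k) x)\<bar> \<le> C" using C Rsp by blast
      then show "norm (indicator E x * f ((R ^^ k) x)) \<le> C" by (auto simp: indicator_def)
    qed
  qed measurable
  have step: "(\<integral>x. indicator E x * f ((R ^^ k) x) \<partial>M) = (\<integral>x. indicator E x * f x \<partial>M)" for k
  proof (induction k)
    case (Suc k)
    have "(\<integral>x. indicator E x * f ((R ^^ Suc k) x) \<partial>M) =
        (\<integral>x. indicator E (R x) * f ((R ^^ k) (R x)) \<partial>M)"
    proof (rule integral_cong_AE)
      show "AE x in M. indicator E x * f ((R ^^ Suc k) x) = indicator E (R x) * f ((R ^^ k) (R x))"
        using inv by eventually_elim (auto simp: indicator_def funpow_swap1)
    qed measurable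
    also have "\<dots> = (\<integral>x. indicator E x * f ((R ^^ k) x) \<partial>M)"
      by (rule measure_preserving_integral[OF mp, where f="\<lambda>x. indicator E x * f ((R ^^ k) x)"]) measurable
    finally show ?case using Suc by simp
  qed simp
  have iE: "integrable M (indicator E :: _ \<Rightarrow> real)"
    by (rule integrable_const_bound[of _ 1]) (auto simp: indicator_def)
  let ?I = "\<integral>x. f x \<partial>M"
  have bound: "\<bar>(\<integral>x. indicator E x * f x \<partial>M) - measure M E * ?I\<bar> < e" if "e > 0" for e
  proof -
    obtain n where n: "n \<ge> 1" "(\<integral>x. \<bar>birkhoff_average R f n x - ?I\<bar> \<partial>M) < e"
      using avg \<open>e > 0\<close> by blast
    have eq: "(\<lambda>x. indicator E x * birkhoff_average R f n x) =
        (\<lambda>x. (\<Sum>k<n. indicator E x * f ((R ^^ k) x)) / real n)"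
      by (simp add: birkhoff_average_def sum_distrib_left)
    have i1: "integrable M (\<lambda>x. indicator E x * birkhoff_average R f n x)"
      unfolding eq by (intro integrable_divide_zero Bochner_Integration.integrable_sum Ci)
    have "(\<integral>x. indicator E x * birkhoff_average R f n x \<partial>M) = (\<integral>x. indicator E x * f x \<partial>M)"
      unfolding eq integral_divide_zero
      by (subst Bochner_Integration.integral_sum) (use Ci step n(1) in auto)
    then have "(\<integral>x. indicator E x * f x \<partial>M) - measure M E * ?I =
        (\<integral>x. indicator E x * birkhoff_average R f n x - indicator E x * ?I \<partial>M)"
      using iE by (subst Bochner_Integration.integral_diff[OF i1]) auto
    also have "\<bar>\<dots>\<bar> \<le> (\<integral>x. \<bar>indicator E x * birkhoff_average R f n x - indicator E x * ?I\<bar> \<partial>M)"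
      by (rule integral_abs_bound)
    also have "\<dots> \<le> (\<integral>x. \<bar>birkhoff_average R f n x - ?I\<bar> \<partial>M)"
    proof (rule integral_mono)
      have "integrable M (birkhoff_average R f n)"
        by (rule integrable_const_bound[of _ C])
           (use C Rsp in \<open>auto intro!: AE_I2 birkhoff_average_bound\<close>)
      then show "integrable M (\<lambda>x. \<bar>birkhoff_average R f n x - ?I\<bar>)" by simp
      show "integrable M (\<lambda>x. \<bar>indicator E x * birkhoff_average R f n x - indicator E x * ?I\<bar>)"
        using iE by (intro integrable_abs Bochner_Integration.integrable_diff i1) auto
    qed (auto simp: indicator_def)
    finally show ?thesis using n(2) by simp
  qed
  then show ?thesis using bound[of "\<bar>(\<integral>x. indicator E x * f x \<partial>M) - measure M E * ?I\<bar>"] by force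
qed

text \<open>For an invariant \<open>E\<close> the sets independent of \<open>E\<close> form a Dynkin
  system, so they comprise all measurable sets once they contain a generating pi-system. Taking
  \<open>E\<close> itself for \<open>Q\<close> makes \<open>measure M E\<close> equal to its
  square.\<close>

lemma is_ergodic_generatorI:
  assumes "prob_space M" and gen: "Int_stable \<E>" "\<E> \<subseteq> Pow (space M)" "sets M = sigma_sets (space M) \<E>"
    and indep: "\<And>E Q. E \<in> sets M \<Longrightarrow> (AE x in M. R x \<in> E \<longleftrightarrow> x \<in> E) \<Longrightarrow> Q \<in> \<E> \<Longrightarrow>
      measure M (E \<inter> Q) = measure M E * measure M Q"
  shows "is_ergodic M R"
  unfolding is_ergodic_def
proof (intro ballI impI)
  interpret prob_space M by fact
  fix E assume E: "E \<in> sets M" and inv: "AE x in M. R x \<in> E \<longleftrightarrow> x \<in> E"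
  have "measure M (E \<inter> Q) = measure M E * measure M Q" if "Q \<in> sets M" for Q
    using gen(1,2) that[unfolded gen(3)]
  proof (induction rule: sigma_sets_induct_disjoint)
    case (basic A)
    then show ?case using indep[OF E inv] by blast
  next
    case (compl A)
    then have A: "A \<in> sets M" using gen(3) by simp
    have "E \<inter> (space M - A) = E - (E \<inter> A)" using sets.sets_into_space[OF E] by blast
    then have "measure M (E \<inter> (space M - A)) = measure M E - measure M (E \<inter> A)"
      using E A by (simp add: finite_measure_Diff)
    then show ?case unfolding prob_compl[OF A] compl(2) by (simp add: right_diff_distrib)
  next
    case (union A)
    then have A: "range A \<subseteq> sets M" using gen(3) by auto
    have "(\<lambda>i. measure M (E \<inter> A i)) sums measure M (\<Union>i. E \<inter> A i)"
      using A E union(1) by (intro finite_measure_UNION) (auto simp: disjoint_family_on_def)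
    moreover have "(\<lambda>i. measure M E * measure M (A i)) sums (measure M E * measure M (\<Union>i. A i))"
      using A union(1) by (intro sums_mult finite_measure_UNION) auto
    moreover have "(\<Union>i. E \<inter> A i) = E \<inter> (\<Union>i. A i)" by blast
    ultimately show ?case using union(3) sums_unique2 by force
  qed simp
  from this[OF E] show "measure M E = 0 \<or> measure M E = 1" by simp
qed

section \<open>The fibre square of an extension\<close>

lemma is_system_measure_preserving: "is_system M T \<Longrightarrow> measure_preserving M T"
  by (simp add: is_system_def measure_preserving_def)

lemma is_system_prob_space: "is_system M T \<Longrightarrow> prob_space M"
  by (simp add: is_system_def standard_probability_space_def)

lemma distr_pair_snd:
  assumes "prob_space M" "prob_space N"
  shows "distr (M \<Otimes>\<^sub>M N) N snd = N"
proof (rule measure_eqI)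
  interpret M: prob_space M by fact
  interpret N: prob_space N by fact
  fix A assume "A \<in> sets (distr (M \<Otimes>\<^sub>M N) N snd)"
  then have A: "A \<in> sets N" by simp
  have "snd -` A \<inter> space (M \<Otimes>\<^sub>M N) = space M \<times> A"
    using sets.sets_into_space[OF A] by (auto simp: space_pair_measure)
  then show "emeasure (distr (M \<Otimes>\<^sub>M N) N snd) A = emeasure N A"
    using A by (simp add: emeasure_distr N.emeasure_pair_measure_Times M.emeasure_space_1)
qed simp

lemma AE_pair_fstI:
  assumes "prob_space N" "AE x in M. P x"
  shows "AE w in M \<Otimes>\<^sub>M N. P (fst w)"
proof (rule AE_distrD[of fst _ M])
  show "AE x in distr (M \<Otimes>\<^sub>M N) M fst. P x"
    unfolding prob_space.distr_pair_fst[OF assms(1)] by fact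
qed simp

lemma AE_pair_sndI:
  assumes "prob_space M" "prob_space N" "AE x in N. P x"
  shows "AE w in M \<Otimes>\<^sub>M N. P (snd w)"
proof (rule AE_distrD[of snd _ N])
  show "AE x in distr (M \<Otimes>\<^sub>M N) N snd. P x"
    unfolding distr_pair_snd[OF assms(1,2)] by fact
qed simp

text \<open>The relative product before its restriction to the fibre product. On the full product
  space rectangles and coordinate projections are available;
  \<open>is_ergodic_relative_product_iff\<close> takes care of the restriction.\<close>

definition fibre_square :: "'b measure \<Rightarrow> ('b \<Rightarrow> 'a measure) \<Rightarrow> ('a \<times> 'a) measure" where
  "fibre_square N K = N \<bind> (\<lambda>z. K z \<Otimes>\<^sub>M K z)"

locale disintegrated_extension =
  fixes M :: "'y measure" and T :: "'y \<Rightarrow> 'y" and N :: "'z measure" and S :: "'z \<Rightarrow> 'z"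
    and p :: "'y \<Rightarrow> 'z" and K :: "'z \<Rightarrow> 'y measure"
  assumes ext: "is_extension M T N S p" and dis: "is_disintegration M N p K"
begin

abbreviation "\<nu> \<equiv> fibre_square N K"

lemma sysM: "is_system M T" and sysN: "is_system N S"
  and p_measurable[measurable]: "p \<in> measurable M N"
  and distr_p: "distr M N p = N" and equivariant: "AE x in M. p (T x) = S (p x)"
  using ext by (auto simp: is_extension_def)

sublocale M: prob_space M using sysM by (rule is_system_prob_space)
sublocale N: prob_space N using sysN by (rule is_system_prob_space)

lemma T_mp: "measure_preserving M T" and S_mp: "measure_preserving N S"
  using sysM sysN is_system_measure_preserving by auto

lemma T_measurable[measurable]: "T \<in> measurable M M" and S_measurable[measurable]: "S \<in> measurable N N"
  using T_mp S_mp measure_preserving_measurable by auto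

lemma K_kernel[measurable]: "K \<in> measurable N (prob_algebra M)"
  and K_fibre: "AE z in N. AE x in K z. p x = z"
  and M_eq: "M = N \<bind> K"
  using dis by (auto simp: is_disintegration_def)

lemma K_subprob[measurable]: "K \<in> measurable N (subprob_algebra M)"
  by (rule measurable_prob_algebraD) (rule K_kernel)

lemma K_prob: "z \<in> space N \<Longrightarrow> prob_space (K z)"
  and K_sets: "z \<in> space N \<Longrightarrow> sets (K z) = sets M"
  using measurable_space[OF K_kernel] by (auto simp: space_prob_algebra)

lemma K_space: "z \<in> space N \<Longrightarrow> space (K z) = space M"
  using sets_eq_imp_space_eq[OF K_sets] .

lemma KK_kernel[measurable]: "(\<lambda>z. K z \<Otimes>\<^sub>M K z) \<in> measurable N (prob_algebra (M \<Otimes>\<^sub>M M))"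
  by (rule measurable_pair_prob[OF K_kernel K_kernel])

lemma KK_subprob[measurable]: "(\<lambda>z. K z \<Otimes>\<^sub>M K z) \<in> measurable N (subprob_algebra (M \<Otimes>\<^sub>M M))"
  by (rule measurable_prob_algebraD) (rule KK_kernel)

lemma N_in: "N \<in> space (prob_algebra N)"
  using N.prob_space_axioms by (simp add: space_prob_algebra)

lemma sets_\<nu>[measurable_cong, simp]: "sets \<nu> = sets (M \<Otimes>\<^sub>M M)"
  unfolding fibre_square_def by (rule sets_bind'[OF N_in KK_kernel])

lemma space_\<nu>[simp]: "space \<nu> = space M \<times> space M"
  using sets_eq_imp_space_eq[OF sets_\<nu>] by (simp add: space_pair_measure)

sublocale \<nu>: prob_space \<nu>
  unfolding fibre_square_def by (rule prob_space_bind'[OF N_in KK_kernel])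

lemma emeasure_M: "B \<in> sets M \<Longrightarrow> emeasure M B = (\<integral>\<^sup>+z. emeasure (K z) B \<partial>N)"
  using emeasure_bind_prob_algebra[OF N_in K_kernel] M_eq by simp

lemma emeasure_\<nu>_times:
  assumes A: "A \<in> sets M" and B: "B \<in> sets M"
  shows "emeasure \<nu> (A \<times> B) = (\<integral>\<^sup>+z. emeasure (K z) A * emeasure (K z) B \<partial>N)"
proof -
  have "emeasure \<nu> (A \<times> B) = (\<integral>\<^sup>+z. emeasure (K z \<Otimes>\<^sub>M K z) (A \<times> B) \<partial>N)"
    unfolding fibre_square_def using A B by (intro emeasure_bind_prob_algebra[OF N_in KK_kernel]) auto
  also have "\<dots> = (\<integral>\<^sup>+z. emeasure (K z) A * emeasure (K z) B \<partial>N)"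
  proof (rule nn_integral_cong)
    fix z assume z: "z \<in> space N"
    interpret prob_space "K z" using K_prob[OF z] .
    show "emeasure (K z \<Otimes>\<^sub>M K z) (A \<times> B) = emeasure (K z) A * emeasure (K z) B"
      using A B K_sets[OF z] by (intro emeasure_pair_measure_Times) auto
  qed
  finally show ?thesis .
qed

lemma AE_M_iff: "Measurable.pred M P \<Longrightarrow> (AE x in M. P x) \<longleftrightarrow> (AE z in N. AE x in K z. P x)"
  using AE_bind[OF K_subprob, of P] unfolding M_eq[symmetric] by blast

lemma AE_\<nu>_iff: "Measurable.pred (M \<Otimes>\<^sub>M M) P \<Longrightarrow> (AE w in \<nu>. P w) \<longleftrightarrow> (AE z in N. AE w in K z \<Otimes>\<^sub>M K z. P w)"
  unfolding fibre_square_def by (rule AE_bind[OF KK_subprob])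

lemma emeasure_K_space: "z \<in> space N \<Longrightarrow> emeasure (K z) (space M) = 1"
  using prob_space.emeasure_space_1[OF K_prob] K_space by metis

text \<open>Each \<open>K z\<close> has total mass 1, so a marginal of \<open>\<nu>\<close> averages
  the \<open>K z\<close> back to \<open>M\<close>. Through the marginals, almost everywhere
  statements on \<open>M\<close> pass to either coordinate of a pair.\<close>

lemma distr_\<nu>_fst: "distr \<nu> M fst = M"
proof (rule measure_eqI)
  fix A assume "A \<in> sets (distr \<nu> M fst)"
  then have A: "A \<in> sets M" by simp
  have "fst -` A \<inter> space \<nu> = A \<times> space M" using sets.sets_into_space[OF A] by auto
  then have "emeasure (distr \<nu> M fst) A = emeasure \<nu> (A \<times> space M)"
    using A by (subst emeasure_distr) auto
  also have "\<dots> = emeasure M A"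
    using A emeasure_M[OF A] by (subst emeasure_\<nu>_times) (auto intro!: nn_integral_cong simp: emeasure_K_space)
  finally show "emeasure (distr \<nu> M fst) A = emeasure M A" .
qed simp

lemma distr_\<nu>_snd: "distr \<nu> M snd = M"
proof (rule measure_eqI)
  fix A assume "A \<in> sets (distr \<nu> M snd)"
  then have A: "A \<in> sets M" by simp
  have "snd -` A \<inter> space \<nu> = space M \<times> A" using sets.sets_into_space[OF A] by auto
  then have "emeasure (distr \<nu> M snd) A = emeasure \<nu> (space M \<times> A)"
    using A by (subst emeasure_distr) auto
  also have "\<dots> = emeasure M A"
    using A emeasure_M[OF A] by (subst emeasure_\<nu>_times) (auto intro!: nn_integral_cong simp: emeasure_K_space)
  finally show "emeasure (distr \<nu> M snd) A = emeasure M A" .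
qed simp

lemma AE_\<nu>_fst: "AE x in M. P x \<Longrightarrow> AE w in \<nu>. P (fst w)"
  by (rule AE_distrD[of fst \<nu> M P]) (simp, unfold distr_\<nu>_fst)

lemma AE_\<nu>_snd: "AE x in M. P x \<Longrightarrow> AE w in \<nu>. P (snd w)"
  by (rule AE_distrD[of snd \<nu> M P]) (simp, unfold distr_\<nu>_snd)

text \<open>As \<open>K z\<close> is carried by the fibre over \<open>z\<close>, the preimage of
  \<open>C\<close> under \<open>p\<close> has full or zero \<open>K z\<close>-measure according to
  whether \<open>z\<close> lies in \<open>C\<close>.\<close>

lemma emeasure_M_fibred:
  assumes C[measurable]: "C \<in> sets N" and B[measurable]: "B \<in> sets M"
  shows "emeasure M (p -` C \<inter> space M \<inter> B) = (\<integral>\<^sup>+z. indicator C z * emeasure (K z) B \<partial>N)"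
proof -
  have "emeasure M (p -` C \<inter> space M \<inter> B) = (\<integral>\<^sup>+z. emeasure (K z) (p -` C \<inter> space M \<inter> B) \<partial>N)"
    by (rule emeasure_M) measurable
  also have "\<dots> = (\<integral>\<^sup>+z. indicator C z * emeasure (K z) B \<partial>N)"
  proof (rule nn_integral_cong_AE)
    show "AE z in N. emeasure (K z) (p -` C \<inter> space M \<inter> B) = indicator C z * emeasure (K z) B"
      using K_fibre AE_space
    proof eventually_elim
      case (elim z)
      have s[measurable_cong]: "sets (K z) = sets M" using K_sets elim by blast
      have "emeasure (K z) (p -` C \<inter> space M \<inter> B) = emeasure (K z) (if z \<in> C then B else {})"
      proof (rule emeasure_eq_AE)
        show "AE x in K z. (x \<in> p -` C \<inter> space M \<inter> B) \<longleftrightarrow> (x \<in> (if z \<in> C then B else {}))"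
          using elim(1) AE_space by eventually_elim (use K_space[OF elim(2)] in auto)
      qed (auto simp: s)
      then show ?case by (auto simp: indicator_def)
    qed
  qed
  finally show ?thesis .
qed

text \<open>Uniqueness of the disintegration, for one set \<open>B\<close>: integrated over any
  \<open>C\<close>, both sides measure the points over \<open>C\<close> that \<open>T\<close> sends
  into \<open>B\<close>, so they are densities of the same measure on \<open>N\<close>. The
  exceptional null set depends on \<open>B\<close>; this is harmless because \<open>\<nu>_mp\<close>
  tests one rectangle at a time.\<close>

lemma K_equivariant:
  assumes B[measurable]: "B \<in> sets M"
  shows "AE z in N. emeasure (K z) (T -` B \<inter> space M) = emeasure (K (S z)) B"
proof (rule N.density_unique)
  show m1[measurable]: "(\<lambda>z. emeasure (K z) (T -` B \<inter> space M)) \<in> borel_measurable N"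
    by measurable
  show m2[measurable]: "(\<lambda>z. emeasure (K (S z)) B) \<in> borel_measurable N"
    by measurable
  show "density N (\<lambda>z. emeasure (K z) (T -` B \<inter> space M)) = density N (\<lambda>z. emeasure (K (S z)) B)"
  proof (rule measure_eqI)
    fix C assume "C \<in> sets (density N (\<lambda>z. emeasure (K z) (T -` B \<inter> space M)))"
    then have C[measurable]: "C \<in> sets N" by simp
    \<comment> \<open>The image of \<open>C\<close> under \<open>S\<close>, written as a preimage
      under the inverse so that it is visibly measurable.\<close>
    define D where "D = the_inv_into (space N) S -` C \<inter> space N"
    have bij: "bij_betw S (space N) (space N)" and Si: "the_inv_into (space N) S \<in> measurable N N"
      using sysN by (auto simp: is_system_def)
    have D[measurable]: "D \<in> sets N" unfolding D_def using Si C by measurable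
    have SD: "S z \<in> D \<longleftrightarrow> z \<in> C" if "z \<in> space N" for z
      using bij that the_inv_into_f_f[of S "space N" z] measurable_space[OF S_measurable that]
      unfolding D_def bij_betw_def by auto
    have "emeasure (density N (\<lambda>z. emeasure (K (S z)) B)) C
        = (\<integral>\<^sup>+z. emeasure (K (S z)) B * indicator C z \<partial>N)"
      by (subst emeasure_density) auto
    also have "\<dots> = (\<integral>\<^sup>+z. indicator D (S z) * emeasure (K (S z)) B \<partial>N)"
      by (rule nn_integral_cong) (use SD in \<open>auto simp: indicator_def\<close>)
    also have "\<dots> = (\<integral>\<^sup>+z. indicator D z * emeasure (K z) B \<partial>N)"
      by (rule measure_preserving_nn_integral[OF S_mp]) measurable
    also have "\<dots> = emeasure M (p -` D \<inter> space M \<inter> B)"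
      by (rule emeasure_M_fibred[symmetric]) measurable
    also have "\<dots> = emeasure (distr M M T) (p -` D \<inter> space M \<inter> B)"
      using T_mp by (simp add: measure_preserving_def)
    also have "\<dots> = emeasure M (T -` (p -` D \<inter> space M \<inter> B) \<inter> space M)"
      by (subst emeasure_distr) auto
    also have "\<dots> = emeasure M (p -` C \<inter> space M \<inter> (T -` B \<inter> space M))"
    proof (rule emeasure_eq_AE)
      show "AE x in M. x \<in> T -` (p -` D \<inter> space M \<inter> B) \<inter> space M \<longleftrightarrow>
          x \<in> p -` C \<inter> space M \<inter> (T -` B \<inter> space M)"
        using equivariant AE_space
        by eventually_elim
           (use SD measurable_space[OF p_measurable] measurable_space[OF T_measurable] in auto)
    qed auto
    also have "\<dots> = (\<integral>\<^sup>+z. indicator C z * emeasure (K z) (T -` B \<inter> space M) \<partial>N)"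
      by (rule emeasure_M_fibred) measurable
    also have "\<dots> = emeasure (density N (\<lambda>z. emeasure (K z) (T -` B \<inter> space M))) C"
      by (subst emeasure_density) (auto simp: mult.commute)
    finally show "emeasure (density N (\<lambda>z. emeasure (K z) (T -` B \<inter> space M))) C =
        emeasure (density N (\<lambda>z. emeasure (K (S z)) B)) C" by simp
  qed simp
qed

lemma \<nu>_mp: "measure_preserving \<nu> (map_prod T T)"
proof -
  have TT[measurable]: "map_prod T T \<in> measurable (M \<Otimes>\<^sub>M M) (M \<Otimes>\<^sub>M M)"
    unfolding map_prod_def case_prod_beta' by measurable
  have TT': "map_prod T T \<in> measurable \<nu> \<nu>" by measurable
  have "\<nu> = distr \<nu> \<nu> (map_prod T T)"
  proof (rule measure_eqI_generator_eq[OF Int_stable_pair_measure_generator pair_measure_closed])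
    show "sets \<nu> = sigma_sets (space M \<times> space M) {a \<times> b |a b. a \<in> sets M \<and> b \<in> sets M}"
      by (simp add: sets_pair_measure)
    then show "sets (distr \<nu> \<nu> (map_prod T T)) =
        sigma_sets (space M \<times> space M) {a \<times> b |a b. a \<in> sets M \<and> b \<in> sets M}" by simp
    show "range (\<lambda>_::nat. space M \<times> space M) \<subseteq> {a \<times> b |a b. a \<in> sets M \<and> b \<in> sets M}" by auto
    show "emeasure \<nu> (space M \<times> space M) \<noteq> \<infinity>" using \<nu>.emeasure_finite by simp
    fix Q assume "Q \<in> {a \<times> b |a b. a \<in> sets M \<and> b \<in> sets M}"
    then obtain A B where Q: "Q = A \<times> B" and AB[measurable]: "A \<in> sets M" "B \<in> sets M" by blast
    have "map_prod T T -` Q \<inter> space \<nu> = (T -` A \<inter> space M) \<times> (T -` B \<inter> space M)"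
      by (auto simp: Q)
    then have "emeasure (distr \<nu> \<nu> (map_prod T T)) Q
        = emeasure \<nu> ((T -` A \<inter> space M) \<times> (T -` B \<inter> space M))"
      using TT' by (subst emeasure_distr) (auto simp: Q)
    also have "\<dots> = (\<integral>\<^sup>+z. emeasure (K z) (T -` A \<inter> space M) * emeasure (K z) (T -` B \<inter> space M) \<partial>N)"
      by (rule emeasure_\<nu>_times) measurable
    also have "\<dots> = (\<integral>\<^sup>+z. emeasure (K (S z)) A * emeasure (K (S z)) B \<partial>N)"
      by (rule nn_integral_cong_AE)
         (use K_equivariant[OF AB(1)] K_equivariant[OF AB(2)] in \<open>eventually_elim, simp\<close>)
    also have "\<dots> = (\<integral>\<^sup>+z. emeasure (K z) A * emeasure (K z) B \<partial>N)"
      by (rule measure_preserving_nn_integral[OF S_mp]) measurable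
    also have "\<dots> = emeasure \<nu> Q" unfolding Q by (rule emeasure_\<nu>_times[symmetric]) measurable
    finally show "emeasure \<nu> Q = emeasure (distr \<nu> \<nu> (map_prod T T)) Q" by simp
  qed auto
  then show ?thesis using TT' by (simp add: measure_preserving_def)
qed

lemma same_fibre_sets: "{(x, x'). x \<in> space M \<and> x' \<in> space M \<and> p x = p x'} \<in> sets (M \<Otimes>\<^sub>M M)"
proof -
  have "{w \<in> space (M \<Otimes>\<^sub>M M). p (fst w) = p (snd w)} \<in> sets (M \<Otimes>\<^sub>M M)"
    using sysN by (intro equal_set_measurable[of N]) (auto simp: is_system_def)
  moreover have "{w \<in> space (M \<Otimes>\<^sub>M M). p (fst w) = p (snd w)} =
      {(x, x'). x \<in> space M \<and> x' \<in> space M \<and> p x = p x'}"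
    by (auto simp: space_pair_measure)
  ultimately show ?thesis by simp
qed

lemma AE_same_fibre: "AE w in \<nu>. w \<in> {(x, x'). x \<in> space M \<and> x' \<in> space M \<and> p x = p x'}"
proof (subst AE_\<nu>_iff)
  show "Measurable.pred (M \<Otimes>\<^sub>M M) (\<lambda>w. w \<in> {(x, x'). x \<in> space M \<and> x' \<in> space M \<and> p x = p x'})"
    using same_fibre_sets by measurable
  show "AE z in N. AE w in K z \<Otimes>\<^sub>M K z. w \<in> {(x, x'). x \<in> space M \<and> x' \<in> space M \<and> p x = p x'}"
    using K_fibre AE_space
  proof eventually_elim
    case (elim z)
    interpret Kz: prob_space "K z" using K_prob elim by blast
    have "AE w in K z \<Otimes>\<^sub>M K z. p (fst w) = z"
      using elim by (intro AE_pair_fstI Kz.prob_space_axioms)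
    moreover have "AE w in K z \<Otimes>\<^sub>M K z. p (snd w) = z"
      using elim by (intro AE_pair_sndI Kz.prob_space_axioms)
    ultimately show ?case using AE_space
      by eventually_elim (use K_space[OF elim(2)] in \<open>auto simp: space_pair_measure\<close>)
  qed
qed

text \<open>Both \<open>\<Omega>\<close> and its preimage under \<open>map_prod T T\<close> have
  full \<open>\<nu>\<close>-measure, so intersecting with \<open>\<Omega>\<close> changes neither
  measures nor invariance. As \<open>p\<close> intertwines \<open>T\<close> and \<open>S\<close>
  only almost everywhere, \<open>map_prod T T\<close> need not map \<open>\<Omega>\<close> into
  itself; here it matters that \<open>is_ergodic\<close> reads invariance modulo null sets.\<close>

lemma is_ergodic_relative_product_iff:
  "is_ergodic (relative_product M N p K) (map_prod T T) \<longleftrightarrow> is_ergodic \<nu> (map_prod T T)"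
proof -
  define \<Omega> where "\<Omega> = {(x, x'). x \<in> space M \<and> x' \<in> space M \<and> p x = p x'}"
  have \<Omega>[measurable]: "\<Omega> \<in> sets \<nu>" using same_fibre_sets by (simp add: \<Omega>_def)
  have sub: "\<Omega> \<inter> space \<nu> = \<Omega>" using sets.sets_into_space[OF \<Omega>] by blast
  have AE1: "AE w in \<nu>. w \<in> \<Omega>" using AE_same_fibre by (simp add: \<Omega>_def)
  have AE2: "AE w in \<nu>. map_prod T T w \<in> \<Omega>" by (rule measure_preserving_AE[OF \<nu>_mp AE1])
  have RP: "relative_product M N p K = restrict_space \<nu> \<Omega>"
    by (simp add: relative_product_def \<Omega>_def fibre_square_def)
  have AEr: "(AE w in restrict_space \<nu> \<Omega>. P w) \<longleftrightarrow> (AE w in \<nu>. P w)" for P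
  proof -
    have "(AE w in restrict_space \<nu> \<Omega>. P w) \<longleftrightarrow> (AE w in \<nu>. w \<in> \<Omega> \<longrightarrow> P w)"
      by (rule AE_restrict_space_iff) (unfold sub, rule \<Omega>)
    also have "\<dots> \<longleftrightarrow> (AE w in \<nu>. P w)"
      using AE1 by (auto elim: eventually_elim2)
    finally show ?thesis .
  qed
  have meas: "measure (restrict_space \<nu> \<Omega>) (A \<inter> \<Omega>) = measure \<nu> A" if A[measurable]: "A \<in> sets \<nu>" for A
  proof -
    have "measure (restrict_space \<nu> \<Omega>) (A \<inter> \<Omega>) = measure \<nu> (A \<inter> \<Omega>)"
      by (rule measure_restrict_space) (unfold sub, rule \<Omega>, blast)
    also have "\<dots> = measure \<nu> A"
    proof (rule \<nu>.finite_measure_eq_AE)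
      show "AE w in \<nu>. w \<in> A \<inter> \<Omega> \<longleftrightarrow> w \<in> A" using AE1 by eventually_elim blast
    qed (use A \<Omega> in \<open>auto simp del: sets_\<nu>\<close>)
    finally show ?thesis .
  qed
  show ?thesis
  proof
    assume L: "is_ergodic (relative_product M N p K) (map_prod T T)"
    show "is_ergodic \<nu> (map_prod T T)"
      unfolding is_ergodic_def
    proof (intro ballI impI)
      fix A assume A: "A \<in> sets \<nu>" and inv: "AE w in \<nu>. map_prod T T w \<in> A \<longleftrightarrow> w \<in> A"
      have "A \<inter> \<Omega> \<in> sets (restrict_space \<nu> \<Omega>)" using A by (auto simp: sets_restrict_space)
      moreover have "AE w in restrict_space \<nu> \<Omega>. map_prod T T w \<in> A \<inter> \<Omega> \<longleftrightarrow> w \<in> A \<inter> \<Omega>"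
        unfolding AEr using inv AE1 AE2 by eventually_elim blast
      ultimately have "measure (restrict_space \<nu> \<Omega>) (A \<inter> \<Omega>) = 0 \<or>
          measure (restrict_space \<nu> \<Omega>) (A \<inter> \<Omega>) = 1"
        using L[unfolded RP is_ergodic_def, THEN bspec, THEN mp] by blast
      then show "measure \<nu> A = 0 \<or> measure \<nu> A = 1" unfolding meas[OF A] .
    qed
  next
    assume L: "is_ergodic \<nu> (map_prod T T)"
    show "is_ergodic (relative_product M N p K) (map_prod T T)"
      unfolding is_ergodic_def RP
    proof (intro ballI impI)
      fix A assume "A \<in> sets (restrict_space \<nu> \<Omega>)"
        and inv: "AE w in restrict_space \<nu> \<Omega>. map_prod T T w \<in> A \<longleftrightarrow> w \<in> A"
      then have "A \<in> sets \<nu> \<and> A \<subseteq> \<Omega>"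
        using sets_restrict_space_iff[of \<Omega> \<nu> A] \<Omega> unfolding sub by blast
      then have A: "A \<in> sets \<nu>" "A \<inter> \<Omega> = A" by blast+
      have "measure \<nu> A = 0 \<or> measure \<nu> A = 1"
        using L[unfolded is_ergodic_def, THEN bspec, THEN mp, OF A(1)] inv unfolding AEr .
      then show "measure (restrict_space \<nu> \<Omega>) A = 0 \<or> measure (restrict_space \<nu> \<Omega>) A = 1"
        using meas[OF A(1)] A(2) by simp
    qed
  qed
qed

end

section \<open>Consequences of nontriviality: the diagonal and the orbits\<close>

context disintegrated_extension
begin

lemma standard_M: "standard_probability_space M" and standard_N: "standard_probability_space N"
  using sysM sysN by (auto simp: is_system_def)

lemma T_inj: "inj_on T (space M)"
  using sysM by (auto simp: is_system_def bij_betw_def)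

lemma Tn_measurable[measurable]: "(T ^^ n) \<in> measurable M M"
  by (rule measure_preserving_measurable[OF measure_preserving_funpow[OF T_mp]])

lemma Tn_inj: "inj_on (T ^^ n) (space M)"
proof (induction n)
  case (Suc n)
  have "(T ^^ n) ` space M \<subseteq> space M" using measurable_space[OF Tn_measurable] by blast
  then show ?case using comp_inj_on[OF Suc inj_on_subset[OF T_inj]] by (simp only: funpow.simps)
qed simp

lemma equal_pred:
  assumes "f \<in> measurable R M" "g \<in> measurable R M"
  shows "Measurable.pred R (\<lambda>x. f x = g x)"
  using equal_set_measurable[OF standard_M assms] by (simp add: pred_def)

text \<open>If \<open>K z \<Otimes>\<^sub>M K z\<close> is carried by the diagonal, then
  \<open>K z\<close> is a point mass, and sending \<open>z\<close> to its atom inverts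
  \<open>p\<close>.\<close>

lemma diagonal_AE_imp_isomorphism:
  assumes diag: "AE w in \<nu>. fst w = snd w"
  shows "is_isomorphism M T N S p"
proof -
  define \<Delta> where "\<Delta> = {w \<in> space (M \<Otimes>\<^sub>M M). fst w = snd w}"
  have \<Delta>[measurable]: "\<Delta> \<in> sets (M \<Otimes>\<^sub>M M)"
    unfolding \<Delta>_def using equal_pred[of fst "M \<Otimes>\<^sub>M M" snd] by (simp add: pred_def)
  define Gd where "Gd = {z \<in> space N. emeasure (K z \<Otimes>\<^sub>M K z) \<Delta> = 1}"
  have Gd[measurable]: "Gd \<in> sets N" unfolding Gd_def by measurable
  have AE_Gd: "AE z in N. z \<in> Gd"
  proof -
    have "AE z in N. AE w in K z \<Otimes>\<^sub>M K z. fst w = snd w"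
      using diag AE_\<nu>_iff[OF equal_pred[of fst _ snd]] by simp
    then show ?thesis using AE_space
    proof eventually_elim
      case (elim z)
      interpret Kz: prob_space "K z" using K_prob elim by blast
      interpret pair_prob_space "K z" "K z" ..
      have s: "sets (K z \<Otimes>\<^sub>M K z) = sets (M \<Otimes>\<^sub>M M)"
        using K_sets[OF elim(2)] by (intro sets_pair_measure_cong)
      have "AE w in K z \<Otimes>\<^sub>M K z. w \<in> \<Delta>"
        using elim(1) AE_space
        by eventually_elim (auto simp: \<Delta>_def sets_eq_imp_space_eq[OF s])
      then have "emeasure (K z \<Otimes>\<^sub>M K z) \<Delta> = 1"
        using emeasure_eq_1_AE[of \<Delta>] s by simp
      then show ?case using elim(2) by (simp add: Gd_def)
    qed
  qed
  have dirac: "\<exists>x\<in>space M. AE y in K z. y = x" if z: "z \<in> Gd" for z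
  proof -
    have zN: "z \<in> space N" using z by (simp add: Gd_def)
    interpret Kz: prob_space "K z" using K_prob zN by blast
    interpret pair_prob_space "K z" "K z" ..
    have s: "sets (K z \<Otimes>\<^sub>M K z) = sets (M \<Otimes>\<^sub>M M)"
      using K_sets[OF zN] by (intro sets_pair_measure_cong)
    have "AE w in K z \<Otimes>\<^sub>M K z. w \<in> \<Delta>"
      using z s by (intro AE_prob_1) (simp add: Gd_def emeasure_eq_measure)
    then have "AE x in K z. AE y in K z. (x, y) \<in> \<Delta>" by (rule AE_pair)
    then have "AE x in K z. x \<in> space M \<and> (AE y in K z. y = x)"
      using AE_space by eventually_elim (auto simp: \<Delta>_def K_space[OF zN] elim: eventually_mono)
    then show ?thesis using eventually_happens Kz.ae_filter_bot by blast
  qed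
  obtain x0 where x0: "x0 \<in> space M" using M.not_empty by blast
  \<comment> \<open>Outside \<open>Gd\<close> there may be no atom to choose; the fixed point
    \<open>x0\<close> only has to keep \<open>q\<close> measurable and inside the space.\<close>
  define q where "q z = (if z \<in> Gd then SOME x. x \<in> space M \<and> (AE y in K z. y = x) else x0)" for z
  have "q z \<in> space M \<and> (AE y in K z. y = q z)" if z: "z \<in> Gd" for z
  proof -
    have qz: "q z = (SOME x. x \<in> space M \<and> (AE y in K z. y = x))" using z by (simp add: q_def)
    show ?thesis unfolding qz by (rule someI_ex) (use dirac[OF z] in blast)
  qed
  then have q: "q z \<in> space M" "AE y in K z. y = q z" if "z \<in> Gd" for z
    using that by blast+
  have q0: "q z = x0" if "z \<notin> Gd" for z using that by (simp add: q_def)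
  have q_measurable[measurable]: "q \<in> measurable N M"
  proof (rule measurableI)
    show "q z \<in> space M" for z by (cases "z \<in> Gd") (use q x0 in \<open>auto simp: q_def\<close>)
    fix B assume B[measurable]: "B \<in> sets M"
    \<comment> \<open>The choice by \<open>SOME\<close> says nothing about measurability in
      \<open>z\<close>. But for a point mass at \<open>q z\<close>, membership of \<open>q z\<close>
      in \<open>B\<close> can be read off from the number \<open>emeasure (K z) B\<close>, which
      depends measurably on \<open>z\<close>.\<close>
    have *: "q z \<in> B \<longleftrightarrow> emeasure (K z) B = 1" if z: "z \<in> Gd" for z
    proof -
      have zN: "z \<in> space N" using z by (simp add: Gd_def)
      interpret Kz: prob_space "K z" using K_prob zN by blast
      have BK: "B \<in> sets (K z)" using K_sets[OF zN] by simp
      show ?thesis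
      proof (cases "q z \<in> B")
        case True
        have "AE y in K z. y \<in> B" using q(2)[OF z] by eventually_elim (use True in simp)
        then show ?thesis using True Kz.emeasure_eq_1_AE[OF BK] by simp
      next
        case False
        have "AE y in K z. y \<notin> B" using q(2)[OF z] by eventually_elim (use False in simp)
        then have "emeasure (K z) B = 0"
          using AE_iff_measurable[of B "K z" "\<lambda>y. y \<notin> B"] BK sets.sets_into_space[OF BK] by auto
        then show ?thesis using False by simp
      qed
    qed
    have "q -` B \<inter> space N = {z \<in> Gd. emeasure (K z) B = 1} \<union> (if x0 \<in> B then space N - Gd else {})"
      using * q0 sets.sets_into_space[OF Gd] by (auto split: if_splits)
    also have "{z \<in> Gd. emeasure (K z) B = 1} = Gd \<inter> {z \<in> space N. emeasure (K z) B = 1}"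
      using sets.sets_into_space[OF Gd] by blast
    also have "Gd \<inter> {z \<in> space N. emeasure (K z) B = 1} \<union> (if x0 \<in> B then space N - Gd else {}) \<in> sets N"
    proof -
      have "{z \<in> space N. emeasure (K z) B = 1} \<in> sets N" by measurable
      then show ?thesis using Gd by auto
    qed
    finally show "q -` B \<inter> space N \<in> sets N" .
  qed
  have qp: "AE x in M. q (p x) = x"
  proof (subst AE_M_iff)
    show "Measurable.pred M (\<lambda>x. q (p x) = x)" by (rule equal_pred) auto
    show "AE z in N. AE x in K z. q (p x) = x"
      using AE_Gd K_fibre
    proof eventually_elim
      case (elim z)
      show ?case using q(2)[OF elim(1)] elim(2) by eventually_elim simp
    qed
  qed
  have pq: "AE z in N. p (q z) = z"
    using AE_Gd K_fibre AE_space
  proof eventually_elim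
    case (elim z)
    interpret Kz: prob_space "K z" using K_prob elim by blast
    have "AE y in K z. p (q z) = z" using q(2)[OF elim(1)] elim(2) by eventually_elim simp
    then show ?case using Kz.ae_filter_bot by (simp add: eventually_const_iff)
  qed
  have "distr N M q = M"
  proof (rule measure_eqI)
    fix B assume "B \<in> sets (distr N M q)"
    then have B[measurable]: "B \<in> sets M" by simp
    have "emeasure (distr N M q) B = emeasure (distr (distr M N p) M q) B" by (simp add: distr_p)
    also have "\<dots> = emeasure (distr M M (q \<circ> p)) B" by (subst distr_distr) auto
    also have "\<dots> = emeasure M ((q \<circ> p) -` B \<inter> space M)" by (subst emeasure_distr) auto
    also have "\<dots> = emeasure M B"
    proof (rule emeasure_eq_AE)
      show "AE x in M. (x \<in> (q \<circ> p) -` B \<inter> space M) = (x \<in> B)"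
        using qp AE_space by eventually_elim auto
    qed auto
    finally show "emeasure (distr N M q) B = emeasure M B" .
  qed simp
  moreover have "AE z in N. q (S z) = T (q z)"
  proof -
    \<comment> \<open>Over a point \<open>p x\<close> the claim follows from \<open>qp\<close> at
      \<open>x\<close> and at \<open>T x\<close>; it descends to \<open>N\<close> because
      \<open>N\<close> is the image of \<open>M\<close> under \<open>p\<close>.\<close>
    have "AE x in M. q (S (p x)) = T (q (p x))"
      using qp measure_preserving_AE[OF T_mp qp] equivariant by eventually_elim simp
    then have "AE z in distr M N p. q (S z) = T (q z)"
      by (subst AE_distr_iff) (use equal_pred[of "\<lambda>z. q (S z)" N "\<lambda>z. T (q z)"] in \<open>auto simp: pred_def\<close>)
    then show ?thesis unfolding distr_p .
  qed
  ultimately have "is_extension N S M T q"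
    using sysM sysN q_measurable by (simp add: is_extension_def)
  then show ?thesis using ext qp pq unfolding is_isomorphism_def by blast
qed

lemma diagonal_null:
  assumes erg: "is_ergodic \<nu> (map_prod T T)" and niso: "\<not> is_isomorphism M T N S p"
  shows "AE w in \<nu>. fst w \<noteq> snd w"
proof -
  define \<Delta> where "\<Delta> = {w \<in> space \<nu>. fst w = snd w}"
  have \<Delta>: "\<Delta> \<in> sets \<nu>"
    unfolding \<Delta>_def using equal_pred[of fst \<nu> snd] by (simp add: pred_def)
  \<comment> \<open>That a pair which is mapped to the diagonal was already on it is the injectivity
    of \<open>T\<close>.\<close>
  have "AE w in \<nu>. map_prod T T w \<in> \<Delta> \<longleftrightarrow> w \<in> \<Delta>"
    using AE_space
  proof eventually_elim
    case (elim w)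
    then show ?case
      using T_inj measurable_space[OF T_measurable] by (cases w) (auto simp: \<Delta>_def inj_on_def)
  qed
  then have "measure \<nu> \<Delta> = 0 \<or> measure \<nu> \<Delta> = 1" using erg \<Delta> unfolding is_ergodic_def by blast
  moreover have "measure \<nu> \<Delta> \<noteq> 1"
  proof
    assume "measure \<nu> \<Delta> = 1"
    then have "AE w in \<nu>. fst w = snd w" using \<nu>.AE_prob_1[of \<Delta>] by (auto simp: \<Delta>_def elim: eventually_mono)
    then show False using diagonal_AE_imp_isomorphism niso by blast
  qed
  ultimately have "measure \<nu> \<Delta> = 0" by blast
  then show ?thesis
    using \<Delta> by (subst AE_iff_measurable[of \<Delta>]) (auto simp: \<nu>.emeasure_eq_measure \<Delta>_def)
qed

text \<open>An atom of \<open>K z\<close> would give the diagonal positive mass. The quantifier over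
  \<open>x\<close> stands inside, so that for a good \<open>z\<close> all points of the fibre can be
  used at once; and it covers every \<open>x\<close>, so that a point fixed in advance is admissible
  too.\<close>

lemma K_diffuse:
  assumes "AE w in \<nu>. fst w \<noteq> snd w"
  shows "AE z in N. \<forall>x. AE y in K z. y \<noteq> x"
proof -
  have "AE z in N. AE w in K z \<Otimes>\<^sub>M K z. fst w \<noteq> snd w"
    using assms AE_\<nu>_iff[of "\<lambda>w. fst w \<noteq> snd w"] equal_pred[of fst "M \<Otimes>\<^sub>M M" snd] by simp
  then show ?thesis using AE_space
  proof eventually_elim
    case (elim z)
    interpret Kz: prob_space "K z" using K_prob elim by blast
    interpret pair_prob_space "K z" "K z" ..
    have Q: "AE x in K z. AE y in K z. y \<noteq> x"
      using AE_pair[OF elim(1)] by (auto elim!: eventually_mono)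
    show ?case
    proof (rule allI, rule ccontr)
      fix x assume nx: "\<not> (AE y in K z. y \<noteq> x)"
      \<comment> \<open>\<open>Q\<close> holds at almost every point and fails at \<open>x\<close>,
        so almost every point differs from \<open>x\<close>, which is just what \<open>nx\<close>
        denies.\<close>
      have "AE y in K z. y \<noteq> x" using Q by eventually_elim (use nx in blast)
      with nx show False by blast
    qed
  qed
qed

text \<open>As \<open>T ^^ k\<close> is injective, at most one \<open>y\<close> violates the claim,
  and \<open>K z\<close> ignores single points.\<close>

lemma K_diffuse_orbits:
  assumes "AE w in \<nu>. fst w \<noteq> snd w"
  shows "AE z in N. \<forall>x. AE y in K z. (T ^^ j) x \<noteq> (T ^^ k) y"
  using K_diffuse[OF assms] AE_space
proof eventually_elim
  case (elim z)
  show ?case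
  proof
    fix x
    show "AE y in K z. (T ^^ j) x \<noteq> (T ^^ k) y"
    proof (cases "\<exists>y1\<in>space M. (T ^^ k) y1 = (T ^^ j) x")
      case True
      then obtain y1 where y1: "y1 \<in> space M" "(T ^^ k) y1 = (T ^^ j) x" by blast
      show ?thesis using elim(1)[rule_format, of y1] AE_space
        by eventually_elim (use y1 Tn_inj K_space[OF elim(2)] in \<open>metis inj_onD\<close>)
    next
      case False
      show ?thesis using AE_space by eventually_elim (use False K_space[OF elim(2)] in metis)
    qed
  qed
qed

lemma AE_distinct_orbits:
  assumes "AE w in \<nu>. fst w \<noteq> snd w"
  shows "AE w in \<nu>. \<forall>j k. (T ^^ j) (fst w) \<noteq> (T ^^ k) (snd w)"
  unfolding AE_all_countable
proof (intro allI)
  fix j k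
  have pr[measurable]: "Measurable.pred (M \<Otimes>\<^sub>M M) (\<lambda>w. (T ^^ j) (fst w) = (T ^^ k) (snd w))"
    by (rule equal_pred) measurable
  have pr': "Measurable.pred (M \<Otimes>\<^sub>M M) (\<lambda>w. (T ^^ j) (fst w) \<noteq> (T ^^ k) (snd w))" by measurable
  show "AE w in \<nu>. (T ^^ j) (fst w) \<noteq> (T ^^ k) (snd w)"
  proof (subst AE_\<nu>_iff[OF pr'])
    show "AE z in N. AE w in K z \<Otimes>\<^sub>M K z. (T ^^ j) (fst w) \<noteq> (T ^^ k) (snd w)"
      using K_diffuse_orbits[OF assms, of j k] AE_space
    proof eventually_elim
      case (elim z)
      interpret Kz: prob_space "K z" using K_prob elim by blast
      interpret pair_prob_space "K z" "K z" ..
      have s: "sets (K z \<Otimes>\<^sub>M K z) = sets (M \<Otimes>\<^sub>M M)"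
        using K_sets[OF elim(2)] by (intro sets_pair_measure_cong)
      show ?case
        by (rule AE_pair_measure)
           (use pr' elim(1) in \<open>auto simp: pred_def s sets_eq_imp_space_eq[OF s]\<close>)
    qed
  qed
qed

text \<open>Compares a fixed point with an \<open>M\<close>-random one. This serves for coordinates
  taken from two independent pairs, whose joint law is not \<open>\<nu>\<close>; with both exponents
  0 it says that \<open>M\<close> has no atoms.\<close>

lemma AE_distinct_orbits_point:
  assumes "AE w in \<nu>. fst w \<noteq> snd w" and x: "x \<in> space M"
  shows "AE y in M. \<forall>j k. (T ^^ j) x \<noteq> (T ^^ k) y"
  unfolding AE_all_countable
proof (intro allI)
  fix j k
  have "(T ^^ j) x \<in> space M" using measurable_space[OF Tn_measurable x] .
  then have pr[measurable]: "Measurable.pred M (\<lambda>y. (T ^^ j) x = (T ^^ k) y)"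
    by (intro equal_pred) auto
  have pr': "Measurable.pred M (\<lambda>y. (T ^^ j) x \<noteq> (T ^^ k) y)" by measurable
  show "AE y in M. (T ^^ j) x \<noteq> (T ^^ k) y"
    using K_diffuse_orbits[OF assms(1), of j k] by (subst AE_M_iff[OF pr']) (auto elim: eventually_mono)
qed

end

section \<open>The space of cocycles\<close>

locale cocycle_space = compact_metric_group G X L d + M: prob_space M
  for G :: "('g, 'm) monoid_scheme" and X :: "'g topology"
    and L :: "'g measure" and d :: "'g \<Rightarrow> 'g \<Rightarrow> real" and M :: "'y measure"
begin

text \<open>As \<open>d\<close> is bounded, this integral metric induces the topology of convergence
  in measure. Unlike the neighbourhoods in \<open>cocycle_open\<close> it adds up along orbits, as
  \<open>defect_lipschitz\<close> needs.\<close>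

definition rho :: "('y \<Rightarrow> 'g) \<Rightarrow> ('y \<Rightarrow> 'g) \<Rightarrow> real" where
  "rho \<phi> \<psi> = (\<integral>y. d (\<phi> y) (\<psi> y) \<partial>M)"

lemma dist_integrable:
  assumes \<phi>[measurable]: "\<phi> \<in> measurable M L" and \<psi>[measurable]: "\<psi> \<in> measurable M L"
  shows "integrable M (\<lambda>y. d (\<phi> y) (\<psi> y))"
proof -
  obtain D where D: "\<And>g h. g \<in> carrier G \<Longrightarrow> h \<in> carrier G \<Longrightarrow> d g h \<le> D" using dist_bounded by blast
  show ?thesis
    by (rule M.integrable_const_bound[of _ D])
       (use D measurable_L_closed[OF \<phi>] measurable_L_closed[OF \<psi>] in auto)
qed

lemma rho_nonneg: "rho \<phi> \<psi> \<ge> 0"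
  unfolding rho_def by (rule Bochner_Integration.integral_nonneg) simp

lemma rho_commute: "rho \<phi> \<psi> = rho \<psi> \<phi>"
  unfolding rho_def using MG.commute by presburger

lemma rho_triangle:
  assumes "\<phi> \<in> measurable M L" "\<psi> \<in> measurable M L" "\<xi> \<in> measurable M L"
  shows "rho \<phi> \<xi> \<le> rho \<phi> \<psi> + rho \<psi> \<xi>"
proof -
  have "rho \<phi> \<xi> \<le> (\<integral>y. d (\<phi> y) (\<psi> y) + d (\<psi> y) (\<xi> y) \<partial>M)"
    unfolding rho_def
    using measurable_L_closed[OF assms(1)] measurable_L_closed[OF assms(2)] measurable_L_closed[OF assms(3)]
    by (intro integral_mono Bochner_Integration.integrable_add dist_integrable assms MG.triangle)
  also have "\<dots> = rho \<phi> \<psi> + rho \<psi> \<xi>"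
    unfolding rho_def using assms dist_integrable by simp
  finally show ?thesis .
qed

lemma rho_eq_0_iff:
  assumes "\<phi> \<in> measurable M L" "\<psi> \<in> measurable M L"
  shows "rho \<phi> \<psi> = 0 \<longleftrightarrow> (AE y in M. \<phi> y = \<psi> y)"
proof -
  have "rho \<phi> \<psi> = 0 \<longleftrightarrow> (AE y in M. d (\<phi> y) (\<psi> y) = 0)"
    unfolding rho_def by (rule integral_nonneg_eq_0_iff_AE[OF dist_integrable[OF assms]]) simp
  also have "\<dots> \<longleftrightarrow> (AE y in M. \<phi> y = \<psi> y)"
    by (rule AE_cong)
       (use measurable_L_closed[OF assms(1)] measurable_L_closed[OF assms(2)] in simp)
  finally show ?thesis .
qed

lemma cocycle_class_eq_iff:
  assumes "\<phi> \<in> measurable M L" "\<psi> \<in> measurable M L"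
  shows "cocycle_class M X \<phi> = cocycle_class M X \<psi> \<longleftrightarrow> (AE y in M. \<phi> y = \<psi> y)"
proof
  assume "cocycle_class M X \<phi> = cocycle_class M X \<psi>"
  moreover have "\<phi> \<in> cocycle_class M X \<phi>" using assms by (simp add: cocycle_class_def measurable_L_iff)
  ultimately show "AE y in M. \<phi> y = \<psi> y" by (auto simp: cocycle_class_def)
next
  assume "AE y in M. \<phi> y = \<psi> y"
  then have "(AE y in M. \<xi> y = \<phi> y) \<longleftrightarrow> (AE y in M. \<xi> y = \<psi> y)" for \<xi> :: "'y \<Rightarrow> 'g"
    by (auto elim: eventually_elim2)
  then show "cocycle_class M X \<phi> = cocycle_class M X \<psi>" by (simp add: cocycle_class_def)
qed

definition representative :: "('y \<Rightarrow> 'g) set \<Rightarrow> 'y \<Rightarrow> 'g" where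
  "representative c = (SOME \<phi>. \<phi> \<in> c)"

lemma in_cocycle_class: "\<phi> \<in> measurable M L \<Longrightarrow> \<phi> \<in> cocycle_class M X \<phi>"
  by (simp add: cocycle_class_def measurable_L_iff)

lemma class_in_cocycles: "\<phi> \<in> measurable M L \<Longrightarrow> cocycle_class M X \<phi> \<in> cocycles M X"
  by (simp add: cocycles_def measurable_L_iff)

lemma cocycle_member:
  assumes "c \<in> cocycles M X" "\<phi> \<in> c"
  shows "\<phi> \<in> measurable M L" "cocycle_class M X \<phi> = c"
proof -
  obtain \<psi> where \<psi>: "\<psi> \<in> measurable M L" "c = cocycle_class M X \<psi>"
    using assms(1) unfolding cocycles_def measurable_L_iff by blast
  then show m: "\<phi> \<in> measurable M L"
    using assms(2) unfolding cocycle_class_def measurable_L_iff by blast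
  show "cocycle_class M X \<phi> = c"
    using assms(2) cocycle_class_eq_iff[OF m \<psi>(1)] unfolding \<psi>(2)
    by (auto simp: cocycle_class_def[of _ _ \<psi>])
qed

lemma representative:
  assumes "c \<in> cocycles M X"
  shows "representative c \<in> measurable M L" "cocycle_class M X (representative c) = c"
proof -
  have "\<exists>\<phi>. \<phi> \<in> c" using assms in_cocycle_class by (auto simp: cocycles_def measurable_L_iff)
  then have "representative c \<in> c" unfolding representative_def by (rule someI_ex)
  then show "representative c \<in> measurable M L" "cocycle_class M X (representative c) = c"
    using cocycle_member[OF assms] by auto
qed

definition class_dist :: "('y \<Rightarrow> 'g) set \<Rightarrow> ('y \<Rightarrow> 'g) set \<Rightarrow> real" where
  "class_dist c c' = rho (representative c) (representative c')"

lemma class_dist_class: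
  assumes "\<phi> \<in> measurable M L" "\<psi> \<in> measurable M L"
  shows "class_dist (cocycle_class M X \<phi>) (cocycle_class M X \<psi>) = rho \<phi> \<psi>"
proof -
  have AE_rep: "AE y in M. representative (cocycle_class M X \<xi>) y = \<xi> y" if "\<xi> \<in> measurable M L" for \<xi>
    using representative[OF class_in_cocycles[OF that]] cocycle_class_eq_iff that by blast
  show ?thesis
    unfolding class_dist_def rho_def
  proof (rule integral_cong_AE)
    show "AE y in M. d (representative (cocycle_class M X \<phi>) y) (representative (cocycle_class M X \<psi>) y)
        = d (\<phi> y) (\<psi> y)"
      using AE_rep[OF assms(1)] AE_rep[OF assms(2)] by eventually_elim simp
  qed (use representative class_in_cocycles assms in \<open>auto intro!: measurable_dist\<close>)
qed

sublocale C: Metric_space "cocycles M X" class_dist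
proof
  fix a b c assume abc: "a \<in> cocycles M X" "b \<in> cocycles M X"
  show "class_dist a b = 0 \<longleftrightarrow> a = b"
    unfolding class_dist_def
    using rho_eq_0_iff cocycle_class_eq_iff representative abc by metis
  assume "c \<in> cocycles M X"
  then show "class_dist a c \<le> class_dist a b + class_dist b c"
    unfolding class_dist_def using abc representative by (intro rho_triangle) auto
qed (simp_all add: class_dist_def rho_nonneg rho_commute)

text \<open>Boundedness of \<open>d\<close> makes closeness in measure imply closeness in
  \<open>rho\<close>; the converse is Markov's inequality.\<close>

lemma mtopology_eq_cocycle_topology: "C.mtopology = cocycle_topology M X d"
proof (rule topology_eq[THEN iffD2], intro allI)
  fix U
  obtain D where D: "D > 0" "\<And>g h. g \<in> carrier G \<Longrightarrow> h \<in> carrier G \<Longrightarrow> d g h \<le> D"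
    using dist_bounded by blast
  have "openin C.mtopology U \<longleftrightarrow> cocycle_open M X d U"
  proof
    assume o: "openin C.mtopology U"
    show "cocycle_open M X d U"
      unfolding cocycle_open_def measurable_L_iff[symmetric]
    proof (intro conjI ballI impI)
      show "U \<subseteq> cocycles M X" using o C.openin_mtopology by blast
      fix \<phi> assume \<phi>[measurable]: "\<phi> \<in> measurable M L" and c: "cocycle_class M X \<phi> \<in> U"
      obtain r where r: "r > 0" "C.mball (cocycle_class M X \<phi>) r \<subseteq> U"
        using o c unfolding C.openin_mtopology by blast
      \<comment> \<open>Off the exceptional set the distance is below \<open>e\<close>, on it at
        most \<open>D\<close>, so \<open>rho\<close> is at most \<open>e * (1 + D)\<close>; the
        factor 2 makes this strictly less than \<open>r\<close>.\<close>
      define e where "e = r / (2 * (1 + D))"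
      have "e * (1 + D) = r / 2" using D(1) by (simp add: e_def field_simps)
      then have e: "e > 0" "e * (1 + D) < r"
        using r(1) D(1) by (simp add: e_def, linarith)
      have "cocycle_class M X \<psi> \<in> U"
        if \<psi>[measurable]: "\<psi> \<in> measurable M L" and m: "measure M {y \<in> space M. d (\<phi> y) (\<psi> y) \<ge> e} < e" for \<psi>
      proof -
        define A where "A = {y \<in> space M. d (\<phi> y) (\<psi> y) \<ge> e}"
        have A[measurable]: "A \<in> sets M" unfolding A_def by measurable
        have iA: "integrable M (indicator A :: _ \<Rightarrow> real)"
          by (rule M.integrable_const_bound[of _ 1]) (auto simp: indicator_def)
        have "rho \<phi> \<psi> \<le> (\<integral>y. e + D * indicator A y \<partial>M)"
          unfolding rho_def
        proof (rule integral_mono)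
          fix y assume y: "y \<in> space M"
          have "d (\<phi> y) (\<psi> y) \<le> D" by (rule D(2)[OF measurable_L_closed[OF \<phi> y] measurable_L_closed[OF \<psi> y]])
          then show "d (\<phi> y) (\<psi> y) \<le> e + D * indicator A y"
            using y e by (auto simp: A_def indicator_def)
        qed (use dist_integrable iA in auto)
        also have "\<dots> = e + D * measure M A" using iA by (simp add: M.prob_space)
        also have "\<dots> \<le> e + D * e" using m D unfolding A_def by (intro add_left_mono mult_left_mono) auto
        also have "\<dots> < r" using e by (simp add: algebra_simps)
        finally show ?thesis
          using r(2) class_in_cocycles class_dist_class \<phi> \<psi> by (auto simp: C.in_mball)
      qed
      then show "\<exists>e>0. \<forall>\<psi>\<in>measurable M L.
          measure M {y \<in> space M. e \<le> d (\<phi> y) (\<psi> y)} < e \<longrightarrow> cocycle_class M X \<psi> \<in> U"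
        using e(1) by blast
    qed
  next
    assume o: "cocycle_open M X d U"
    show "openin C.mtopology U"
      unfolding C.openin_mtopology
    proof (intro conjI allI impI)
      show U: "U \<subseteq> cocycles M X" using o by (simp add: cocycle_open_def)
      fix c assume c: "c \<in> U"
      define \<phi> where "\<phi> = representative c"
      have \<phi>[measurable]: "\<phi> \<in> measurable M L" and \<phi>c: "cocycle_class M X \<phi> = c"
        using representative U c by (auto simp: \<phi>_def)
      obtain e where e: "e > 0" "\<And>\<psi>. \<psi> \<in> measurable M L \<Longrightarrow>
          measure M {y \<in> space M. d (\<phi> y) (\<psi> y) \<ge> e} < e \<Longrightarrow> cocycle_class M X \<psi> \<in> U"
        using o c \<phi> \<phi>c unfolding cocycle_open_def measurable_L_iff[symmetric] by blast
      \<comment> \<open>Markov's inequality at level \<open>e\<close> divides the radius by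
        \<open>e\<close>, so the radius \<open>e * e\<close> leaves an exceptional set of measure
        below \<open>e\<close>.\<close>
      have "C.mball c (e * e) \<subseteq> U"
      proof
        fix c' assume c': "c' \<in> C.mball c (e * e)"
        define \<psi> where "\<psi> = representative c'"
        have \<psi>[measurable]: "\<psi> \<in> measurable M L" and \<psi>c: "cocycle_class M X \<psi> = c'"
          using representative c' by (auto simp: \<psi>_def)
        define A where "A = {y \<in> space M. d (\<phi> y) (\<psi> y) \<ge> e}"
        have A[measurable]: "A \<in> sets M" unfolding A_def by measurable
        have iA: "integrable M (indicator A :: _ \<Rightarrow> real)"
          by (rule M.integrable_const_bound[of _ 1]) (auto simp: indicator_def)
        have "e * measure M A = (\<integral>y. e * indicator A y \<partial>M)" by simp
        also have "\<dots> \<le> rho \<phi> \<psi>"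
          unfolding rho_def
        proof (rule integral_mono)
          show "e * indicator A y \<le> d (\<phi> y) (\<psi> y)" for y by (auto simp: A_def indicator_def)
        qed (use iA dist_integrable in auto)
        also have "\<dots> < e * e" using c' by (simp add: class_dist_def \<phi>_def \<psi>_def)
        finally have "measure M A < e" using e(1) by simp
        then show "c' \<in> U" using e(2)[OF \<psi>] \<psi>c by (simp add: A_def)
      qed
      then show "\<exists>r>0. C.mball c r \<subseteq> U" using e(1) by (intro exI[of _ "e * e"]) auto
    qed
  qed
  then show "openin C.mtopology U = openin (cocycle_topology M X d) U"
    using openin_cocycle_topology[OF M.finite_measure_axioms metric second_countable] by simp
qed

lemma pointwise_Cauchy:
  assumes c: "\<And>k. f k \<in> carrier G" and s: "summable (\<lambda>k. d (f k) (f (Suc k)))"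
  shows "\<exists>l. limitin X f l sequentially"
proof -
  have "MG.MCauchy f"
    unfolding MG.MCauchy_def
  proof (intro conjI allI impI)
    show "range f \<subseteq> carrier G" using c by blast
    fix e :: real assume "e > 0"
    then obtain n0 where n0: "\<And>m n. m \<ge> n0 \<Longrightarrow> norm (\<Sum>k=m..<n. d (f k) (f (Suc k))) < e"
      using s unfolding summable_Cauchy by blast
    have le: "d (f m) (f n) \<le> (\<Sum>k=m..<n. d (f k) (f (Suc k)))" if "m \<le> n" for m n
      using that
    proof (induction n rule: dec_induct)
      case (step n)
      have "d (f m) (f (Suc n)) \<le> d (f m) (f n) + d (f n) (f (Suc n))" using c by (intro MG.triangle)
      then show ?case using step by simp
    qed (use c MG.mdist_zero in simp)
    show "\<exists>n0. \<forall>m n. n0 \<le> m \<longrightarrow> n0 \<le> n \<longrightarrow> d (f m) (f n) < e"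
    proof (intro exI allI impI)
      fix m n assume "n0 \<le> m" "n0 \<le> n"
      then show "d (f m) (f n) < e"
        using le[of m n] le[of n m] n0[of m n] n0[of n m] MG.commute[of "f m" "f n"]
        by (cases "m \<le> n") (auto simp: abs_less_iff intro: order_le_less_trans)
    qed
  qed
  then show ?thesis using mcomplete mtopology_eq unfolding MG.mcomplete_def by metis
qed

text \<open>The Riesz-Fischer argument: a subsequence with \<open>rho\<close>-steps below
  \<open>(1/2) ^ k\<close> converges pointwise almost everywhere, dominated convergence makes the
  limit a limit for \<open>rho\<close>, and a Cauchy sequence follows its convergent subsequence.
  Completeness is what Baire's theorem asks for.\<close>

lemma cocycles_mcomplete: "C.mcomplete"
  unfolding C.mcomplete_def
proof (intro allI impI)
  fix \<sigma> assume \<sigma>: "C.MCauchy \<sigma>"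
  then have \<sigma>M: "range \<sigma> \<subseteq> cocycles M X" by (simp add: C.MCauchy_def)
  have "\<exists>n0. \<forall>m\<ge>n0. \<forall>n\<ge>n0. class_dist (\<sigma> m) (\<sigma> n) < (1/2) ^ k" for k
    using \<sigma> unfolding C.MCauchy_def by (metis half_gt_zero_iff zero_less_one zero_less_power zero_less_divide_1_iff zero_less_numeral)
  then obtain n0 where n0: "\<And>k m n. m \<ge> n0 k \<Longrightarrow> n \<ge> n0 k \<Longrightarrow> class_dist (\<sigma> m) (\<sigma> n) < (1/2) ^ k"
    by metis
  \<comment> \<open>Strictly increasing, and at least \<open>n0 k\<close> at \<open>k\<close>, so
    that consecutive members of the subsequence are within \<open>(1/2) ^ k\<close>.\<close>
  define r where "r = rec_nat (n0 0) (\<lambda>k m. Suc (max m (n0 (Suc k))))"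
  have rS: "r (Suc k) = Suc (max (r k) (n0 (Suc k)))" for k by (simp add: r_def)
  have r: "strict_mono r" by (rule strict_mono_Suc_iff[THEN iffD2]) (simp add: rS less_Suc_eq_le)
  have rn: "r k \<ge> n0 k" for k by (cases k) (simp_all add: rS, simp add: r_def)
  define f where "f k = representative (\<sigma> (r k))" for k
  have f[measurable]: "f k \<in> measurable M L" for k
    unfolding f_def using representative \<sigma>M by blast
  have fc: "cocycle_class M X (f k) = \<sigma> (r k)" for k
    unfolding f_def using representative \<sigma>M by blast
  have fr: "rho (f k) (f (Suc k)) < (1/2) ^ k" for k
  proof -
    have "r (Suc k) \<ge> n0 k" using rn[of k] rS[of k] by simp
    then show ?thesis using n0[OF rn[of k]] by (simp add: f_def class_dist_def)
  qed
  have fin: "(\<integral>\<^sup>+y. (\<Sum>k. ennreal (d (f k y) (f (Suc k) y))) \<partial>M) \<noteq> \<infinity>"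
  proof -
    have "(\<integral>\<^sup>+y. (\<Sum>k. ennreal (d (f k y) (f (Suc k) y))) \<partial>M)
        = (\<Sum>k. \<integral>\<^sup>+y. ennreal (d (f k y) (f (Suc k) y)) \<partial>M)"
      by (rule nn_integral_suminf) measurable
    also have "\<dots> = (\<Sum>k. ennreal (rho (f k) (f (Suc k))))"
      unfolding rho_def by (intro suminf_cong nn_integral_eq_integral dist_integrable) auto
    also have "\<dots> \<le> (\<Sum>k. ennreal ((1/2) ^ k))"
      by (intro suminf_le) (auto intro!: ennreal_leI less_imp_le[OF fr])
    also have "\<dots> < \<infinity>" by (subst suminf_ennreal2) auto
    finally show ?thesis by simp
  qed
  define Gs where "Gs = {y \<in> space M. (\<Sum>k. ennreal (d (f k y) (f (Suc k) y))) \<noteq> \<infinity>}"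
  have Gs[measurable]: "Gs \<in> sets M" unfolding Gs_def by measurable
  have "AE y in M. (\<Sum>k. ennreal (d (f k y) (f (Suc k) y))) \<noteq> \<infinity>"
    by (rule nn_integral_PInf_AE[OF _ fin]) measurable
  then have AE_Gs: "AE y in M. y \<in> Gs"
    using AE_space by eventually_elim (simp add: Gs_def)
  have lim: "\<exists>l. limitin X (\<lambda>k. f k y) l sequentially" if y: "y \<in> Gs" for y
  proof (rule pointwise_Cauchy)
    show "f k y \<in> carrier G" for k using measurable_L_closed[OF f] y by (simp add: Gs_def)
    show "summable (\<lambda>k. d (f k y) (f (Suc k) y))"
      using y by (intro summable_suminf_not_top) (auto simp: Gs_def)
  qed
  define \<psi> where "\<psi> y = (if y \<in> Gs then SOME l. limitin X (\<lambda>k. f k y) l sequentially else \<one>\<^bsub>G\<^esub>)" for y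
  have \<psi>lim: "limitin MG.mtopology (\<lambda>k. f k y) (\<psi> y) sequentially" if "y \<in> Gs" for y
    using someI_ex[OF lim[OF that]] that by (simp add: \<psi>_def mtopology_eq)
  have \<psi>c: "\<psi> y \<in> carrier G" for y
    using \<psi>lim[of y] MG.limitin_mspace by (cases "y \<in> Gs") (auto simp: \<psi>_def)
  have \<psi>dist: "(\<lambda>k. d (f k y) (\<psi> y)) \<longlonglongrightarrow> 0" if "y \<in> Gs" for y
    using \<psi>lim[OF that] by (simp add: MG.limitin_metric_dist_null)
  have \<psi>[measurable]: "\<psi> \<in> measurable M L"
  proof (rule measurable_L_distI)
    fix g assume g: "g \<in> carrier G"
    have [measurable]: "(\<lambda>_. g) \<in> measurable M L" using g by (rule const_measurable)
    show "(\<lambda>y. d (\<psi> y) g) \<in> borel_measurable M"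
    proof (rule borel_measurable_LIMSEQ_real)
      fix y assume y: "y \<in> space M"
      \<comment> \<open>Off \<open>Gs\<close> the sequence is replaced by its constant limit, so
        that convergence holds at every point, as the measurability of a pointwise limit
        requires.\<close>
      show "(\<lambda>k. if y \<in> Gs then d (f k y) g else d \<one>\<^bsub>G\<^esub> g) \<longlonglongrightarrow> d (\<psi> y) g"
      proof (cases "y \<in> Gs")
        case True
        have "\<bar>d (f k y) g - d (\<psi> y) g\<bar> \<le> d (f k y) (\<psi> y)" for k
          using MG.triangle[of "f k y" "\<psi> y" g] MG.triangle[of "\<psi> y" "f k y" g]
            measurable_L_closed[OF f y] \<psi>c g MG.commute[of "\<psi> y" "f k y"] by force
        then have "(\<lambda>k. d (f k y) g - d (\<psi> y) g) \<longlonglongrightarrow> 0"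
          by (intro Lim_null_comparison[OF _ \<psi>dist[OF True]]) auto
        then show ?thesis using True by (simp add: LIM_zero_iff)
      qed (simp add: \<psi>_def)
    qed measurable
  qed (rule \<psi>c)
  have "(\<lambda>k. rho (f k) \<psi>) \<longlonglongrightarrow> (\<integral>y. 0 \<partial>M)"
  proof -
    obtain D where D: "D > 0" "\<And>g h. g \<in> carrier G \<Longrightarrow> h \<in> carrier G \<Longrightarrow> d g h \<le> D"
      using dist_bounded by blast
    show ?thesis unfolding rho_def
    proof (rule integral_dominated_convergence[where w="\<lambda>_. D"])
      show "AE y in M. (\<lambda>k. d (f k y) (\<psi> y)) \<longlonglongrightarrow> 0"
        using AE_Gs by eventually_elim (rule \<psi>dist)
      show "AE y in M. norm (d (f k y) (\<psi> y)) \<le> D" for k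
        using D(2) measurable_L_closed[OF f] \<psi>c by auto
    qed auto
  qed
  then have "limitin C.mtopology (\<sigma> \<circ> r) (cocycle_class M X \<psi>) sequentially"
    using class_in_cocycles[OF \<psi>] \<sigma>M class_dist_class[OF f \<psi>]
    by (auto simp: C.limitin_metric_dist_null fc subset_iff)
  then show "\<exists>x. limitin C.mtopology \<sigma> x sequentially"
    using C.MCauchy_convergent_subsequence[OF \<sigma> r] by blast
qed

text \<open>Baire's theorem in the complete metric space of classes. Density is stated for functions
  and \<open>rho\<close>, so that no representatives have to be chosen where it is verified.\<close>

lemma generic_cocycleI:
  assumes I: "countable I" and o: "\<And>i. i \<in> I \<Longrightarrow> openin C.mtopology (U i)"
    and dense: "\<And>i \<phi> e. i \<in> I \<Longrightarrow> \<phi> \<in> measurable M L \<Longrightarrow> e > 0 \<Longrightarrow>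
      \<exists>\<psi>\<in>measurable M L. rho \<phi> \<psi> < e \<and> cocycle_class M X \<psi> \<in> U i"
    and P: "\<And>\<phi>. \<phi> \<in> measurable M L \<Longrightarrow> (\<And>i. i \<in> I \<Longrightarrow> cocycle_class M X \<phi> \<in> U i) \<Longrightarrow> P \<phi>"
  shows "generic_cocycle M X d P"
proof -
  \<comment> \<open>The whole space is added to make the family nonempty: for an empty
    \<open>I\<close> the intersection would otherwise leave the space.\<close>
  define \<G> where "\<G> = insert (cocycles M X) (U ` I)"
  have o': "openin C.mtopology W" if "W \<in> \<G>" for W
    using that o C.open_in_mspace by (auto simp: \<G>_def)
  have d': "C.mtopology closure_of W = cocycles M X" if W: "W \<in> \<G>" for W
  proof (cases "W = cocycles M X")
    case True
    then show ?thesis using closure_of_topspace[of C.mtopology] by simp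
  next
    case False
    then obtain i where i: "i \<in> I" "W = U i" using W by (auto simp: \<G>_def)
    have "c \<in> C.mtopology closure_of W" if c: "c \<in> cocycles M X" for c
      unfolding C.metric_closure_of
    proof (clarsimp simp: c)
      fix r :: real assume r: "r > 0"
      obtain \<psi> where \<psi>: "\<psi> \<in> measurable M L" "rho (representative c) \<psi> < r" "cocycle_class M X \<psi> \<in> U i"
        using dense[OF i(1) representative(1)[OF c] r] by blast
      have "class_dist c (cocycle_class M X \<psi>) < r"
        using class_dist_class[OF representative(1)[OF c] \<psi>(1)] representative(2)[OF c] \<psi>(2) by simp
      then show "\<exists>y\<in>W. y \<in> cocycles M X \<and> class_dist c y < r"
        using \<psi>(3) i(2) class_in_cocycles[OF \<psi>(1)] by blast
    qed
    then show ?thesis using closure_of_subset_topspace[of C.mtopology W] by auto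
  qed
  have c: "countable \<G>" using I by (simp add: \<G>_def)
  have cl: "C.mtopology closure_of \<Inter>\<G> = cocycles M X"
    using o' d' by (intro C.metric_Baire_category[OF cocycles_mcomplete c]) blast
  have gd: "gdelta_in C.mtopology (\<Inter>\<G>)"
    using o' c by (intro gdelta_in_Inter) (auto simp: \<G>_def intro: open_imp_gdelta_in)
  show ?thesis
    unfolding generic_cocycle_def
  proof (intro exI conjI ballI)
    show "gdelta_in (cocycle_topology M X d) (\<Inter>\<G>)" using gd mtopology_eq_cocycle_topology by simp
    show "cocycle_topology M X d closure_of \<Inter>\<G> = cocycles M X"
      using cl mtopology_eq_cocycle_topology by simp
    fix c \<phi> assume "c \<in> \<Inter>\<G>" "\<phi> \<in> c"
    then have "c \<in> cocycles M X" "\<And>i. i \<in> I \<Longrightarrow> c \<in> U i" by (auto simp: \<G>_def)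
    then show "P \<phi>" using cocycle_member[of c \<phi>] \<open>\<phi> \<in> c\<close> P by metis
  qed
qed

end

section \<open>Averages over the skew product\<close>

context compact_metric_group
begin

text \<open>The Lipschitz inequality does not force \<open>C \<ge> 0\<close> when \<open>G\<close>
  has one element. Values in the unit interval keep a product of two such functions bounded by 1 and
  Lipschitz.\<close>

definition unit_lipschitz :: "real \<Rightarrow> ('g \<Rightarrow> real) \<Rightarrow> bool" where
  "unit_lipschitz C u \<longleftrightarrow> C \<ge> 0 \<and> (\<forall>g\<in>carrier G. 0 \<le> u g \<and> u g \<le> 1) \<and>
     (\<forall>g\<in>carrier G. \<forall>h\<in>carrier G. \<bar>u g - u h\<bar> \<le> C * d g h)"

lemma unit_lipschitz_measurable: "unit_lipschitz C u \<Longrightarrow> u \<in> borel_measurable L"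
  using measurable_lipschitz[of u C] by (simp add: unit_lipschitz_def)

text \<open>The case distinction avoids the infimum over the empty set.\<close>

definition bump :: "'g set \<Rightarrow> nat \<Rightarrow> 'g \<Rightarrow> real" where
  "bump C j h = (if C = carrier G then 1 else min 1 (real j * (INF x\<in>carrier G - C. d h x)))"

text \<open>The distance to the complement of \<open>C\<close> is 1-Lipschitz; scaling by
  \<open>j\<close> gives the constant, and truncation at 1 does not increase it.\<close>

lemma bump_unit_lipschitz:
  assumes C: "C \<subseteq> carrier G"
  shows "unit_lipschitz (real j) (bump C j)"
proof (cases "C = carrier G")
  case True
  then show ?thesis by (auto simp: unit_lipschitz_def bump_def)
next
  case False
  then have ne: "carrier G - C \<noteq> {}" using C by blast
  define i where "i h = (INF x\<in>carrier G - C. d h x)" for h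
  have bdd: "bdd_below (d h ` (carrier G - C))" for h by (rule bdd_belowI2[of _ 0]) simp
  have i0: "i h \<ge> 0" for h unfolding i_def using ne by (intro cINF_greatest) auto
  have i1: "i g \<le> i h + d g h" if gh: "g \<in> carrier G" "h \<in> carrier G" for g h
  proof -
    have "i g - d g h \<le> i h"
      unfolding i_def[of h]
    proof (rule cINF_greatest[OF ne])
      fix x assume x: "x \<in> carrier G - C"
      have "i g \<le> d g x" unfolding i_def by (rule cINF_lower[OF bdd x])
      also have "\<dots> \<le> d g h + d h x" using gh x by (intro MG.triangle) auto
      finally show "i g - d g h \<le> d h x" by simp
    qed
    then show ?thesis by simp
  qed
  have b: "bump C j h = min 1 (real j * i h)" for h using False by (simp add: bump_def i_def)
  have "\<bar>bump C j g - bump C j h\<bar> \<le> real j * d g h" if gh: "g \<in> carrier G" "h \<in> carrier G" for g h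
  proof -
    have "real j * i g \<le> real j * i h + real j * d g h" "real j * i h \<le> real j * i g + real j * d g h"
      using mult_left_mono[OF i1[OF gh], of "real j"] mult_left_mono[OF i1[OF gh(2,1)], of "real j"]
        MG.commute[of g h] by (auto simp: algebra_simps)
    then show ?thesis unfolding b by (auto simp: min_def abs_le_iff)
  qed
  then show ?thesis using i0 by (auto simp: unit_lipschitz_def b)
qed

text \<open>Openness of \<open>C\<close> makes the distance to its complement positive at points of
  \<open>C\<close>, so the truncated multiples are eventually 1; off \<open>C\<close> the distance
  is 0.\<close>

lemma bump_tendsto_indicator:
  assumes C: "openin X C" and h: "h \<in> carrier G"
  shows "(\<lambda>j. bump C j h) \<longlonglongrightarrow> indicator C h"
proof (cases "C = carrier G")
  case True
  then show ?thesis using h by (simp add: bump_def)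
next
  case False
  have Cs: "C \<subseteq> carrier G" using C openin_subset topspace_X by metis
  then have ne: "carrier G - C \<noteq> {}" using False by blast
  define i where "i = (INF x\<in>carrier G - C. d h x)"
  have bdd: "bdd_below (d h ` (carrier G - C))" by (rule bdd_belowI2[of _ 0]) simp
  have b: "bump C j h = min 1 (real j * i)" for j using False by (simp add: bump_def i_def)
  show ?thesis
  proof (cases "h \<in> C")
    case True
    then obtain r where r: "r > 0" "MG.mball h r \<subseteq> C"
      using C MG.openin_mtopology mtopology_eq by metis
    have "i \<ge> r"
      unfolding i_def
    proof (rule cINF_greatest[OF ne])
      fix x assume "x \<in> carrier G - C"
      then show "r \<le> d h x" using r(2) h by (force simp: not_less[symmetric])
    qed
    then have i: "i > 0" using r by simp
    obtain j0 :: nat where j0: "1 / i \<le> real j0" using real_arch_simple by blast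
    have "bump C j h = 1" if "j \<ge> j0" for j
    proof -
      have "1 / i \<le> real j" using j0 that by linarith
      then have "1 \<le> real j * i" using i by (simp add: field_simps)
      then show ?thesis by (simp add: b)
    qed
    then have "eventually (\<lambda>j. bump C j h = 1) sequentially" unfolding eventually_sequentially by blast
    then show ?thesis using True tendsto_eventually by auto
  next
    case hC: False
    have "i \<le> d h h" unfolding i_def using h hC by (intro cINF_lower[OF bdd]) auto
    moreover have "i \<ge> 0" unfolding i_def using ne by (intro cINF_greatest) auto
    ultimately have "i = 0" using h by simp
    then show ?thesis using hC by (simp add: b)
  qed
qed

lemma haar_pair_left:
  assumes g: "g \<in> carrier G" and h: "h \<in> carrier G"
  shows "distr (L \<Otimes>\<^sub>M L) (L \<Otimes>\<^sub>M L) (\<lambda>x. (g \<otimes>\<^bsub>G\<^esub> fst x, h \<otimes>\<^bsub>G\<^esub> snd x)) = L \<Otimes>\<^sub>M L"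
proof -
  have [measurable]: "(\<lambda>_. g) \<in> measurable L L" "(\<lambda>_. h) \<in> measurable L L"
    using g h const_measurable by auto
  have "distr L L (\<lambda>x. g \<otimes>\<^bsub>G\<^esub> x) \<Otimes>\<^sub>M distr L L (\<lambda>x. h \<otimes>\<^bsub>G\<^esub> x) =
      distr (L \<Otimes>\<^sub>M L) (L \<Otimes>\<^sub>M L) (\<lambda>(x, y). (g \<otimes>\<^bsub>G\<^esub> x, h \<otimes>\<^bsub>G\<^esub> y))"
    by (rule pair_measure_distr) (use h haar_left L.sigma_finite_measure_axioms in auto)
  then show ?thesis using g h by (simp add: haar_left case_prod_beta')
qed

end

section \<open>The square of the skew product as a skew product over the fibre square\<close>

locale group_extension_setting =
  cocycle_space G X L d M + disintegrated_extension M T N S p K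
  for G :: "('g, 'm) monoid_scheme" and X :: "'g topology" and L :: "'g measure"
    and d :: "'g \<Rightarrow> 'g \<Rightarrow> real" and M :: "'y measure" and T :: "'y \<Rightarrow> 'y"
    and N :: "'z measure" and S :: "'z \<Rightarrow> 'z" and p :: "'y \<Rightarrow> 'z" and K :: "'z \<Rightarrow> 'y measure"
begin

abbreviation V :: "(('y \<times> 'y) \<times> ('g \<times> 'g)) measure" where
  "V \<equiv> \<nu> \<Otimes>\<^sub>M (L \<Otimes>\<^sub>M L)"

sublocale LL: prob_space "L \<Otimes>\<^sub>M L"
  by (rule prob_space_pair) (rule L.prob_space_axioms)+

sublocale V: prob_space V
  by (rule prob_space_pair) (rule \<nu>.prob_space_axioms, rule LL.prob_space_axioms)

lemma space_V: "space V = (space M \<times> space M) \<times> (carrier G \<times> carrier G)"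
  by (simp add: space_pair_measure space_L)

lemma V_coordinates[measurable]:
  "(\<lambda>x. fst (fst x)) \<in> measurable V M" "(\<lambda>x. snd (fst x)) \<in> measurable V M"
  "(\<lambda>x. fst (snd x)) \<in> measurable V L" "(\<lambda>x. snd (snd x)) \<in> measurable V L"
  by measurable

text \<open>The coordinates are grouped as a pair of base points and a pair of group elements, so
  that \<open>\<nu>\<close> becomes the base of a skew product; \<open>shuffle\<close> translates to
  the order in which the relative product is defined.\<close>

definition skew :: "('y \<Rightarrow> 'g) \<Rightarrow> ('y \<times> 'y) \<times> ('g \<times> 'g) \<Rightarrow> ('y \<times> 'y) \<times> ('g \<times> 'g)" where
  "skew \<phi> = (\<lambda>(w, x). (map_prod T T w, (\<phi> (fst w) \<otimes>\<^bsub>G\<^esub> fst x, \<phi> (snd w) \<otimes>\<^bsub>G\<^esub> snd x)))"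

text \<open>\<open>R\<close> is left open for two uses: \<open>map_prod T T\<close> gives
  \<open>skew \<phi>\<close>, and the identity gives the change of fibre coordinates in
  \<open>defect_coboundary_tendsto\<close>.\<close>

lemma fibre_translation_mp:
  assumes R: "measure_preserving \<nu> R" and g[measurable]: "g \<in> measurable M L"
  shows "measure_preserving V (\<lambda>(w, x). (R w, (g (fst w) \<otimes>\<^bsub>G\<^esub> fst x, g (snd w) \<otimes>\<^bsub>G\<^esub> snd x)))"
proof (rule measure_preserving_skew[OF \<nu>.prob_space_axioms LL.prob_space_axioms R])
  show "(\<lambda>(w, x). (g (fst w) \<otimes>\<^bsub>G\<^esub> fst x, g (snd w) \<otimes>\<^bsub>G\<^esub> snd x)) \<in> measurable V (L \<Otimes>\<^sub>M L)"
    unfolding case_prod_beta' by measurable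
  show "distr (L \<Otimes>\<^sub>M L) (L \<Otimes>\<^sub>M L) (\<lambda>x. (g (fst w) \<otimes>\<^bsub>G\<^esub> fst x, g (snd w) \<otimes>\<^bsub>G\<^esub> snd x)) = L \<Otimes>\<^sub>M L"
    if "w \<in> space \<nu>" for w
    using that measurable_L_closed[OF g] by (intro haar_pair_left) auto
qed

lemma skew_mp: "\<phi> \<in> measurable M L \<Longrightarrow> measure_preserving V (skew \<phi>)"
  unfolding skew_def by (rule fibre_translation_mp[OF \<nu>_mp])

primrec iterated_cocycle :: "('y \<Rightarrow> 'g) \<Rightarrow> nat \<Rightarrow> 'y \<Rightarrow> 'g" where
  "iterated_cocycle \<phi> 0 = (\<lambda>y. \<one>\<^bsub>G\<^esub>)"
| "iterated_cocycle \<phi> (Suc k) = (\<lambda>y. \<phi> ((T ^^ k) y) \<otimes>\<^bsub>G\<^esub> iterated_cocycle \<phi> k y)"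

lemma Tn_space: "y \<in> space M \<Longrightarrow> (T ^^ k) y \<in> space M"
  using measurable_space[OF Tn_measurable] .

lemma iterated_cocycle_closed:
  assumes "\<phi> \<in> measurable M L" "y \<in> space M"
  shows "iterated_cocycle \<phi> k y \<in> carrier G"
  by (induction k) (use measurable_L_closed[OF assms(1)] Tn_space[OF assms(2)] in auto)

lemma skew_funpow:
  assumes \<phi>: "\<phi> \<in> measurable M L" and x: "x \<in> space V"
  shows "(skew \<phi> ^^ k) x = (((T ^^ k) (fst (fst x)), (T ^^ k) (snd (fst x))),
     (iterated_cocycle \<phi> k (fst (fst x)) \<otimes>\<^bsub>G\<^esub> fst (snd x), iterated_cocycle \<phi> k (snd (fst x)) \<otimes>\<^bsub>G\<^esub> snd (snd x)))"
proof (induction k)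
  case 0
  then show ?case using x by (auto simp: space_V)
next
  case (Suc k)
  have "fst (fst x) \<in> space M" "snd (fst x) \<in> space M" "fst (snd x) \<in> carrier G" "snd (snd x) \<in> carrier G"
    using x by (auto simp: space_V)
  then show ?case
    using Suc iterated_cocycle_closed[OF \<phi>] measurable_L_closed[OF \<phi>] Tn_space
    by (simp add: skew_def m_assoc)
qed

definition test :: "'y set \<Rightarrow> 'y set \<Rightarrow> ('g \<Rightarrow> real) \<Rightarrow> ('g \<Rightarrow> real) \<Rightarrow> ('y \<times> 'y) \<times> ('g \<times> 'g) \<Rightarrow> real" where
  "test A B u v = (\<lambda>x. indicator A (fst (fst x)) * indicator B (snd (fst x)) *
     (u (fst (snd x)) * v (snd (snd x))))"

definition defect :: "'y set \<Rightarrow> 'y set \<Rightarrow> ('g \<Rightarrow> real) \<Rightarrow> ('g \<Rightarrow> real) \<Rightarrow> ('y \<Rightarrow> 'g) \<Rightarrow> nat \<Rightarrow> real" where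
  "defect A B u v \<phi> n =
     (\<integral>x. \<bar>birkhoff_average (skew \<phi>) (test A B u v) n x - (\<integral>x. test A B u v x \<partial>V)\<bar> \<partial>V)"

lemma test_measurable[measurable]:
  assumes [measurable]: "A \<in> sets M" "B \<in> sets M" "u \<in> borel_measurable L" "v \<in> borel_measurable L"
  shows "test A B u v \<in> borel_measurable V"
  unfolding test_def by measurable

lemma test_bounds:
  assumes "unit_lipschitz C u" "unit_lipschitz C v" "x \<in> space V"
  shows "0 \<le> test A B u v x" "test A B u v x \<le> 1"
proof -
  have "0 \<le> u (fst (snd x))" "u (fst (snd x)) \<le> 1" "0 \<le> v (snd (snd x))" "v (snd (snd x)) \<le> 1"
    using assms by (auto simp: unit_lipschitz_def space_V)
  then show "0 \<le> test A B u v x" "test A B u v x \<le> 1"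
    by (auto simp: test_def indicator_def intro: mult_le_one)
qed

text \<open>Right invariance of \<open>d\<close> cancels \<open>k\<close> and \<open>l\<close>, so
  the bound is uniform over the fibre. In the product of \<open>u\<close> and \<open>v\<close> one
  factor is changed at a time, the other being at most 1.\<close>

lemma test_difference:
  assumes u: "unit_lipschitz C u" "unit_lipschitz C v"
    and "g \<in> carrier G" "g' \<in> carrier G" "h \<in> carrier G" "h' \<in> carrier G"
    and "k \<in> carrier G" "l \<in> carrier G"
  shows "\<bar>test A B u v (w, (g \<otimes>\<^bsub>G\<^esub> k, h \<otimes>\<^bsub>G\<^esub> l)) - test A B u v (w, (g' \<otimes>\<^bsub>G\<^esub> k, h' \<otimes>\<^bsub>G\<^esub> l))\<bar>
     \<le> C * (d g g' + d h h')"
proof -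
  define a a' b b' where "a = u (g \<otimes>\<^bsub>G\<^esub> k)" and "a' = u (g' \<otimes>\<^bsub>G\<^esub> k)"
    and "b = v (h \<otimes>\<^bsub>G\<^esub> l)" and "b' = v (h' \<otimes>\<^bsub>G\<^esub> l)"
  have r: "0 \<le> a" "a \<le> 1" "0 \<le> b'" "b' \<le> 1"
    using assms by (auto simp: unit_lipschitz_def a_def b'_def)
  have a: "\<bar>a - a'\<bar> \<le> C * d g g'"
    using assms d_mult_right[of g g' k] unfolding unit_lipschitz_def a_def a'_def by (metis m_closed)
  have b: "\<bar>b - b'\<bar> \<le> C * d h h'"
    using assms d_mult_right[of h h' l] unfolding unit_lipschitz_def b_def b'_def by (metis m_closed)
  have "a * b - a' * b' = a * (b - b') + (a - a') * b'" by (simp add: algebra_simps)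
  also have "\<bar>\<dots>\<bar> \<le> \<bar>a\<bar> * \<bar>b - b'\<bar> + \<bar>a - a'\<bar> * \<bar>b'\<bar>"
    using abs_triangle_ineq[of "a * (b - b')" "(a - a') * b'"] by (simp add: abs_mult)
  also have "\<dots> \<le> \<bar>b - b'\<bar> + \<bar>a - a'\<bar>"
    using r by (intro add_mono) (auto intro: mult_left_le_one_le mult_right_le_one_le)
  finally have ab: "\<bar>a * b - a' * b'\<bar> \<le> C * (d g g' + d h h')" using a b by (simp add: algebra_simps)
  have "C * (d g g' + d h h') \<ge> 0" using u by (auto simp: unit_lipschitz_def)
  then show ?thesis using ab by (auto simp: test_def a_def a'_def b_def b'_def indicator_def)
qed

text \<open>One factor is exchanged at a time: left invariance strips the common newest factor,
  right invariance the common past. Both halves of bi-invariance enter.\<close>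

lemma iterated_cocycle_dist:
  assumes \<phi>: "\<phi> \<in> measurable M L" and \<psi>: "\<psi> \<in> measurable M L" and y: "y \<in> space M"
  shows "d (iterated_cocycle \<phi> k y) (iterated_cocycle \<psi> k y) \<le> (\<Sum>i<k. d (\<phi> ((T ^^ i) y)) (\<psi> ((T ^^ i) y)))"
proof (induction k)
  case (Suc k)
  note c = iterated_cocycle_closed[OF \<phi> y, of k] iterated_cocycle_closed[OF \<psi> y, of k]
    measurable_L_closed[OF \<phi> Tn_space[OF y], of k] measurable_L_closed[OF \<psi> Tn_space[OF y], of k]
  have "d (iterated_cocycle \<phi> (Suc k) y) (iterated_cocycle \<psi> (Suc k) y) \<le>
      d (\<phi> ((T ^^ k) y) \<otimes>\<^bsub>G\<^esub> iterated_cocycle \<phi> k y) (\<phi> ((T ^^ k) y) \<otimes>\<^bsub>G\<^esub> iterated_cocycle \<psi> k y) +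
      d (\<phi> ((T ^^ k) y) \<otimes>\<^bsub>G\<^esub> iterated_cocycle \<psi> k y) (\<psi> ((T ^^ k) y) \<otimes>\<^bsub>G\<^esub> iterated_cocycle \<psi> k y)"
    using c by (simp, intro MG.triangle) auto
  also have "\<dots> = d (iterated_cocycle \<phi> k y) (iterated_cocycle \<psi> k y) + d (\<phi> ((T ^^ k) y)) (\<psi> ((T ^^ k) y))"
    using c d_mult_left d_mult_right by simp
  finally show ?case using Suc by simp
qed simp

lemma integral_V_fst: "f \<in> borel_measurable M \<Longrightarrow> (\<integral>x. f (fst (fst x)) \<partial>V) = (\<integral>y. f y \<partial>M)" for f :: "'y \<Rightarrow> real"
proof -
  assume f[measurable]: "f \<in> borel_measurable M"
  have "(\<integral>x. f (fst (fst x)) \<partial>V) = (\<integral>w. f (fst w) \<partial>distr V \<nu> fst)"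
    by (subst integral_distr) auto
  also have "\<dots> = (\<integral>y. f y \<partial>distr \<nu> M fst)"
    unfolding LL.distr_pair_fst by (subst integral_distr) auto
  finally show ?thesis unfolding distr_\<nu>_fst .
qed

lemma integral_V_snd: "f \<in> borel_measurable M \<Longrightarrow> (\<integral>x. f (snd (fst x)) \<partial>V) = (\<integral>y. f y \<partial>M)" for f :: "'y \<Rightarrow> real"
proof -
  assume f[measurable]: "f \<in> borel_measurable M"
  have "(\<integral>x. f (snd (fst x)) \<partial>V) = (\<integral>w. f (snd w) \<partial>distr V \<nu> fst)"
    by (subst integral_distr) auto
  also have "\<dots> = (\<integral>y. f y \<partial>distr \<nu> M snd)"
    unfolding LL.distr_pair_fst by (subst integral_distr) auto
  finally show ?thesis unfolding distr_\<nu>_snd .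
qed

text \<open>Each of the \<open>n\<close> terms moves by at most \<open>C\<close> times the sum
  \<open>D\<close> of cocycle distances along both orbits up to time \<open>n\<close>.
  \<open>D\<close> has integral \<open>real n * rho \<phi> \<psi>\<close>, and the two base
  coordinates account for the factor 2. The growth with \<open>n\<close> is harmless, since openness
  is shown for a fixed \<open>n\<close>.\<close>

lemma defect_lipschitz:
  assumes A[measurable]: "A \<in> sets M" and B[measurable]: "B \<in> sets M"
    and u: "unit_lipschitz C u" "unit_lipschitz C v"
    and \<phi>[measurable]: "\<phi> \<in> measurable M L" and \<psi>[measurable]: "\<psi> \<in> measurable M L" and n: "n \<ge> 1"
  shows "defect A B u v \<psi> n \<le> defect A B u v \<phi> n + 2 * C * real n * rho \<phi> \<psi>"
proof -
  note uv[measurable] = unit_lipschitz_measurable[OF u(1)] unit_lipschitz_measurable[OF u(2)]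
  have C: "C \<ge> 0" using u by (simp add: unit_lipschitz_def)
  define F where "F = test A B u v"
  have F[measurable]: "F \<in> borel_measurable V" unfolding F_def by measurable
  define I where "I = (\<integral>x. F x \<partial>V)"
  define D where "D y = (\<Sum>i<n. d (\<phi> ((T ^^ i) y)) (\<psi> ((T ^^ i) y)))" for y
  have D[measurable]: "D \<in> borel_measurable M" unfolding D_def by measurable
  have Di: "(\<integral>y. D y \<partial>M) = real n * rho \<phi> \<psi>"
  proof -
    have "(\<integral>y. D y \<partial>M) = (\<Sum>i<n. \<integral>y. d (\<phi> ((T ^^ i) y)) (\<psi> ((T ^^ i) y)) \<partial>M)"
      unfolding D_def
      by (rule Bochner_Integration.integral_sum)
         (rule dist_integrable; measurable)
    also have "\<dots> = (\<Sum>i<n. rho \<phi> \<psi>)"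
      unfolding rho_def
      by (intro sum.cong refl measure_preserving_integral[OF measure_preserving_funpow[OF T_mp]]) measurable
    finally show ?thesis by simp
  qed
  obtain d0 where d0: "\<And>g h. g \<in> carrier G \<Longrightarrow> h \<in> carrier G \<Longrightarrow> d g h \<le> d0" using dist_bounded by blast
  have Db: "\<bar>D y\<bar> \<le> real n * d0" if y: "y \<in> space M" for y
  proof -
    have "D y \<le> (\<Sum>i<n. d0)"
      unfolding D_def using d0 measurable_L_closed[OF \<phi>] measurable_L_closed[OF \<psi>] Tn_space[OF y]
      by (intro sum_mono) auto
    moreover have "D y \<ge> 0" unfolding D_def by (intro sum_nonneg) simp
    ultimately show ?thesis by simp
  qed
  have Rsp: "(skew \<xi> ^^ k) x \<in> space V" if "\<xi> \<in> measurable M L" "x \<in> space V" for \<xi> k x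
    using measure_preserving_space[OF measure_preserving_funpow[OF skew_mp]] that by blast
  have avb: "\<bar>birkhoff_average (skew \<xi>) F n x\<bar> \<le> 1" if "\<xi> \<in> measurable M L" "x \<in> space V" for \<xi> x
    using Rsp[OF that] test_bounds[OF u] by (intro birkhoff_average_bound) (auto simp: F_def)
  have avm: "birkhoff_average (skew \<xi>) F n \<in> borel_measurable V" if "\<xi> \<in> measurable M L" for \<xi>
    using measure_preserving_measurable[OF skew_mp[OF that]] F by (rule birkhoff_average_measurable)
  have avi: "integrable V (\<lambda>x. \<bar>birkhoff_average (skew \<xi>) F n x - I\<bar>)" if "\<xi> \<in> measurable M L" for \<xi>
  proof -
    have "integrable V (birkhoff_average (skew \<xi>) F n)"
      by (rule V.integrable_const_bound[of _ 1]) (use avb[OF that] avm[OF that] in auto)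
    then show ?thesis by simp
  qed
  have Dint1: "integrable V (\<lambda>x. D (fst (fst x)))" and Dint2: "integrable V (\<lambda>x. D (snd (fst x)))"
    by (rule V.integrable_const_bound[of _ "real n * d0"]; use Db in \<open>auto simp: space_V\<close>)+
  have pt: "\<bar>birkhoff_average (skew \<psi>) F n x - birkhoff_average (skew \<phi>) F n x\<bar>
      \<le> C * (D (fst (fst x)) + D (snd (fst x)))" if x: "x \<in> space V" for x
  proof -
    have y: "fst (fst x) \<in> space M" "snd (fst x) \<in> space M" "fst (snd x) \<in> carrier G" "snd (snd x) \<in> carrier G"
      using x by (auto simp: space_V)
    have k: "\<bar>F ((skew \<psi> ^^ k) x) - F ((skew \<phi> ^^ k) x)\<bar> \<le> C * (D (fst (fst x)) + D (snd (fst x)))"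
      if k: "k < n" for k
    proof -
      have DD: "d (iterated_cocycle \<psi> k z) (iterated_cocycle \<phi> k z) \<le> D z" if z: "z \<in> space M" for z
      proof -
        have "d (iterated_cocycle \<psi> k z) (iterated_cocycle \<phi> k z) = d (iterated_cocycle \<phi> k z) (iterated_cocycle \<psi> k z)"
          by (rule MG.commute)
        also have "\<dots> \<le> (\<Sum>i<k. d (\<phi> ((T ^^ i) z)) (\<psi> ((T ^^ i) z)))"
          by (rule iterated_cocycle_dist[OF \<phi> \<psi> z])
        also have "\<dots> \<le> D z" unfolding D_def using k by (intro sum_mono2) auto
        finally show ?thesis .
      qed
      have "\<bar>F ((skew \<psi> ^^ k) x) - F ((skew \<phi> ^^ k) x)\<bar> \<le>
          C * (d (iterated_cocycle \<psi> k (fst (fst x))) (iterated_cocycle \<phi> k (fst (fst x))) +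
               d (iterated_cocycle \<psi> k (snd (fst x))) (iterated_cocycle \<phi> k (snd (fst x))))"
        unfolding F_def skew_funpow[OF \<phi> x] skew_funpow[OF \<psi> x]
        using y by (intro test_difference[OF u] iterated_cocycle_closed) auto
      also have "\<dots> \<le> C * (D (fst (fst x)) + D (snd (fst x)))"
        using C DD[OF y(1)] DD[OF y(2)] by (intro mult_left_mono add_mono) auto
      finally show ?thesis .
    qed
    have "birkhoff_average (skew \<psi>) F n x - birkhoff_average (skew \<phi>) F n x =
        (\<Sum>k<n. F ((skew \<psi> ^^ k) x) - F ((skew \<phi> ^^ k) x)) / real n"
      by (simp add: birkhoff_average_def sum_subtractf diff_divide_distrib)
    also have "\<bar>\<dots>\<bar> \<le> (\<Sum>k<n. C * (D (fst (fst x)) + D (snd (fst x)))) / real n"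
      using k by (simp only: abs_divide abs_of_nat)
        (intro divide_right_mono order_trans[OF sum_abs sum_mono]; simp)
    also have "\<dots> = C * (D (fst (fst x)) + D (snd (fst x)))" using n by simp
    finally show ?thesis .
  qed
  have "defect A B u v \<psi> n \<le>
      (\<integral>x. \<bar>birkhoff_average (skew \<phi>) F n x - I\<bar> + C * (D (fst (fst x)) + D (snd (fst x))) \<partial>V)"
    unfolding defect_def F_def[symmetric] I_def[symmetric]
  proof (rule integral_mono[OF avi[OF \<psi>]])
    fix x assume "x \<in> space V"
    from pt[OF this] show "\<bar>birkhoff_average (skew \<psi>) F n x - I\<bar> \<le>
      \<bar>birkhoff_average (skew \<phi>) F n x - I\<bar> + C * (D (fst (fst x)) + D (snd (fst x)))" by linarith
  qed (use avi[OF \<phi>] Dint1 Dint2 in auto)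
  also have "\<dots> = defect A B u v \<phi> n + C * ((\<integral>x. D (fst (fst x)) \<partial>V) + (\<integral>x. D (snd (fst x)) \<partial>V))"
    unfolding defect_def F_def[symmetric] I_def[symmetric]
    using avi[OF \<phi>] Dint1 Dint2 by simp
  also have "\<dots> = defect A B u v \<phi> n + 2 * C * real n * rho \<phi> \<psi>"
    unfolding integral_V_fst[OF D] integral_V_snd[OF D] Di by (simp add: algebra_simps)
  finally show ?thesis .
qed

definition good_classes :: "'y set \<Rightarrow> 'y set \<Rightarrow> ('g \<Rightarrow> real) \<Rightarrow> ('g \<Rightarrow> real) \<Rightarrow> real \<Rightarrow> ('y \<Rightarrow> 'g) set set" where
  "good_classes A B u v e = {c \<in> cocycles M X. \<exists>\<phi>\<in>c. \<exists>n\<ge>1. defect A B u v \<phi> n < e}"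

text \<open>By \<open>defect_lipschitz\<close> with \<open>rho\<close> equal to 0 the defect depends
  only on the class, so any member can stand for the one chosen in
  \<open>good_classes\<close>.\<close>

lemma good_classes_iff:
  assumes "A \<in> sets M" "B \<in> sets M" "unit_lipschitz C u" "unit_lipschitz C v" and \<phi>: "\<phi> \<in> measurable M L"
  shows "cocycle_class M X \<phi> \<in> good_classes A B u v e \<longleftrightarrow> (\<exists>n\<ge>1. defect A B u v \<phi> n < e)"
proof
  assume "cocycle_class M X \<phi> \<in> good_classes A B u v e"
  then obtain \<psi> n where \<psi>: "\<psi> \<in> cocycle_class M X \<phi>" "n \<ge> 1" "defect A B u v \<psi> n < e"
    by (auto simp: good_classes_def)
  have m: "\<psi> \<in> measurable M L" using cocycle_member[OF class_in_cocycles[OF \<phi>] \<psi>(1)] by simp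
  have "rho \<psi> \<phi> = 0" using \<psi>(1) rho_eq_0_iff[OF m \<phi>] by (simp add: cocycle_class_def)
  then have "defect A B u v \<phi> n < e"
    using defect_lipschitz[OF assms(1-4) m \<phi> \<psi>(2)] \<psi>(3) by simp
  then show "\<exists>n\<ge>1. defect A B u v \<phi> n < e" using \<psi>(2) by blast
next
  assume "\<exists>n\<ge>1. defect A B u v \<phi> n < e"
  then show "cocycle_class M X \<phi> \<in> good_classes A B u v e"
    using in_cocycle_class[OF \<phi>] class_in_cocycles[OF \<phi>] unfolding good_classes_def by blast
qed

lemma good_classes_open:
  assumes "A \<in> sets M" "B \<in> sets M" and u: "unit_lipschitz C u" "unit_lipschitz C v"
  shows "openin C.mtopology (good_classes A B u v e)"
  unfolding C.openin_mtopology
proof (intro conjI allI impI)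
  show "good_classes A B u v e \<subseteq> cocycles M X" by (auto simp: good_classes_def)
  have C: "C \<ge> 0" using u by (simp add: unit_lipschitz_def)
  fix c assume c: "c \<in> good_classes A B u v e"
  then have cc: "c \<in> cocycles M X" by (simp add: good_classes_def)
  define \<phi> where "\<phi> = representative c"
  have \<phi>: "\<phi> \<in> measurable M L" "cocycle_class M X \<phi> = c" using representative[OF cc] by (auto simp: \<phi>_def)
  obtain n where n: "n \<ge> 1" "defect A B u v \<phi> n < e"
    using c good_classes_iff[OF assms \<phi>(1)] \<phi>(2) by metis
  \<comment> \<open>The summand 1 keeps the denominator positive when \<open>C\<close> is 0.\<close>
  define r where "r = (e - defect A B u v \<phi> n) / (2 * C * real n + 1)"
  have pos: "2 * C * real n + 1 > 0" using C by (simp add: add_nonneg_pos)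
  have r: "r > 0" "(2 * C * real n + 1) * r = e - defect A B u v \<phi> n"
    using n(2) pos by (auto simp: r_def)
  have "C.mball c r \<subseteq> good_classes A B u v e"
  proof
    fix c' assume c': "c' \<in> C.mball c r"
    define \<psi> where "\<psi> = representative c'"
    have \<psi>: "\<psi> \<in> measurable M L" "cocycle_class M X \<psi> = c'"
      using representative c' by (auto simp: \<psi>_def)
    have rho: "rho \<phi> \<psi> < r" using c' by (simp add: class_dist_def \<phi>_def \<psi>_def)
    have "2 * C * real n * rho \<phi> \<psi> \<le> 2 * C * real n * r"
      using rho C by (intro mult_left_mono) auto
    also have "\<dots> < e - defect A B u v \<phi> n" using r by (simp add: algebra_simps)
    finally have "defect A B u v \<psi> n < e" using defect_lipschitz[OF assms \<phi>(1) \<psi>(1) n(1)] by simp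
    then show "c' \<in> good_classes A B u v e" using good_classes_iff[OF assms \<psi>(1)] \<psi>(2) n(1) by blast
  qed
  then show "\<exists>r>0. C.mball c r \<subseteq> good_classes A B u v e" using r(1) by blast
qed

text \<open>The rectangles built from \<open>BM\<close> and \<open>BX\<close> form a generating
  pi-system. An invariant set is uncorrelated with the Lipschitz tests by
  \<open>invariant_set_correlation\<close>, hence independent of the rectangles, because the bumps
  converge to the indicators of the open sets in \<open>BX\<close>.\<close>

lemma skew_ergodicI:
  assumes BM: "Int_stable BM" "space M \<in> BM" "BM \<subseteq> sets M" "sets M = sigma_sets (space M) BM"
    and BX: "Int_stable BX" "carrier G \<in> BX" "\<And>W. W \<in> BX \<Longrightarrow> openin X W" "sets L = sigma_sets (carrier G) BX"
    and \<phi>: "\<phi> \<in> measurable M L"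
    and good: "\<And>A B W W' j e. A \<in> BM \<Longrightarrow> B \<in> BM \<Longrightarrow> W \<in> BX \<Longrightarrow> W' \<in> BX \<Longrightarrow> e > 0 \<Longrightarrow>
      \<exists>n\<ge>1. defect A B (bump W j) (bump W' j) \<phi> n < e"
  shows "is_ergodic V (skew \<phi>)"
proof -
  define E1 where "E1 = {A \<times> B |A B. A \<in> BM \<and> B \<in> BM}"
  define E2 where "E2 = {A \<times> B |A B. A \<in> BX \<and> B \<in> BX}"
  define E3 where "E3 = {A \<times> B |A B. A \<in> E1 \<and> B \<in> E2}"
  have BXs: "BX \<subseteq> Pow (carrier G)" using BX(3) openin_subset topspace_X by blast
  have BMs: "BM \<subseteq> Pow (space M)" using BM(3) sets.sets_into_space by blast
  have E1s: "E1 \<subseteq> Pow (space M \<times> space M)" using BMs by (auto simp: E1_def)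
  have E2s: "E2 \<subseteq> Pow (carrier G \<times> carrier G)" using BXs by (auto simp: E2_def)
  have s1: "sets \<nu> = sigma_sets (space \<nu>) E1"
  proof -
    have "sets (M \<Otimes>\<^sub>M M) = sets (sigma (space M \<times> space M) E1)"
      unfolding E1_def
      by (rule sets_pair_eq[where Ca="{space M}" and Cb="{space M}"]) (use BM BMs in auto)
    then show ?thesis using E1s by simp
  qed
  have s2: "sets (L \<Otimes>\<^sub>M L) = sigma_sets (space (L \<Otimes>\<^sub>M L)) E2"
  proof -
    have "sets (L \<Otimes>\<^sub>M L) = sets (sigma (space L \<times> space L) E2)"
      unfolding E2_def
      by (rule sets_pair_eq[where Ca="{carrier G}" and Cb="{carrier G}"])
         (use BX(2,4) BXs in \<open>auto simp: space_L\<close>)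
    then show ?thesis using E2s by (simp add: space_L space_pair_measure)
  qed
  have s3: "sets V = sigma_sets (space V) E3"
  proof -
    have "sets V = sets (sigma (space \<nu> \<times> space (L \<Otimes>\<^sub>M L)) E3)"
      unfolding E3_def
    proof (rule sets_pair_eq[where Ca="{space M \<times> space M}" and Cb="{carrier G \<times> carrier G}"])
      show "{space M \<times> space M} \<subseteq> E1" using BM(2) by (auto simp: E1_def)
      show "{carrier G \<times> carrier G} \<subseteq> E2" using BX(2) by (auto simp: E2_def)
    qed (use s1 s2 E1s E2s in \<open>auto simp: space_pair_measure space_L\<close>)
    moreover have "E3 \<subseteq> Pow (space \<nu> \<times> space (L \<Otimes>\<^sub>M L))"
      using E1s E2s by (auto simp: E3_def space_pair_measure space_L)
    ultimately show ?thesis by (simp add: space_pair_measure[of \<nu>])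
  qed
  have stab: "Int_stable {A \<times> B |A B. A \<in> F \<and> B \<in> H}" if "Int_stable F" "Int_stable H"
    for F :: "'p set set" and H :: "'q set set"
  proof (rule Int_stableI, clarify)
    fix A B A' B' assume "A \<in> F" "B \<in> H" "A' \<in> F" "B' \<in> H"
    then have "A \<inter> A' \<in> F" "B \<inter> B' \<in> H" using that by (auto simp: Int_stable_def)
    then show "\<exists>A'' B''. A \<times> B \<inter> A' \<times> B' = A'' \<times> B'' \<and> A'' \<in> F \<and> B'' \<in> H"
      by (intro exI[of _ "A \<inter> A'"] exI[of _ "B \<inter> B'"]) auto
  qed
  have st3: "Int_stable E3"
    unfolding E3_def E1_def E2_def by (intro stab BM BX)
  show ?thesis
  proof (rule is_ergodic_generatorI[OF V.prob_space_axioms st3 _ s3])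
    show "E3 \<subseteq> Pow (space V)" using E1s E2s by (auto simp: E3_def space_V)
    fix E Q assume E[measurable]: "E \<in> sets V" and inv: "AE x in V. skew \<phi> x \<in> E \<longleftrightarrow> x \<in> E" and Q: "Q \<in> E3"
    obtain A B W W' where AB: "A \<in> BM" "B \<in> BM" and WW: "W \<in> BX" "W' \<in> BX"
      and Qe: "Q = (A \<times> B) \<times> (W \<times> W')"
      using Q by (auto simp: E3_def E1_def E2_def)
    have ABs[measurable]: "A \<in> sets M" "B \<in> sets M" using AB BM(3) by auto
    have WWs[measurable]: "W \<in> sets L" "W' \<in> sets L" using WW BX(3) openin_imp_sets_borel_of sets_L by auto
    have WWc: "W \<subseteq> carrier G" "W' \<subseteq> carrier G" using WW BXs by auto
    have Qm[measurable]: "Q \<in> sets V" using s3 Q by (simp add: sigma_sets.Basic)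
    define f where "f j = test A B (bump W j) (bump W' j)" for j
    have lip: "unit_lipschitz (real j) (bump W j)" "unit_lipschitz (real j) (bump W' j)" for j
      using bump_unit_lipschitz WWc by auto
    have fm[measurable]: "f j \<in> borel_measurable V" for j
      unfolding f_def using unit_lipschitz_measurable[OF lip(1)] unit_lipschitz_measurable[OF lip(2)]
      by measurable
    have fb: "\<bar>f j x\<bar> \<le> 1" if "x \<in> space V" for j x
      using test_bounds[OF lip that] by (simp add: f_def)
    have eq: "(\<integral>x. indicator E x * f j x \<partial>V) = measure V E * (\<integral>x. f j x \<partial>V)" for j
      by (rule invariant_set_correlation[OF V.prob_space_axioms skew_mp[OF \<phi>] E inv fm fb])
         (use good[OF AB WW, of _ j] in \<open>auto simp: f_def defect_def\<close>)
    have fl: "(\<lambda>j. f j x) \<longlonglongrightarrow> indicator Q x" if x: "x \<in> space V" for x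
    proof -
      have "(\<lambda>j. f j x) \<longlonglongrightarrow> indicator A (fst (fst x)) * indicator B (snd (fst x)) *
          (indicator W (fst (snd x)) * indicator W' (snd (snd x)))"
        unfolding f_def test_def
        by (intro tendsto_mult tendsto_const bump_tendsto_indicator) (use x WW BX(3) in \<open>auto simp: space_V\<close>)
      moreover have "indicator A (fst (fst x)) * indicator B (snd (fst x)) *
          (indicator W (fst (snd x)) * indicator W' (snd (snd x))) = (indicator Q x :: real)"
        by (cases x) (auto simp: Qe indicator_def)
      ultimately show ?thesis by simp
    qed
    have l1: "(\<lambda>j. \<integral>x. indicator E x * f j x \<partial>V) \<longlonglongrightarrow> (\<integral>x. indicator E x * indicator Q x \<partial>V)"
    proof (rule integral_dominated_convergence[where w="\<lambda>_. 1"])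
      show "AE x in V. (\<lambda>j. indicator E x * f j x) \<longlonglongrightarrow> indicator E x * indicator Q x"
        by (intro AE_I2 tendsto_mult tendsto_const fl)
      show "AE x in V. norm (indicator E x * f j x) \<le> 1" for j
        by (rule AE_I2) (use fb[of _ j] in \<open>auto simp: indicator_def\<close>)
    qed auto
    have l2: "(\<lambda>j. \<integral>x. f j x \<partial>V) \<longlonglongrightarrow> (\<integral>x. indicator Q x \<partial>V)"
      by (rule integral_dominated_convergence[where w="\<lambda>_. 1"]) (use fb fl in \<open>auto intro!: AE_I2\<close>)
    have "(\<lambda>j. \<integral>x. indicator E x * f j x \<partial>V) \<longlonglongrightarrow> measure V E * (\<integral>x. indicator Q x \<partial>V)"
      unfolding eq by (intro tendsto_mult tendsto_const l2)
    then have "(\<integral>x. indicator E x * indicator Q x \<partial>V) = measure V E * (\<integral>x. indicator Q x \<partial>V)"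
      using l1 LIMSEQ_unique by blast
    then show "measure V (E \<inter> Q) = measure V E * measure V Q"
      using sets.Int_space_eq2[OF Qm] sets.Int_space_eq2[OF sets.Int[OF E Qm]]
      by (simp add: indicator_inter_arith[symmetric])
  qed
qed

end

section \<open>Coboundaries\<close>

lemma integral_pair_mult:
  fixes f :: "'a \<Rightarrow> real" and g :: "'b \<Rightarrow> real"
  assumes "prob_space P" "prob_space Q"
    and f[measurable]: "f \<in> borel_measurable P" and g[measurable]: "g \<in> borel_measurable Q"
    and bf: "\<And>x. x \<in> space P \<Longrightarrow> \<bar>f x\<bar> \<le> 1" and bg: "\<And>y. y \<in> space Q \<Longrightarrow> \<bar>g y\<bar> \<le> 1"
  shows "(\<integral>z. f (fst z) * g (snd z) \<partial>(P \<Otimes>\<^sub>M Q)) = (\<integral>x. f x \<partial>P) * (\<integral>y. g y \<partial>Q)"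
proof -
  interpret P: prob_space P by fact
  interpret Q: prob_space Q by fact
  interpret pq: pair_sigma_finite P Q ..
  interpret PQ: prob_space "P \<Otimes>\<^sub>M Q" by (rule prob_space_pair) fact+
  have i: "integrable (P \<Otimes>\<^sub>M Q) (\<lambda>z. f (fst z) * g (snd z))"
  proof (rule PQ.integrable_const_bound[of _ 1])
    show "AE z in P \<Otimes>\<^sub>M Q. norm (f (fst z) * g (snd z)) \<le> 1"
      by (rule AE_I2) (use bf bg in \<open>auto simp: space_pair_measure abs_mult intro!: mult_le_one\<close>)
  qed measurable
  have "(\<integral>z. f (fst z) * g (snd z) \<partial>(P \<Otimes>\<^sub>M Q)) = (\<integral>x. \<integral>y. f x * g y \<partial>Q \<partial>P)"
    using pq.integral_fst'[OF i] by simp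
  also have "\<dots> = (\<integral>x. f x \<partial>P) * (\<integral>y. g y \<partial>Q)" by simp
  finally show ?thesis .
qed

text \<open>The square of an integral is an integral over independent pairs \<open>(b, c)\<close>.
  After Fubini the inner integral over \<open>P\<close> vanishes off \<open>D\<close> and is at most
  1 on \<open>D\<close>.\<close>

lemma second_moment_bound:
  fixes \<Phi> :: "'a \<times> 'b \<Rightarrow> real"
  assumes "prob_space P" "prob_space Q"
    and \<Phi>[measurable]: "\<Phi> \<in> borel_measurable (P \<Otimes>\<^sub>M Q)"
    and bd: "\<And>a b. a \<in> space P \<Longrightarrow> b \<in> space Q \<Longrightarrow> \<bar>\<Phi> (a, b)\<bar> \<le> 1"
    and D[measurable]: "D \<in> sets (Q \<Otimes>\<^sub>M Q)"
    and orth: "\<And>b c. b \<in> space Q \<Longrightarrow> c \<in> space Q \<Longrightarrow> (b, c) \<notin> D \<Longrightarrow> (\<integral>a. \<Phi> (a, b) * \<Phi> (a, c) \<partial>P) = 0"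
  shows "(\<integral>a. (\<integral>b. \<Phi> (a, b) \<partial>Q)\<^sup>2 \<partial>P) \<le> measure (Q \<Otimes>\<^sub>M Q) D"
proof -
  interpret P: prob_space P by fact
  interpret Q: prob_space Q by fact
  interpret QQ: prob_space "Q \<Otimes>\<^sub>M Q" by (rule prob_space_pair) fact+
  interpret PQ: pair_sigma_finite P "Q \<Otimes>\<^sub>M Q" ..
  interpret PQp: prob_space "P \<Otimes>\<^sub>M (Q \<Otimes>\<^sub>M Q)" by (rule prob_space_pair) (unfold_locales)
  define F where "F a z = \<Phi> (a, fst z) * \<Phi> (a, snd z)" for a z
  have F[measurable]: "case_prod F \<in> borel_measurable (P \<Otimes>\<^sub>M (Q \<Otimes>\<^sub>M Q))"
    unfolding F_def case_prod_beta' by measurable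
  have Fb: "\<bar>F a z\<bar> \<le> 1" if "a \<in> space P" "z \<in> space (Q \<Otimes>\<^sub>M Q)" for a z
    using that bd unfolding F_def abs_mult by (auto simp: space_pair_measure intro!: mult_le_one)
  have Fi: "integrable (P \<Otimes>\<^sub>M (Q \<Otimes>\<^sub>M Q)) (case_prod F)"
  proof (rule PQp.integrable_const_bound[of _ 1])
    show "AE z in P \<Otimes>\<^sub>M (Q \<Otimes>\<^sub>M Q). norm (case_prod F z) \<le> 1"
    proof (rule AE_I2)
      fix z assume "z \<in> space (P \<Otimes>\<^sub>M (Q \<Otimes>\<^sub>M Q))"
      then show "norm (case_prod F z) \<le> 1" using Fb by (cases z) (simp add: space_pair_measure)
    qed
  qed measurable
  have "(\<integral>a. (\<integral>b. \<Phi> (a, b) \<partial>Q)\<^sup>2 \<partial>P) = (\<integral>a. \<integral>z. F a z \<partial>(Q \<Otimes>\<^sub>M Q) \<partial>P)"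
  proof (rule Bochner_Integration.integral_cong[OF refl])
    fix a assume a: "a \<in> space P"
    have "(\<integral>z. F a z \<partial>(Q \<Otimes>\<^sub>M Q)) = (\<integral>b. \<Phi> (a, b) \<partial>Q) * (\<integral>b. \<Phi> (a, b) \<partial>Q)"
      unfolding F_def by (rule integral_pair_mult) (use a bd assms(2) in auto)
    then show "(\<integral>b. \<Phi> (a, b) \<partial>Q)\<^sup>2 = (\<integral>z. F a z \<partial>(Q \<Otimes>\<^sub>M Q))" by (simp add: power2_eq_square)
  qed
  also have "\<dots> = (\<integral>z. \<integral>a. F a z \<partial>P \<partial>(Q \<Otimes>\<^sub>M Q))"
    by (rule PQ.Fubini_integral[OF Fi, symmetric])
  also have "\<dots> \<le> (\<integral>z. indicator D z \<partial>(Q \<Otimes>\<^sub>M Q))"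
  proof (rule integral_mono)
    show "integrable (Q \<Otimes>\<^sub>M Q) (\<lambda>z. \<integral>a. F a z \<partial>P)" by (rule PQ.integrable_snd[OF Fi])
    show "integrable (Q \<Otimes>\<^sub>M Q) (indicator D :: _ \<Rightarrow> real)"
      by (rule QQ.integrable_const_bound[of _ 1]) (auto simp: indicator_def)
    fix z assume z: "z \<in> space (Q \<Otimes>\<^sub>M Q)"
    show "(\<integral>a. F a z \<partial>P) \<le> indicator D z"
    proof (cases "z \<in> D")
      case True
      have "(\<integral>a. F a z \<partial>P) \<le> (\<integral>a. 1 \<partial>P)"
      proof (rule integral_mono')
        show "F a z \<le> 1" if "a \<in> space P" for a using Fb[OF that z] by (simp add: abs_le_iff)
      qed auto
      then show ?thesis using True by (simp add: P.prob_space)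
    next
      case False
      then show ?thesis using orth[of "fst z" "snd z"] z by (auto simp: F_def space_pair_measure)
    qed
  qed
  also have "\<dots> = measure (Q \<Otimes>\<^sub>M Q) D" using sets.Int_space_eq2[OF D] by simp
  finally show ?thesis .
qed

lemma (in prob_space) exists_less_of_integral_less:
  fixes f :: "'a \<Rightarrow> real"
  assumes "integrable M f" "(\<integral>x. f x \<partial>M) < e"
  shows "\<exists>x\<in>space M. f x < e"
proof (rule ccontr)
  assume "\<not> ?thesis"
  then have "(\<integral>x. e \<partial>M) \<le> (\<integral>x. f x \<partial>M)" using assms(1) by (intro integral_mono) (auto simp: not_less)
  then show False using assms(2) by (simp add: prob_space)
qed

text \<open>Coordinates of the product measure at distinct indices are independent; a repeated index
  would produce the integral of a product instead.\<close>

lemma PiM_integral_four: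
  fixes f :: "nat \<Rightarrow> 'a \<Rightarrow> real"
  assumes L: "prob_space L" and J: "finite J" "{i, j, k, l} \<subseteq> J" and ne: "distinct [i, j, k, l]"
    and f: "\<And>n. f n \<in> borel_measurable L" and b: "\<And>n x. x \<in> space L \<Longrightarrow> \<bar>f n x\<bar> \<le> 1"
  shows "(\<integral>\<omega>. f 0 (\<omega> i) * f 1 (\<omega> j) * (f 2 (\<omega> k) * f 3 (\<omega> l)) \<partial>PiM J (\<lambda>_. L)) =
    (\<integral>x. f 0 x \<partial>L) * (\<integral>x. f 1 x \<partial>L) * ((\<integral>x. f 2 x \<partial>L) * (\<integral>x. f 3 x \<partial>L))"
proof -
  interpret L: prob_space L by fact
  interpret product_prob_space "\<lambda>_. L" ..
  \<comment> \<open>Padding with the constant 1 at all other indices brings the integrand into the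
    form of a product over the whole of \<open>J\<close>.\<close>
  define F where "F m = (if m = i then f 0 else if m = j then f 1 else if m = k then f 2
    else if m = l then f 3 else (\<lambda>_. 1))" for m
  have Fi: "integrable L (F m)" for m
  proof -
    have "integrable L (f n)" for n
      by (rule L.integrable_const_bound[of _ 1]) (use f b in auto)
    then show ?thesis by (simp add: F_def)
  qed
  \<comment> \<open>\<open>h\<close> is abstract because the collapse to four factors is needed
    twice, for the values at \<open>\<omega>\<close> and for the integrals.\<close>
  have pr: "(\<Prod>m\<in>J. h (F m) m) = h (f 0) i * h (f 1) j * (h (f 2) k * h (f 3) l)"
    if h: "\<And>m. h (\<lambda>_. 1) m = 1" for h :: "('a \<Rightarrow> real) \<Rightarrow> 'b \<Rightarrow> real"
  proof -
    have "(\<Prod>m\<in>J. h (F m) m) = (\<Prod>m\<in>{i, j, k, l}. h (F m) m)"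
      using J by (intro prod.mono_neutral_right) (auto simp: F_def h)
    moreover have "j \<noteq> i" "k \<noteq> i" "l \<noteq> i" "k \<noteq> j" "l \<noteq> j" "l \<noteq> k" using ne by auto
    ultimately show ?thesis by (simp add: F_def mult.assoc)
  qed
  have "(\<integral>\<omega>. (\<Prod>m\<in>J. F m (\<omega> m)) \<partial>PiM J (\<lambda>_. L)) = (\<Prod>m\<in>J. integral\<^sup>L L (F m))"
    by (rule product_integral_prod[OF J(1) Fi])
  moreover have "(\<Prod>m\<in>J. F m (\<omega> m)) = f 0 (\<omega> i) * f 1 (\<omega> j) * (f 2 (\<omega> k) * f 3 (\<omega> l))" for \<omega>
    by (rule pr[of "\<lambda>q m. q (\<omega> m)"]) simp
  moreover have "(\<Prod>m\<in>J. integral\<^sup>L L (F m)) =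
      (\<integral>x. f 0 x \<partial>L) * (\<integral>x. f 1 x \<partial>L) * ((\<integral>x. f 2 x \<partial>L) * (\<integral>x. f 3 x \<partial>L))"
    by (rule pr[of "\<lambda>q m. integral\<^sup>L L q"]) (simp add: L.prob_space)
  ultimately show ?thesis by simp
qed

context group_extension_setting
begin

text \<open>The test function in the fibre coordinates in which the skew product over
  \<open>coboundary g\<close> moves only the base; \<open>x\<close> comes first because it is a
  parameter there.\<close>

definition twisted :: "'y set \<Rightarrow> 'y set \<Rightarrow> ('g \<Rightarrow> real) \<Rightarrow> ('g \<Rightarrow> real) \<Rightarrow> ('y \<Rightarrow> 'g) \<Rightarrow> 'g \<times> 'g \<Rightarrow> 'y \<times> 'y \<Rightarrow> real" where
  "twisted A B u v g x w = test A B u v (w, (g (fst w) \<otimes>\<^bsub>G\<^esub> fst x, g (snd w) \<otimes>\<^bsub>G\<^esub> snd x))"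

definition coboundary :: "('y \<Rightarrow> 'g) \<Rightarrow> 'y \<Rightarrow> 'g" where
  "coboundary g y = g (T y) \<otimes>\<^bsub>G\<^esub> inv\<^bsub>G\<^esub> (g y)"

lemma coboundary_measurable[measurable]:
  assumes [measurable]: "g \<in> measurable M L"
  shows "coboundary g \<in> measurable M L"
  unfolding coboundary_def by measurable

lemma iterated_coboundary:
  assumes g: "g \<in> measurable M L" and y: "y \<in> space M"
  shows "iterated_cocycle (coboundary g) k y = g ((T ^^ k) y) \<otimes>\<^bsub>G\<^esub> inv\<^bsub>G\<^esub> (g y)"
proof (induction k)
  case 0
  then show ?case using measurable_L_closed[OF g y] by simp
next
  case (Suc k)
  have c: "g y \<in> carrier G" "g ((T ^^ k) y) \<in> carrier G" "g (T ((T ^^ k) y)) \<in> carrier G"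
    using measurable_L_closed[OF g] y Tn_space[OF y, of k] Tn_space[OF y, of "Suc k"] by auto
  have "inv\<^bsub>G\<^esub> g ((T ^^ k) y) \<otimes>\<^bsub>G\<^esub> (g ((T ^^ k) y) \<otimes>\<^bsub>G\<^esub> inv\<^bsub>G\<^esub> g y) = inv\<^bsub>G\<^esub> g y"
    using c by (simp add: m_assoc[symmetric])
  then show ?case using Suc c by (simp add: coboundary_def m_assoc)
qed

lemma map_prod_funpow: "(map_prod T T ^^ k) w = ((T ^^ k) (fst w), (T ^^ k) (snd w))"
  by (induction k) auto

text \<open>The skew product over a coboundary is conjugate to a product with a trivial action on the fibre,
  so its averages are governed by the ergodic theorem on \<open>\<nu>\<close>, one fibre coordinate \<open>x\<close> at a time.\<close>

lemma defect_coboundary_tendsto: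
  assumes erg: "is_ergodic \<nu> (map_prod T T)"
    and A[measurable]: "A \<in> sets M" and B[measurable]: "B \<in> sets M"
    and u: "unit_lipschitz C u" "unit_lipschitz C v" and g[measurable]: "g \<in> measurable M L"
  shows "(\<lambda>n. defect A B u v (coboundary g) n) \<longlonglongrightarrow>
    (\<integral>x. \<bar>(\<integral>w. twisted A B u v g x w \<partial>\<nu>) - (\<integral>x. test A B u v x \<partial>V)\<bar> \<partial>(L \<Otimes>\<^sub>M L))"
proof -
  note uv[measurable] = unit_lipschitz_measurable[OF u(1)] unit_lipschitz_measurable[OF u(2)]
  interpret VV: pair_sigma_finite \<nu> "L \<Otimes>\<^sub>M L" ..
  define F where "F = twisted A B u v g"
  define I where "I = (\<integral>x. test A B u v x \<partial>V)"
  define m where "m x = (\<integral>w. F x w \<partial>\<nu>)" for x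
  have Fm[measurable]: "(\<lambda>z. F (snd z) (fst z)) \<in> borel_measurable V"
    unfolding F_def twisted_def test_def by (simp, measurable)
  have Fxm: "F x \<in> borel_measurable \<nu>" if x: "x \<in> space (L \<Otimes>\<^sub>M L)" for x
    using measurable_compose[OF measurable_Pair2'[OF x] Fm] by simp
  have Fb: "\<bar>F x w\<bar> \<le> 1" if "x \<in> space (L \<Otimes>\<^sub>M L)" "w \<in> space \<nu>" for x w
  proof -
    have "(w, (g (fst w) \<otimes>\<^bsub>G\<^esub> fst x, g (snd w) \<otimes>\<^bsub>G\<^esub> snd x)) \<in> space V"
      using that measurable_L_closed[OF g] by (auto simp: space_V space_pair_measure space_L)
    from test_bounds[OF u this] show ?thesis unfolding F_def twisted_def by (simp add: abs_le_iff)
  qed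
  have TT[measurable]: "(map_prod T T ^^ k) \<in> measurable \<nu> \<nu>" for k
    by (rule measure_preserving_measurable[OF measure_preserving_funpow[OF \<nu>_mp]])
  define H where "H n w x = birkhoff_average (map_prod T T) (F x) n w" for n w x
  have Hm[measurable]: "(\<lambda>z. H n (fst z) (snd z)) \<in> borel_measurable V" for n
  proof -
    have "(\<lambda>z. F (snd z) ((map_prod T T ^^ k) (fst z))) \<in> borel_measurable V" for k
    proof -
      have "(\<lambda>z. ((map_prod T T ^^ k) (fst z), snd z)) \<in> measurable V V" by measurable
      from measurable_compose[OF this Fm] show ?thesis by simp
    qed
    then show ?thesis unfolding H_def birkhoff_average_def by measurable
  qed
  have TTs: "(map_prod T T ^^ k) w \<in> space \<nu>" if "w \<in> space \<nu>" for k w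
    using measurable_space[OF TT that] .
  have Hb: "\<bar>H n w x\<bar> \<le> 1" if "x \<in> space (L \<Otimes>\<^sub>M L)" "w \<in> space \<nu>" for n x w
    unfolding H_def using Fb[OF that(1)] TTs[OF that(2)] by (intro birkhoff_average_bound) auto
  \<comment> \<open>Multiplying the fibres by the inverse of \<open>g\<close> straightens the
    coboundary: its products along orbits telescope, so the iterates then act on the base alone.
    \<open>\<Psi>\<close> preserves \<open>V\<close>, hence integrals do not change.\<close>
  define \<Psi> where "\<Psi> = (\<lambda>(w, x). (id w, (inv\<^bsub>G\<^esub> g (fst w) \<otimes>\<^bsub>G\<^esub> fst x, inv\<^bsub>G\<^esub> g (snd w) \<otimes>\<^bsub>G\<^esub> snd x)))"
  have \<Psi>: "measure_preserving V \<Psi>"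
    unfolding \<Psi>_def
    by (rule fibre_translation_mp[of id "\<lambda>y. inv\<^bsub>G\<^esub> g y"])
       (auto simp: measure_preserving_def id_def distr_id)
  have conj: "birkhoff_average (skew (coboundary g)) (test A B u v) n z = H n (fst (\<Psi> z)) (snd (\<Psi> z))"
    if z: "z \<in> space V" for n z
  proof -
    have y: "fst (fst z) \<in> space M" "snd (fst z) \<in> space M" "fst (snd z) \<in> carrier G" "snd (snd z) \<in> carrier G"
      using z by (auto simp: space_V)
    have "test A B u v ((skew (coboundary g) ^^ k) z) = F (snd (\<Psi> z)) ((map_prod T T ^^ k) (fst (\<Psi> z)))" for k
      unfolding skew_funpow[OF coboundary_measurable[OF g] z] iterated_coboundary[OF g y(1)]
        iterated_coboundary[OF g y(2)] F_def twisted_def map_prod_funpow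
      using y measurable_L_closed[OF g] Tn_space
      by (cases z) (simp add: \<Psi>_def m_assoc)
    then show ?thesis by (simp add: H_def birkhoff_average_def)
  qed
  have absI: "\<bar>I\<bar> \<le> 1"
  proof -
    have "\<bar>I\<bar> \<le> (\<integral>x. \<bar>test A B u v x\<bar> \<partial>V)" unfolding I_def by (rule integral_abs_bound)
    also have "\<dots> \<le> (\<integral>x. 1 \<partial>V)"
    proof (rule integral_mono')
      fix x assume "x \<in> space V"
      from test_bounds[OF u this] show "\<bar>test A B u v x\<bar> \<le> 1" by (simp add: abs_le_iff)
    qed auto
    finally show ?thesis by (simp add: V.prob_space)
  qed
  have Hi: "integrable V (\<lambda>(w, x). \<bar>H n w x - I\<bar>)" for n
  proof (rule V.integrable_const_bound[of _ 2])
    show "AE z in V. norm (case z of (w, x) \<Rightarrow> \<bar>H n w x - I\<bar>) \<le> 2"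
    proof (rule AE_I2)
      fix z assume "z \<in> space V"
      then have "\<bar>H n (fst z) (snd z)\<bar> \<le> 1" by (intro Hb) (auto simp: space_V space_pair_measure space_L)
      then show "norm (case z of (w, x) \<Rightarrow> \<bar>H n w x - I\<bar>) \<le> 2"
        using absI by (auto simp: case_prod_beta' abs_le_iff)
    qed
    show "(\<lambda>(w, x). \<bar>H n w x - I\<bar>) \<in> borel_measurable V" unfolding case_prod_beta' by measurable
  qed
  have defect: "defect A B u v (coboundary g) n = (\<integral>x. \<integral>w. \<bar>H n w x - I\<bar> \<partial>\<nu> \<partial>(L \<Otimes>\<^sub>M L))" for n
  proof -
    have "defect A B u v (coboundary g) n = (\<integral>z. (case \<Psi> z of (w, x) \<Rightarrow> \<bar>H n w x - I\<bar>) \<partial>V)"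
      unfolding defect_def I_def[symmetric]
      by (rule Bochner_Integration.integral_cong) (auto simp: conj case_prod_beta')
    also have "\<dots> = (\<integral>z. (case z of (w, x) \<Rightarrow> \<bar>H n w x - I\<bar>) \<partial>V)"
      by (rule measure_preserving_integral[OF \<Psi>]) (rule borel_measurable_integrable[OF Hi])
    also have "\<dots> = (\<integral>x. \<integral>w. \<bar>H n w x - I\<bar> \<partial>\<nu> \<partial>(L \<Otimes>\<^sub>M L))"
      by (rule VV.integral_snd[OF Hi, symmetric])
    finally show ?thesis .
  qed
  \<comment> \<open>The limit \<open>m x\<close> still depends on the fibre point, as the action on
    the fibre is trivial. How far it is from the mean \<open>I\<close> is exactly what the choice of
    \<open>g\<close> has to control.\<close>
  have inner: "(\<lambda>n. \<integral>w. \<bar>H n w x - I\<bar> \<partial>\<nu>) \<longlonglongrightarrow> \<bar>m x - I\<bar>" if x: "x \<in> space (L \<Otimes>\<^sub>M L)" for x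
  proof -
    have Hxm: "(\<lambda>w. H n w x) \<in> borel_measurable \<nu>" for n
      using measurable_compose[OF measurable_Pair2'[OF x] Hm] by simp
    have "(\<lambda>n. \<integral>w. \<bar>H n w x - I\<bar> \<partial>\<nu>) \<longlonglongrightarrow> (\<integral>w. \<bar>m x - I\<bar> \<partial>\<nu>)"
    proof (rule integral_dominated_convergence[where w="\<lambda>_. 2"])
      have "AE w in \<nu>. (\<lambda>n. H n w x) \<longlonglongrightarrow> m x"
        unfolding H_def m_def
        by (rule birkhoff_ergodic_bounded[OF \<nu>.prob_space_axioms \<nu>_mp erg Fxm[OF x] Fb[OF x]])
      then show "AE w in \<nu>. (\<lambda>n. \<bar>H n w x - I\<bar>) \<longlonglongrightarrow> \<bar>m x - I\<bar>"
        by eventually_elim (intro tendsto_intros)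
      show "AE w in \<nu>. norm \<bar>H n w x - I\<bar> \<le> 2" for n
      proof (rule AE_I2)
        fix w assume "w \<in> space \<nu>"
        from Hb[OF x this, of n] show "norm \<bar>H n w x - I\<bar> \<le> 2" using absI by simp
      qed
    qed (use Hxm in auto)
    then show ?thesis by (simp add: \<nu>.prob_space[unfolded space_\<nu>])
  qed
  have "(\<lambda>n. \<integral>x. \<integral>w. \<bar>H n w x - I\<bar> \<partial>\<nu> \<partial>(L \<Otimes>\<^sub>M L)) \<longlonglongrightarrow> (\<integral>x. \<bar>m x - I\<bar> \<partial>(L \<Otimes>\<^sub>M L))"
  proof (rule integral_dominated_convergence[where w="\<lambda>_. 2"])
    show "AE x in L \<Otimes>\<^sub>M L. (\<lambda>n. \<integral>w. \<bar>H n w x - I\<bar> \<partial>\<nu>) \<longlonglongrightarrow> \<bar>m x - I\<bar>"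
      by (rule AE_I2) (rule inner)
    show "(\<lambda>x. \<integral>w. \<bar>H n w x - I\<bar> \<partial>\<nu>) \<in> borel_measurable (L \<Otimes>\<^sub>M L)" for n
      by (rule borel_measurable_integrable[OF VV.integrable_snd[OF Hi]])
    show "(\<lambda>x. \<bar>m x - I\<bar>) \<in> borel_measurable (L \<Otimes>\<^sub>M L)"
    proof -
      have "(\<lambda>z. F (fst z) (snd z)) \<in> borel_measurable ((L \<Otimes>\<^sub>M L) \<Otimes>\<^sub>M \<nu>)"
        using measurable_compose[OF measurable_pair_swap' Fm] by (simp add: case_prod_beta')
      then have "m \<in> borel_measurable (L \<Otimes>\<^sub>M L)"
        unfolding m_def by (intro \<nu>.borel_measurable_lebesgue_integral) (simp add: case_prod_beta')
      then show ?thesis by measurable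
    qed
    show "AE x in L \<Otimes>\<^sub>M L. norm (\<integral>w. \<bar>H n w x - I\<bar> \<partial>\<nu>) \<le> 2" for n
    proof (rule AE_I2)
      fix x assume x: "x \<in> space (L \<Otimes>\<^sub>M L)"
      have "norm (\<integral>w. \<bar>H n w x - I\<bar> \<partial>\<nu>) \<le> (\<integral>w. \<bar>\<bar>H n w x - I\<bar>\<bar> \<partial>\<nu>)"
        using integral_abs_bound by simp
      also have "\<dots> \<le> (\<integral>w. 2 \<partial>\<nu>)"
      proof (rule integral_mono')
        fix w assume "w \<in> space \<nu>"
        from Hb[OF x this, of n] show "\<bar>\<bar>H n w x - I\<bar>\<bar> \<le> 2" using absI by simp
      qed auto
      finally show "norm (\<integral>w. \<bar>H n w x - I\<bar> \<partial>\<nu>) \<le> 2" by (simp add: \<nu>.prob_space[unfolded space_\<nu>])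
    qed
  qed auto
  then show ?thesis unfolding defect m_def F_def I_def .
qed

end

section \<open>Randomised transfer functions\<close>

lemma pred_eq_finite_count_space:
  assumes J: "finite J" and f: "f \<in> measurable M (count_space J)" and g: "g \<in> measurable M (count_space J)"
  shows "Measurable.pred M (\<lambda>x. f x = g x)"
proof -
  have "{x \<in> space M. f x = g x} = (\<Union>i\<in>J. (f -` {i} \<inter> space M) \<inter> (g -` {i} \<inter> space M))"
    using measurable_space[OF f] measurable_space[OF g] by auto
  also have "\<dots> \<in> sets M"
    using J by (intro sets.finite_UN sets.Int measurable_sets[OF f] measurable_sets[OF g]) auto
  finally show ?thesis by (simp add: pred_def)
qed

text \<open>Expanding the product leaves a mixed moment and two single ones; the latter are cases of
  the four-factor formula with two functions replaced by 1. When \<open>a\<close> is the mean of the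
  first product, or \<open>a'\<close> that of the second, the result vanishes.\<close>

lemma PiM_integral_centred:
  fixes f :: "nat \<Rightarrow> 'a \<Rightarrow> real"
  assumes L: "prob_space L" and J: "finite J" "{i, j, k, l} \<subseteq> J" and ne: "distinct [i, j, k, l]"
    and f[measurable]: "\<And>n. f n \<in> borel_measurable L" and b: "\<And>n x. x \<in> space L \<Longrightarrow> \<bar>f n x\<bar> \<le> 1"
  shows "(\<integral>\<omega>. (f 0 (\<omega> i) * f 1 (\<omega> j) - a) * (f 2 (\<omega> k) * f 3 (\<omega> l) - a') \<partial>PiM J (\<lambda>_. L)) =
    ((\<integral>x. f 0 x \<partial>L) * (\<integral>x. f 1 x \<partial>L) - a) * ((\<integral>x. f 2 x \<partial>L) * (\<integral>x. f 3 x \<partial>L) - a')"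
proof -
  interpret L: prob_space L by fact
  interpret product_prob_space "\<lambda>_. L" ..
  interpret J: prob_space "PiM J (\<lambda>_. L)" by (rule prob_space_PiM) (rule L)
  have sp: "\<omega> m \<in> space L" if "\<omega> \<in> space (PiM J (\<lambda>_. L))" "m \<in> {i, j, k, l}" for \<omega> m
    using that J(2) by (auto simp: space_PiM)
  have co[measurable]: "(\<lambda>\<omega>. f n (\<omega> m)) \<in> borel_measurable (PiM J (\<lambda>_. L))" if "m \<in> {i, j, k, l}" for n m
    using measurable_compose[OF measurable_component_singleton[of m J "\<lambda>_. L"] f[of n]] that J(2) by auto
  define X where "X \<omega> = f 0 (\<omega> i) * f 1 (\<omega> j)" for \<omega>
  define Y where "Y \<omega> = f 2 (\<omega> k) * f 3 (\<omega> l)" for \<omega>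
  have XY[measurable]: "X \<in> borel_measurable (PiM J (\<lambda>_. L))" "Y \<in> borel_measurable (PiM J (\<lambda>_. L))"
    unfolding X_def Y_def using co by auto
  have Xb: "\<bar>X \<omega>\<bar> \<le> 1" "\<bar>Y \<omega>\<bar> \<le> 1" if "\<omega> \<in> space (PiM J (\<lambda>_. L))" for \<omega>
    unfolding X_def Y_def abs_mult using sp[OF that] b by (auto intro!: mult_le_one)
  have iX: "integrable (PiM J (\<lambda>_. L)) X" and iY: "integrable (PiM J (\<lambda>_. L)) Y"
    by (rule J.integrable_const_bound[of _ 1]; use Xb in auto)+
  have iXY: "integrable (PiM J (\<lambda>_. L)) (\<lambda>\<omega>. X \<omega> * Y \<omega>)"
  proof (rule J.integrable_const_bound[of _ 1])
    show "AE \<omega> in PiM J (\<lambda>_. L). norm (X \<omega> * Y \<omega>) \<le> 1"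
      by (rule AE_I2) (use Xb in \<open>auto simp: abs_mult intro!: mult_le_one\<close>)
  qed measurable
  note P4 = PiM_integral_four[OF L J ne]
  have e1: "(\<integral>\<omega>. X \<omega> * Y \<omega> \<partial>PiM J (\<lambda>_. L)) =
      (\<integral>x. f 0 x \<partial>L) * (\<integral>x. f 1 x \<partial>L) * ((\<integral>x. f 2 x \<partial>L) * (\<integral>x. f 3 x \<partial>L))"
    unfolding X_def Y_def by (rule P4[OF f b])
  have e2: "(\<integral>\<omega>. X \<omega> \<partial>PiM J (\<lambda>_. L)) = (\<integral>x. f 0 x \<partial>L) * (\<integral>x. f 1 x \<partial>L)"
    using P4[of "\<lambda>n. if n < 2 then f n else (\<lambda>_. 1)"] f b by (simp add: X_def L.prob_space)
  have e3: "(\<integral>\<omega>. Y \<omega> \<partial>PiM J (\<lambda>_. L)) = (\<integral>x. f 2 x \<partial>L) * (\<integral>x. f 3 x \<partial>L)"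
    using P4[of "\<lambda>n. if n < 2 then (\<lambda>_. 1) else f n"] f b by (simp add: Y_def L.prob_space)
  have "(\<integral>\<omega>. (X \<omega> - a) * (Y \<omega> - a') \<partial>PiM J (\<lambda>_. L)) =
      (\<integral>\<omega>. X \<omega> * Y \<omega> - a' * X \<omega> - a * Y \<omega> + a * a' \<partial>PiM J (\<lambda>_. L))"
    by (rule Bochner_Integration.integral_cong) (auto simp: algebra_simps)
  also have "\<dots> = (\<integral>\<omega>. X \<omega> * Y \<omega> \<partial>PiM J (\<lambda>_. L)) - a' * (\<integral>\<omega>. X \<omega> \<partial>PiM J (\<lambda>_. L))
      - a * (\<integral>\<omega>. Y \<omega> \<partial>PiM J (\<lambda>_. L)) + a * a'"
    using iX iY iXY by (simp add: J.prob_space)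
  also have "\<dots> = ((\<integral>x. f 0 x \<partial>L) * (\<integral>x. f 1 x \<partial>L) - a) * ((\<integral>x. f 2 x \<partial>L) * (\<integral>x. f 3 x \<partial>L) - a')"
    unfolding e1 e2 e3 by (simp add: algebra_simps)
  finally show ?thesis unfolding X_def Y_def .
qed

context group_extension_setting
begin

lemma integral_unit_lipschitz:
  assumes "unit_lipschitz C u"
  shows "0 \<le> (\<integral>g. u g \<partial>L)" "(\<integral>g. u g \<partial>L) \<le> 1"
proof -
  have u: "\<And>g. g \<in> space L \<Longrightarrow> 0 \<le> u g \<and> u g \<le> 1" using assms by (simp add: unit_lipschitz_def space_L)
  then show "0 \<le> (\<integral>g. u g \<partial>L)" by (intro Bochner_Integration.integral_nonneg) auto
  have "(\<integral>g. u g \<partial>L) \<le> (\<integral>g. 1 \<partial>L)" using u by (intro integral_mono') auto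
  then show "(\<integral>g. u g \<partial>L) \<le> 1" by (simp add: L.prob_space)
qed

lemma integral_test:
  assumes A[measurable]: "A \<in> sets M" and B[measurable]: "B \<in> sets M"
    and u: "unit_lipschitz C u" "unit_lipschitz C v"
  shows "(\<integral>x. test A B u v x \<partial>V) =
    (\<integral>w. indicator A (fst w) * indicator B (snd w) \<partial>\<nu>) * ((\<integral>g. u g \<partial>L) * (\<integral>g. v g \<partial>L))"
proof -
  note uv[measurable] = unit_lipschitz_measurable[OF u(1)] unit_lipschitz_measurable[OF u(2)]
  have ub: "\<bar>u g\<bar> \<le> 1" "\<bar>v g\<bar> \<le> 1" if "g \<in> space L" for g
    using u that by (auto simp: unit_lipschitz_def space_L)
  have "(\<integral>x. test A B u v x \<partial>V) =
      (\<integral>w. indicator A (fst w) * indicator B (snd w) \<partial>\<nu>) * (\<integral>x. u (fst x) * v (snd x) \<partial>(L \<Otimes>\<^sub>M L))"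
    unfolding test_def
    by (rule integral_pair_mult[OF \<nu>.prob_space_axioms LL.prob_space_axioms])
       (use ub in \<open>auto simp: indicator_def abs_mult space_pair_measure intro!: mult_le_one\<close>)
  also have "(\<integral>x. u (fst x) * v (snd x) \<partial>(L \<Otimes>\<^sub>M L)) = (\<integral>g. u g \<partial>L) * (\<integral>g. v g \<partial>L)"
    by (rule integral_pair_mult[OF L.prob_space_axioms L.prob_space_axioms]) (use ub in auto)
  finally show ?thesis .
qed

text \<open>The transfer function is randomised by independent Haar-distributed elements \<open>\<omega> i\<close>, one for each
  cell \<open>i\<close>. The second moment of the deviation only sees the pairs \<open>(w\<^sub>1, w\<^sub>2)\<close> whose four coordinates do
  not lie in distinct cells.\<close>

lemma random_transfer_function:
  fixes k :: "'y \<Rightarrow> 'i"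
  assumes A[measurable]: "A \<in> sets M" and B[measurable]: "B \<in> sets M"
    and u: "unit_lipschitz C u" "unit_lipschitz C v" and c[measurable]: "c \<in> measurable M L"
    and J: "finite J" and k[measurable]: "k \<in> measurable M (count_space J)"
    and e: "e > 0"
    and bad: "measure (\<nu> \<Otimes>\<^sub>M \<nu>) {q \<in> space (\<nu> \<Otimes>\<^sub>M \<nu>).
      \<not> distinct [k (fst (fst q)), k (snd (fst q)), k (fst (snd q)), k (snd (snd q))]} < e\<^sup>2"
  obtains g \<omega> where "g = (\<lambda>y. c y \<otimes>\<^bsub>G\<^esub> \<omega> (k y))" "g \<in> measurable M L" "\<And>i. i \<in> J \<Longrightarrow> \<omega> i \<in> carrier G"
    "(\<integral>x. \<bar>(\<integral>w. twisted A B u v g x w \<partial>\<nu>) - (\<integral>x. test A B u v x \<partial>V)\<bar> \<partial>(L \<Otimes>\<^sub>M L)) < e"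
proof -
  note uv[measurable] = unit_lipschitz_measurable[OF u(1)] unit_lipschitz_measurable[OF u(2)]
  have ub: "0 \<le> u g" "u g \<le> 1" "0 \<le> v g" "v g \<le> 1" if "g \<in> carrier G" for g
    using u that by (auto simp: unit_lipschitz_def)
  define \<Omega> where "\<Omega> = PiM J (\<lambda>_. L)"
  interpret \<Omega>: prob_space \<Omega> unfolding \<Omega>_def by (rule prob_space_PiM) (rule L.prob_space_axioms)
  interpret \<Omega>L: prob_space "\<Omega> \<Otimes>\<^sub>M (L \<Otimes>\<^sub>M L)"
    by (rule prob_space_pair) (rule \<Omega>.prob_space_axioms, rule LL.prob_space_axioms)
  interpret \<Omega>P: pair_sigma_finite \<Omega> "L \<Otimes>\<^sub>M L" ..
  have \<Omega>c: "\<omega> i \<in> carrier G" if "\<omega> \<in> space \<Omega>" "i \<in> J" for \<omega> i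
    using that by (auto simp: \<Omega>_def space_PiM space_L PiE_def)
  have kJ: "k y \<in> J" if "y \<in> space M" for y using measurable_space[OF k that] by simp
  have cG: "c y \<in> carrier G" if "y \<in> space M" for y using measurable_L_closed[OF c that] .
  \<comment> \<open>The mean of the fibre part. It is subtracted inside \<open>\<Phi>\<close>, so
    that for two base points in different cells \<open>\<Phi>\<close> is centred before any
    integration over \<open>\<nu>\<close>.\<close>
  define c0 where "c0 = (\<integral>g. u g \<partial>L) * (\<integral>g. v g \<partial>L)"
  have c0: "0 \<le> c0" "c0 \<le> 1"
    unfolding c0_def using integral_unit_lipschitz[OF u(1)] integral_unit_lipschitz[OF u(2)]
    by (auto intro: mult_le_one)
  define \<Phi> where "\<Phi> q = indicator A (fst (snd q)) * indicator B (snd (snd q)) *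
      (u (c (fst (snd q)) \<otimes>\<^bsub>G\<^esub> (fst (fst q)) (k (fst (snd q))) \<otimes>\<^bsub>G\<^esub> fst (snd (fst q))) *
       v (c (snd (snd q)) \<otimes>\<^bsub>G\<^esub> (fst (fst q)) (k (snd (snd q))) \<otimes>\<^bsub>G\<^esub> snd (snd (fst q))) - c0)"
    for q :: "(('i \<Rightarrow> 'g) \<times> ('g \<times> 'g)) \<times> ('y \<times> 'y)"
  define I where "I = (\<integral>x. test A B u v x \<partial>V)"
  \<comment> \<open>\<open>\<omega>\<close> is evaluated at an index that depends on the base point;
    this stays measurable because there are only finitely many cells.\<close>
  have cm[measurable]: "(\<lambda>q. (fst (fst q)) (k (h q))) \<in> measurable ((\<Omega> \<Otimes>\<^sub>M (L \<Otimes>\<^sub>M L)) \<Otimes>\<^sub>M \<nu>) L"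
    if h[measurable]: "h \<in> measurable ((\<Omega> \<Otimes>\<^sub>M (L \<Otimes>\<^sub>M L)) \<Otimes>\<^sub>M \<nu>) M" for h
  proof (rule measurable_compose_countable'[where I=J and f="\<lambda>i q. (fst (fst q)) i"])
    show "countable J" using J by (rule countable_finite)
    show "(\<lambda>q. fst (fst q) i) \<in> measurable ((\<Omega> \<Otimes>\<^sub>M (L \<Otimes>\<^sub>M L)) \<Otimes>\<^sub>M \<nu>) L" if "i \<in> J" for i
      using measurable_compose[of "\<lambda>q. fst (fst q)" "(\<Omega> \<Otimes>\<^sub>M (L \<Otimes>\<^sub>M L)) \<Otimes>\<^sub>M \<nu>" \<Omega> "\<lambda>\<omega>. \<omega> i" L]
        measurable_component_singleton[OF that, of "\<lambda>_. L"] by (simp add: \<Omega>_def)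
  qed measurable
  have \<Phi>m[measurable]: "\<Phi> \<in> borel_measurable ((\<Omega> \<Otimes>\<^sub>M (L \<Otimes>\<^sub>M L)) \<Otimes>\<^sub>M \<nu>)"
    unfolding \<Phi>_def by measurable
  have \<Phi>b: "\<bar>\<Phi> (a, w)\<bar> \<le> 1" if "a \<in> space (\<Omega> \<Otimes>\<^sub>M (L \<Otimes>\<^sub>M L))" "w \<in> space \<nu>" for a w
  proof -
    define s t where "s = u (c (fst w) \<otimes>\<^bsub>G\<^esub> (fst a) (k (fst w)) \<otimes>\<^bsub>G\<^esub> fst (snd a))"
      and "t = v (c (snd w) \<otimes>\<^bsub>G\<^esub> (fst a) (k (snd w)) \<otimes>\<^bsub>G\<^esub> snd (snd a))"
    have "fst w \<in> space M" "snd w \<in> space M" "fst a \<in> space \<Omega>"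
      "fst (snd a) \<in> carrier G" "snd (snd a) \<in> carrier G"
      using that by (auto simp: space_pair_measure space_L)
    then have "c (fst w) \<otimes>\<^bsub>G\<^esub> (fst a) (k (fst w)) \<otimes>\<^bsub>G\<^esub> fst (snd a) \<in> carrier G"
      "c (snd w) \<otimes>\<^bsub>G\<^esub> (fst a) (k (snd w)) \<otimes>\<^bsub>G\<^esub> snd (snd a) \<in> carrier G"
      using cG \<Omega>c kJ by simp_all
    from ub(1,2)[OF this(1)] ub(3,4)[OF this(2)]
    have "0 \<le> s" "s \<le> 1" "0 \<le> t" "t \<le> 1" unfolding s_def t_def by simp_all
    then have "0 \<le> s * t" "s * t \<le> 1" by (auto intro: mult_le_one)
    then have "\<bar>s * t - c0\<bar> \<le> 1" using c0 by auto
    then show ?thesis by (auto simp: \<Phi>_def s_def t_def indicator_def)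
  qed
  define D where "D = {q \<in> space (\<nu> \<Otimes>\<^sub>M \<nu>).
      \<not> distinct [k (fst (fst q)), k (snd (fst q)), k (fst (snd q)), k (snd (snd q))]}"
  have Dm: "D \<in> sets (\<nu> \<Otimes>\<^sub>M \<nu>)"
  proof -
    have eqm[measurable]: "Measurable.pred (\<nu> \<Otimes>\<^sub>M \<nu>) (\<lambda>q. k (h q) = k (h' q))"
      if h: "h \<in> measurable (\<nu> \<Otimes>\<^sub>M \<nu>) M" "h' \<in> measurable (\<nu> \<Otimes>\<^sub>M \<nu>) M" for h h'
      by (rule pred_eq_finite_count_space[OF J measurable_compose[OF h(1) k] measurable_compose[OF h(2) k]])
    show ?thesis unfolding D_def distinct.simps list.set insert_iff empty_iff by measurable
  qed
  \<comment> \<open>With the fibre point fixed, only the random elements are integrated. In four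
    distinct cells they are independent, and Haar invariance gives the factors the means of
    \<open>u\<close> and \<open>v\<close> whatever the translations by \<open>c\<close> and
    \<open>x\<close> are, so the centred product integrates to 0.\<close>
  have orth: "(\<integral>a. \<Phi> (a, w) * \<Phi> (a, w') \<partial>(\<Omega> \<Otimes>\<^sub>M (L \<Otimes>\<^sub>M L))) = 0"
    if w: "w \<in> space \<nu>" and w': "w' \<in> space \<nu>" and nD: "(w, w') \<notin> D" for w w'
  proof -
    have wM: "fst w \<in> space M" "snd w \<in> space M" "fst w' \<in> space M" "snd w' \<in> space M"
      using w w' by auto
    have dist: "distinct [k (fst w), k (snd w), k (fst w'), k (snd w')]"
      using nD w w' by (auto simp: D_def space_pair_measure)
    have sub: "{k (fst w), k (snd w), k (fst w'), k (snd w')} \<subseteq> J" using kJ wM by auto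
    have int: "integrable (\<Omega> \<Otimes>\<^sub>M (L \<Otimes>\<^sub>M L)) (\<lambda>a. \<Phi> (a, w) * \<Phi> (a, w'))"
    proof (rule \<Omega>L.integrable_const_bound[of _ 1])
      show "AE a in \<Omega> \<Otimes>\<^sub>M (L \<Otimes>\<^sub>M L). norm (\<Phi> (a, w) * \<Phi> (a, w')) \<le> 1"
      proof (rule AE_I2)
        fix a assume "a \<in> space (\<Omega> \<Otimes>\<^sub>M (L \<Otimes>\<^sub>M L))"
        then show "norm (\<Phi> (a, w) * \<Phi> (a, w')) \<le> 1"
          using \<Phi>b[OF _ w] \<Phi>b[OF _ w'] by (simp add: abs_mult mult_le_one)
      qed
      have "(\<lambda>a. \<Phi> (a, w)) \<in> borel_measurable (\<Omega> \<Otimes>\<^sub>M (L \<Otimes>\<^sub>M L))"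
        "(\<lambda>a. \<Phi> (a, w')) \<in> borel_measurable (\<Omega> \<Otimes>\<^sub>M (L \<Otimes>\<^sub>M L))"
        using measurable_compose[OF measurable_Pair2'[OF w] \<Phi>m] measurable_compose[OF measurable_Pair2'[OF w'] \<Phi>m]
        by simp_all
      then show "(\<lambda>a. \<Phi> (a, w) * \<Phi> (a, w')) \<in> borel_measurable (\<Omega> \<Otimes>\<^sub>M (L \<Otimes>\<^sub>M L))"
        by (rule borel_measurable_times)
    qed
    have inner: "(\<integral>\<omega>. \<Phi> ((\<omega>, x), w) * \<Phi> ((\<omega>, x), w') \<partial>\<Omega>) = 0" if x: "x \<in> space (L \<Otimes>\<^sub>M L)" for x
    proof -
      have xc: "fst x \<in> carrier G" "snd x \<in> carrier G" using x by (auto simp: space_pair_measure space_L)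
      define f where "f n z = (if n = 0 then u (c (fst w) \<otimes>\<^bsub>G\<^esub> z \<otimes>\<^bsub>G\<^esub> fst x)
         else if n = 1 then v (c (snd w) \<otimes>\<^bsub>G\<^esub> z \<otimes>\<^bsub>G\<^esub> snd x)
         else if n = 2 then u (c (fst w') \<otimes>\<^bsub>G\<^esub> z \<otimes>\<^bsub>G\<^esub> fst x)
         else v (c (snd w') \<otimes>\<^bsub>G\<^esub> z \<otimes>\<^bsub>G\<^esub> snd x))" for n :: nat and z
      have trm: "(\<lambda>z. q (a \<otimes>\<^bsub>G\<^esub> z \<otimes>\<^bsub>G\<^esub> b)) \<in> borel_measurable L"
        if "q \<in> borel_measurable L" "a \<in> carrier G" "b \<in> carrier G" for q :: "'g \<Rightarrow> real" and a b
      proof -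
        have [measurable]: "(\<lambda>_. a) \<in> measurable L L" "(\<lambda>_. b) \<in> measurable L L" "q \<in> borel_measurable L"
          using that const_measurable by auto
        show ?thesis by measurable
      qed
      have fm: "f n \<in> borel_measurable L" for n
        unfolding f_def using trm uv cG wM xc by auto
      have fb: "\<bar>f n z\<bar> \<le> 1" if "z \<in> space L" for n z
        using that ub cG wM xc by (auto simp: f_def space_L abs_le_iff intro: order_trans[of _ 0])
      have fi: "(\<integral>z. f 0 z \<partial>L) = (\<integral>g. u g \<partial>L)" "(\<integral>z. f 1 z \<partial>L) = (\<integral>g. v g \<partial>L)"
        "(\<integral>z. f 2 z \<partial>L) = (\<integral>g. u g \<partial>L)" "(\<integral>z. f 3 z \<partial>L) = (\<integral>g. v g \<partial>L)"
        unfolding f_def using haar_left_right_integral cG wM xc uv by simp_all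
      define s where "s = (indicator A (fst w) * indicator B (snd w) * (indicator A (fst w') * indicator B (snd w')) :: real)"
      have "(\<integral>\<omega>. \<Phi> ((\<omega>, x), w) * \<Phi> ((\<omega>, x), w') \<partial>\<Omega>) =
          (\<integral>\<omega>. s * ((f 0 (\<omega> (k (fst w))) * f 1 (\<omega> (k (snd w))) - c0) *
            (f 2 (\<omega> (k (fst w'))) * f 3 (\<omega> (k (snd w'))) - c0)) \<partial>\<Omega>)"
        by (rule Bochner_Integration.integral_cong) (auto simp: \<Phi>_def f_def s_def)
      also have "\<dots> = s * (\<integral>\<omega>. (f 0 (\<omega> (k (fst w))) * f 1 (\<omega> (k (snd w))) - c0) *
            (f 2 (\<omega> (k (fst w'))) * f 3 (\<omega> (k (snd w'))) - c0) \<partial>\<Omega>)"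
        by simp
      also have "(\<integral>\<omega>. (f 0 (\<omega> (k (fst w))) * f 1 (\<omega> (k (snd w))) - c0) *
            (f 2 (\<omega> (k (fst w'))) * f 3 (\<omega> (k (snd w'))) - c0) \<partial>\<Omega>) =
          ((\<integral>z. f 0 z \<partial>L) * (\<integral>z. f 1 z \<partial>L) - c0) * ((\<integral>z. f 2 z \<partial>L) * (\<integral>z. f 3 z \<partial>L) - c0)"
        unfolding \<Omega>_def by (rule PiM_integral_centred[OF L.prob_space_axioms J sub dist fm fb])
      also have "\<dots> = 0" unfolding fi by (simp add: c0_def)
      finally show ?thesis by simp
    qed
    have "(\<integral>a. \<Phi> (a, w) * \<Phi> (a, w') \<partial>(\<Omega> \<Otimes>\<^sub>M (L \<Otimes>\<^sub>M L))) =
        (\<integral>x. \<integral>\<omega>. \<Phi> ((\<omega>, x), w) * \<Phi> ((\<omega>, x), w') \<partial>\<Omega> \<partial>(L \<Otimes>\<^sub>M L))"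
      using \<Omega>P.integral_snd[of "\<lambda>\<omega> x. \<Phi> ((\<omega>, x), w) * \<Phi> ((\<omega>, x), w')"] int
      by (simp add: case_prod_beta')
    also have "\<dots> = (\<integral>x. 0 \<partial>(L \<Otimes>\<^sub>M L))"
      by (rule Bochner_Integration.integral_cong[OF refl]) (rule inner)
    finally show ?thesis by simp
  qed
  define h where "h a = (\<integral>w. \<Phi> (a, w) \<partial>\<nu>)" for a
  have hm[measurable]: "h \<in> borel_measurable (\<Omega> \<Otimes>\<^sub>M (L \<Otimes>\<^sub>M L))"
    unfolding h_def by (rule \<nu>.borel_measurable_lebesgue_integral) (simp add: case_prod_beta' \<Phi>m)
  have hb: "\<bar>h a\<bar> \<le> 1" if a: "a \<in> space (\<Omega> \<Otimes>\<^sub>M (L \<Otimes>\<^sub>M L))" for a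
  proof -
    have "\<bar>h a\<bar> \<le> (\<integral>w. \<bar>\<Phi> (a, w)\<bar> \<partial>\<nu>)" unfolding h_def by (rule integral_abs_bound)
    also have "\<dots> \<le> (\<integral>w. 1 \<partial>\<nu>)" by (rule integral_mono') (use \<Phi>b[OF a] in auto)
    finally show ?thesis by (simp add: \<nu>.prob_space[unfolded space_\<nu>])
  qed
  have "(\<integral>a. (h a)\<^sup>2 \<partial>(\<Omega> \<Otimes>\<^sub>M (L \<Otimes>\<^sub>M L))) \<le> measure (\<nu> \<Otimes>\<^sub>M \<nu>) D"
    unfolding h_def
    by (rule second_moment_bound[OF \<Omega>L.prob_space_axioms \<nu>.prob_space_axioms \<Phi>m \<Phi>b Dm orth])
  then have lt: "(\<integral>a. (h a)\<^sup>2 \<partial>(\<Omega> \<Otimes>\<^sub>M (L \<Otimes>\<^sub>M L))) < e\<^sup>2" using bad by (simp add: D_def)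
  have hi: "integrable (\<Omega> \<Otimes>\<^sub>M (L \<Otimes>\<^sub>M L)) (\<lambda>a. (h a)\<^sup>2)"
  proof (rule \<Omega>L.integrable_const_bound[of _ 1])
    show "AE a in \<Omega> \<Otimes>\<^sub>M (L \<Otimes>\<^sub>M L). norm ((h a)\<^sup>2) \<le> 1"
      by (rule AE_I2) (use hb in \<open>simp add: abs_square_le_1\<close>)
  qed measurable
  have "(\<integral>\<omega>. \<integral>x. (h (\<omega>, x))\<^sup>2 \<partial>(L \<Otimes>\<^sub>M L) \<partial>\<Omega>) < e\<^sup>2"
    using \<Omega>P.integral_fst'[OF hi] lt by simp
  \<comment> \<open>An average over \<open>\<Omega>\<close> below \<open>e\<^sup>2\<close> yields
    one realisation below \<open>e\<^sup>2\<close>; from here on nothing is random.\<close>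
  then obtain \<omega> where \<omega>: "\<omega> \<in> space \<Omega>" "(\<integral>x. (h (\<omega>, x))\<^sup>2 \<partial>(L \<Otimes>\<^sub>M L)) < e\<^sup>2"
    using \<Omega>.exists_less_of_integral_less[OF \<Omega>P.integrable_fst'[OF hi]] by blast
  have h\<omega>m[measurable]: "(\<lambda>x. h (\<omega>, x)) \<in> borel_measurable (L \<Otimes>\<^sub>M L)"
    using measurable_compose[OF measurable_Pair1'[OF \<omega>(1)] hm] by simp
  have h\<omega>b: "\<bar>h (\<omega>, x)\<bar> \<le> 1" if "x \<in> space (L \<Otimes>\<^sub>M L)" for x
    using hb \<omega>(1) that by (simp add: space_pair_measure)
  have small: "(\<integral>x. \<bar>h (\<omega>, x)\<bar> \<partial>(L \<Otimes>\<^sub>M L)) < e"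
  proof -
    have i2: "integrable (L \<Otimes>\<^sub>M L) (\<lambda>x. (h (\<omega>, x))\<^sup>2)"
      by (rule LL.integrable_const_bound[of _ 1]) (use h\<omega>b in \<open>auto simp: abs_square_le_1\<close>)
    have i1: "integrable (L \<Otimes>\<^sub>M L) (\<lambda>x. \<bar>h (\<omega>, x)\<bar>)"
      by (rule LL.integrable_const_bound[of _ 1]) (use h\<omega>b in auto)
    \<comment> \<open>An elementary substitute for Cauchy-Schwarz, tuned to the scale
      \<open>e\<close>: a second moment below \<open>e\<^sup>2\<close> forces a first moment below
      \<open>e\<close>. This is the origin of the square in the bound on the bad pairs.\<close>
    have "\<bar>t\<bar> \<le> e / 2 + t\<^sup>2 / (2 * e)" for t :: real
    proof -
      have "0 \<le> (\<bar>t\<bar> - e)\<^sup>2" by simp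
      then have "2 * e * \<bar>t\<bar> \<le> e\<^sup>2 + t\<^sup>2" by (simp add: power2_diff algebra_simps)
      then show ?thesis using e by (simp add: field_simps power2_eq_square)
    qed
    then have "(\<integral>x. \<bar>h (\<omega>, x)\<bar> \<partial>(L \<Otimes>\<^sub>M L)) \<le> (\<integral>x. e / 2 + (h (\<omega>, x))\<^sup>2 / (2 * e) \<partial>(L \<Otimes>\<^sub>M L))"
      using i1 i2 by (intro integral_mono) auto
    also have "\<dots> = e / 2 + (\<integral>x. (h (\<omega>, x))\<^sup>2 \<partial>(L \<Otimes>\<^sub>M L)) / (2 * e)"
      using i2 by (simp add: LL.prob_space)
    also have "\<dots> < e / 2 + e\<^sup>2 / (2 * e)"
      using \<omega>(2) e by (intro add_strict_left_mono divide_strict_right_mono) auto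
    also have "\<dots> = e" using e by (simp add: power2_eq_square)
    finally show ?thesis .
  qed
  define g where "g = (\<lambda>y. c y \<otimes>\<^bsub>G\<^esub> \<omega> (k y))"
  have gm: "g \<in> measurable M L"
  proof -
    have "(\<lambda>y. \<omega> (k y)) \<in> measurable M L"
      by (rule measurable_compose_countable'[where I=J and f="\<lambda>i y. \<omega> i"])
         (use \<Omega>c[OF \<omega>(1)] k J in \<open>auto simp: space_L countable_finite\<close>)
    then show ?thesis unfolding g_def using c by measurable
  qed
  have dev: "h (\<omega>, x) = (\<integral>w. twisted A B u v g x w \<partial>\<nu>) - I" if x: "x \<in> space (L \<Otimes>\<^sub>M L)" for x
  proof -
    have tm: "(\<lambda>w. twisted A B u v g x w) \<in> borel_measurable \<nu>"
    proof -
      have [measurable]: "(\<lambda>_. fst x) \<in> measurable \<nu> L" "(\<lambda>_. snd x) \<in> measurable \<nu> L"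
        using x const_measurable by (auto simp: space_pair_measure space_L)
      note gm[measurable]
      show ?thesis unfolding twisted_def test_def by (simp, measurable)
    qed
    have tb: "\<bar>twisted A B u v g x w\<bar> \<le> 1" if "w \<in> space \<nu>" for w
    proof -
      have "(w, (g (fst w) \<otimes>\<^bsub>G\<^esub> fst x, g (snd w) \<otimes>\<^bsub>G\<^esub> snd x)) \<in> space V"
        using that x measurable_L_closed[OF gm] by (auto simp: space_V space_pair_measure space_L)
      from test_bounds[OF u this] show ?thesis unfolding twisted_def by (simp add: abs_le_iff)
    qed
    have i1: "integrable \<nu> (\<lambda>w. twisted A B u v g x w)"
      by (rule \<nu>.integrable_const_bound[of _ 1]) (use tb tm in auto)
    have i2: "integrable \<nu> (\<lambda>w. indicator A (fst w) * indicator B (snd w) :: real)"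
      by (rule \<nu>.integrable_const_bound[of _ 1]) (auto simp: indicator_def)
    have "h (\<omega>, x) = (\<integral>w. twisted A B u v g x w - (indicator A (fst w) * indicator B (snd w)) * c0 \<partial>\<nu>)"
      unfolding h_def
      by (rule Bochner_Integration.integral_cong)
         (auto simp: \<Phi>_def twisted_def test_def g_def algebra_simps)
    also have "\<dots> = (\<integral>w. twisted A B u v g x w \<partial>\<nu>) - I"
      using i1 i2 unfolding I_def integral_test[OF A B u] c0_def by simp
    finally show ?thesis .
  qed
  have "(\<integral>x. \<bar>(\<integral>w. twisted A B u v g x w \<partial>\<nu>) - I\<bar> \<partial>(L \<Otimes>\<^sub>M L)) = (\<integral>x. \<bar>h (\<omega>, x)\<bar> \<partial>(L \<Otimes>\<^sub>M L))"
    by (rule Bochner_Integration.integral_cong) (auto simp: dev)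
  then show thesis
    using that[OF g_def gm \<Omega>c[OF \<omega>(1)]] small by (simp add: I_def)
qed

end

section \<open>Density of good cocycles\<close>

context group_extension_setting
begin

text \<open>The witness \<open>b y\<close> is the first point of \<open>A\<close> on the backward orbit of \<open>y\<close>, and \<open>c y\<close> is the product of the
  cocycle \<open>\<phi>\<close> along the orbit from \<open>b y\<close> to \<open>y\<close>.\<close>

lemma skyscraper:
  assumes erg: "is_ergodic M T" and \<phi>[measurable]: "\<phi> \<in> measurable M L"
    and A[measurable]: "A \<in> sets M" and pos: "measure M A > 0"
  obtains b c where "b \<in> measurable M M" "c \<in> measurable M L"
    "\<And>x y. x \<in> space M \<Longrightarrow> y \<in> space M \<Longrightarrow> b x = b y \<Longrightarrow> \<exists>j k. (T ^^ j) x = (T ^^ k) y"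
    "AE y in M. T y \<notin> A \<longrightarrow> b (T y) = b y \<and> c (T y) = \<phi> y \<otimes>\<^bsub>G\<^esub> c y"
proof -
  define \<tau> where "\<tau> = the_inv_into (space M) T"
  have bij: "bij_betw T (space M) (space M)" and \<tau>m[measurable]: "\<tau> \<in> measurable M M"
    using sysM by (auto simp: is_system_def \<tau>_def)
  have \<tau>T: "\<tau> (T y) = y" if "y \<in> space M" for y
    unfolding \<tau>_def by (rule the_inv_into_f_f[OF T_inj that])
  have T\<tau>: "T (\<tau> y) = y" if "y \<in> space M" for y
    unfolding \<tau>_def by (rule f_the_inv_into_f_bij_betw[OF bij that])
  have \<tau>nm[measurable]: "(\<tau> ^^ n) \<in> measurable M M" for n
    by (rule measurable_compose_n[OF \<tau>m])
  have Tn\<tau>n: "(T ^^ n) ((\<tau> ^^ n) y) = y" if y: "y \<in> space M" for n y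
  proof (induction n)
    case (Suc n)
    have "(T ^^ Suc n) ((\<tau> ^^ Suc n) y) = (T ^^ n) (T (\<tau> ((\<tau> ^^ n) y)))" by (simp add: funpow_swap1)
    then show ?case using Suc T\<tau>[OF measurable_space[OF \<tau>nm y]] by simp
  qed simp
  have \<tau>S: "(\<tau> ^^ Suc n) (T y) = (\<tau> ^^ n) y" if "y \<in> space M" for n y
    using \<tau>T[OF that] by (simp add: funpow_swap1)
  \<comment> \<open>Where the backward orbit misses \<open>A\<close> the value is unspecified; by
    ergodicity those points form a null set.\<close>
  define r where "r y = (LEAST n. (\<tau> ^^ n) y \<in> A)" for y
  have rm[measurable]: "r \<in> measurable M (count_space UNIV)"
    unfolding r_def by measurable
  define b where "b y = (\<tau> ^^ r y) y" for y
  \<comment> \<open>The product of \<open>\<phi>\<close> over the \<open>n\<close> points before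
    \<open>y\<close>, the most recent one on the left.\<close>
  define cc where "cc = rec_nat (\<lambda>y. \<one>\<^bsub>G\<^esub>) (\<lambda>_ h y. \<phi> (\<tau> y) \<otimes>\<^bsub>G\<^esub> h (\<tau> y))"
  have ccS: "cc (Suc n) = (\<lambda>y. \<phi> (\<tau> y) \<otimes>\<^bsub>G\<^esub> cc n (\<tau> y))" for n by (simp add: cc_def)
  have ccm[measurable]: "cc n \<in> measurable M L" for n
  proof (induction n)
    case 0
    then show ?case using const_measurable[of "\<one>\<^bsub>G\<^esub>"] by (simp add: cc_def)
  next
    case (Suc n)
    note Suc[measurable]
    show ?case unfolding ccS by measurable
  qed
  define c where "c y = cc (r y) y" for y
  have bm: "b \<in> measurable M M"
    unfolding b_def by (rule measurable_compose_countable[OF _ rm]) measurable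
  have cm: "c \<in> measurable M L"
    unfolding c_def by (rule measurable_compose_countable[OF _ rm]) measurable
  \<comment> \<open>Both points lie on the forward orbit of their common base point, at times
    \<open>r x\<close> and \<open>r y\<close>; when each waits for the time of the other, they
    meet.\<close>
  have orbit: "\<exists>j k. (T ^^ j) x = (T ^^ k) y" if "x \<in> space M" "y \<in> space M" "b x = b y" for x y
  proof -
    have "(T ^^ r y) x = (T ^^ (r y + r x)) ((\<tau> ^^ r x) x)"
      using Tn\<tau>n[OF that(1)] by (simp add: funpow_add)
    also have "\<dots> = (T ^^ (r x + r y)) ((\<tau> ^^ r y) y)"
      using that(3) by (simp add: b_def add.commute)
    also have "\<dots> = (T ^^ r x) y"
      using Tn\<tau>n[OF that(2)] by (simp add: funpow_add)
    finally show ?thesis by blast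
  qed
  define H where "H = {y \<in> space M. \<exists>n. (\<tau> ^^ n) y \<in> A}"
  have Hm[measurable]: "H \<in> sets M" unfolding H_def by measurable
  have TH: "T y \<in> H" if yH: "y \<in> H" for y
  proof -
    have y: "y \<in> space M" using yH by (simp add: H_def)
    obtain n where "(\<tau> ^^ n) y \<in> A" using yH by (auto simp: H_def)
    then have "(\<tau> ^^ Suc n) (T y) \<in> A" using \<tau>S[OF y] by simp
    then show ?thesis using measurable_space[OF T_measurable y] unfolding H_def by blast
  qed
  \<comment> \<open>By construction \<open>H\<close> is only forward invariant; preservation of the
    measure turns the inclusion into its preimage into an equality up to a null set.\<close>
  have "AE y in M. T y \<in> H \<longleftrightarrow> y \<in> H"
  proof -
    have "measure M (T -` H \<inter> space M) = measure (distr M M T) H"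
      by (subst measure_distr) auto
    then have e: "measure M (T -` H \<inter> space M) = measure M H"
      using T_mp by (simp add: measure_preserving_def)
    have "H \<subseteq> T -` H \<inter> space M" using TH by (auto simp: H_def)
    then have "measure M ((T -` H \<inter> space M) - H) = 0"
      using e by (subst M.finite_measure_Diff) auto
    then have "(T -` H \<inter> space M) - H \<in> null_sets M"
      by (intro null_setsI) (auto simp: M.emeasure_eq_measure)
    then have "AE y in M. y \<notin> (T -` H \<inter> space M) - H" by (rule AE_not_in)
    then show ?thesis using AE_space by eventually_elim (use TH in blast)
  qed
  then have "measure M H = 0 \<or> measure M H = 1" using erg Hm unfolding is_ergodic_def by blast
  moreover have "measure M A \<le> measure M H"
  proof (rule M.finite_measure_mono)
    show "A \<subseteq> H"
    proof
      fix y assume y: "y \<in> A"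
      then have "(\<tau> ^^ 0) y \<in> A" by simp
      then show "y \<in> H" using y sets.sets_into_space[OF A] unfolding H_def by blast
    qed
  qed measurable
  ultimately have "measure M H = 1" using pos by auto
  then have "AE y in M. y \<in> H" by (rule M.AE_prob_1)
  then have step: "AE y in M. T y \<notin> A \<longrightarrow> b (T y) = b y \<and> c (T y) = \<phi> y \<otimes>\<^bsub>G\<^esub> c y"
  proof eventually_elim
    case (elim y)
    then have y: "y \<in> space M" by (simp add: H_def)
    obtain n where n: "(\<tau> ^^ n) y \<in> A" using elim by (auto simp: H_def)
    show ?case
    proof
      assume TA: "T y \<notin> A"
      \<comment> \<open>As \<open>T y\<close> is not in \<open>A\<close>, the search from
        \<open>T y\<close> cannot stop at time 0, and from time 1 on it repeats the search from
        \<open>y\<close>.\<close>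
      have "r (T y) = Suc (LEAST m. (\<tau> ^^ Suc m) (T y) \<in> A)"
        unfolding r_def by (rule Least_Suc[of _ "Suc n"]) (use n TA \<tau>S[OF y] in auto)
      then have rT: "r (T y) = Suc (r y)" unfolding \<tau>S[OF y] r_def .
      then show "b (T y) = b y \<and> c (T y) = \<phi> y \<otimes>\<^bsub>G\<^esub> c y"
        unfolding b_def c_def rT \<tau>S[OF y] ccS \<tau>T[OF y] by simp
    qed
  qed
  show thesis by (rule that[OF bm cm orbit step])
qed

lemma separating_sequence:
  obtains a :: "nat \<Rightarrow> 'y set" where "\<And>i. a i \<in> sets M"
    "\<And>x y. x \<in> space M \<Longrightarrow> y \<in> space M \<Longrightarrow> x \<noteq> y \<Longrightarrow> \<exists>i. x \<in> a i \<and> y \<notin> a i"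
proof -
  obtain BM where BM: "countable BM" "space M \<in> BM" "BM \<subseteq> sets M"
    "\<And>x y. x \<in> space M \<Longrightarrow> y \<in> space M \<Longrightarrow> x \<noteq> y \<Longrightarrow> \<exists>A\<in>BM. x \<in> A \<and> y \<notin> A"
    using standard_probability_space_pi_system[OF standard_M] by metis
  then have ne: "BM \<noteq> {}" by auto
  define a where "a = from_nat_into BM"
  have ra: "range a = BM" unfolding a_def by (rule range_from_nat_into[OF ne BM(1)])
  show thesis
  proof (rule that[of a])
    show "a i \<in> sets M" for i using ra BM(3) by blast
    fix x y assume "x \<in> space M" "y \<in> space M" "x \<noteq> y"
    then obtain A where "A \<in> BM" "x \<in> A" "y \<notin> A" using BM(4) by blast
    then show "\<exists>i. x \<in> a i \<and> y \<notin> a i" using ra by blast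
  qed
qed

text \<open>The label of the atom of \<open>y\<close> in the partition generated by the first
  \<open>n\<close> sets of the sequence. All labels are subsets of \<open>{..<n}\<close>, hence
  finite in number.\<close>

definition cell :: "(nat \<Rightarrow> 'y set) \<Rightarrow> nat \<Rightarrow> 'y \<Rightarrow> nat set" where
  "cell a n y = {i. i < n \<and> y \<in> a i}"

lemma cell_measurable:
  assumes a: "\<And>i. a i \<in> sets M"
  shows "cell a n \<in> measurable M (count_space (Pow {..<n}))"
proof -
  have "cell a n -` {s} \<inter> space M \<in> sets M" if s: "s \<in> Pow {..<n}" for s
  proof -
    note a[measurable]
    have "cell a n -` {s} \<inter> space M = {y \<in> space M. \<forall>i\<in>{..<n}. y \<in> a i \<longleftrightarrow> i \<in> s}"
    proof -
      have "cell a n y = s \<longleftrightarrow> (\<forall>i\<in>{..<n}. y \<in> a i \<longleftrightarrow> i \<in> s)" for y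
        using s unfolding cell_def by blast
      then show ?thesis by blast
    qed
    also have "\<dots> \<in> sets M" by measurable
    finally show ?thesis .
  qed
  moreover have "cell a n \<in> space M \<rightarrow> Pow {..<n}" by (auto simp: cell_def)
  ultimately show ?thesis by (subst measurable_count_space_eq2) auto
qed

lemma cell_eventually_distinct:
  assumes "x \<in> a i" "y \<notin> a i"
  shows "eventually (\<lambda>n. cell a n x \<noteq> cell a n y) sequentially"
  using eventually_gt_at_top[of i]
proof eventually_elim
  case (elim n)
  then have "i \<in> cell a n x" "i \<notin> cell a n y" using assms by (auto simp: cell_def)
  then show ?case by blast
qed

text \<open>For almost every point, its cells in all the successive partitions have positive
  measure. These cells decrease to at most that one point, which is null, so their measures tend to
  0.\<close>

lemma small_positive_set:
  assumes diffuse: "\<And>x. x \<in> space M \<Longrightarrow> AE y in M. y \<noteq> x" and e: "e > 0"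
  obtains A where "A \<in> sets M" "0 < measure M A" "measure M A < e"
proof -
  obtain a :: "nat \<Rightarrow> 'y set" where a: "\<And>i. a i \<in> sets M"
    "\<And>x y. x \<in> space M \<Longrightarrow> y \<in> space M \<Longrightarrow> x \<noteq> y \<Longrightarrow> \<exists>i. x \<in> a i \<and> y \<notin> a i"
    using separating_sequence by blast
  define Q where "Q n s = cell a n -` {s} \<inter> space M" for n s
  have Qm: "Q n s \<in> sets M" for n s
  proof (cases "s \<in> Pow {..<n}")
    case True
    then show ?thesis unfolding Q_def by (intro measurable_sets[OF cell_measurable[OF a(1)]]) auto
  next
    case False
    then have "Q n s = {}" by (auto simp: Q_def cell_def)
    then show ?thesis by simp
  qed
  \<comment> \<open>Countably many \<open>n\<close> with finitely many labels each: all null cells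
    together are still null.\<close>
  have "AE x in M. \<forall>n. \<forall>s\<in>Pow {..<n}. measure M (Q n s) = 0 \<longrightarrow> x \<notin> Q n s"
    unfolding AE_all_countable
  proof (rule allI, rule AE_finite_allI)
    fix n s
    show "AE x in M. measure M (Q n s) = 0 \<longrightarrow> x \<notin> Q n s"
    proof (cases "measure M (Q n s) = 0")
      case True
      then have "Q n s \<in> null_sets M" using Qm by (intro null_setsI) (auto simp: M.emeasure_eq_measure)
      then show ?thesis using AE_not_in by auto
    qed simp
  qed simp
  then have "AE x in M. x \<in> space M \<and> (\<forall>n. measure M (Q n (cell a n x)) > 0)"
    using AE_space
  proof eventually_elim
    case (elim x)
    have "measure M (Q n (cell a n x)) \<noteq> 0" for n
      using elim by (auto simp: Q_def cell_def)
    then show ?case using elim(2) by (simp add: zero_less_measure_iff)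
  qed
  then obtain x where x: "x \<in> space M" "\<And>n. measure M (Q n (cell a n x)) > 0"
    using eventually_happens M.ae_filter_bot by blast
  define R where "R n = Q n (cell a n x)" for n
  have "decseq R"
    unfolding decseq_def
  proof (intro allI impI subsetI)
    fix m n y assume mn: "m \<le> n" and y: "y \<in> R n"
    have "cell a m z = cell a n z \<inter> {..<m}" for z using mn by (auto simp: cell_def)
    then show "y \<in> R m" using y by (simp add: R_def Q_def)
  qed
  moreover have Rm: "range R \<subseteq> sets M" using Qm by (auto simp: R_def)
  ultimately have "(\<lambda>n. measure M (R n)) \<longlonglongrightarrow> measure M (\<Inter>n. R n)"
    by (intro M.finite_Lim_measure_decseq)
  moreover have "measure M (\<Inter>n. R n) = 0"
  proof -
    have "y = x" if y: "y \<in> (\<Inter>n. R n)" for y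
    proof (rule ccontr)
      assume ne: "y \<noteq> x"
      have yM: "y \<in> space M" using y by (auto simp: R_def Q_def)
      obtain i where "y \<in> a i" "x \<notin> a i" using a(2)[OF yM x(1) ne] by blast
      then have "\<exists>n. cell a n y \<noteq> cell a n x"
        using eventually_happens[OF cell_eventually_distinct] by force
      then show False using y by (auto simp: R_def Q_def)
    qed
    then have "AE y in M. y \<notin> (\<Inter>n. R n)"
      using diffuse[OF x(1)] by (auto elim!: eventually_mono)
    moreover have "(\<Inter>n. R n) \<in> sets M" using Qm by (auto simp: R_def)
    ultimately show ?thesis
      using M.prob_eq_0 by blast
  qed
  ultimately have "eventually (\<lambda>n. measure M (R n) < e) sequentially"
    using e by (intro order_tendstoD(2)) auto
  then obtain n where "measure M (R n) < e" using eventually_happens by force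
  then show thesis using that[of "R n"] x(2) Qm by (auto simp: R_def)
qed

lemma good_cocycles_dense:
  assumes erg\<nu>: "is_ergodic \<nu> (map_prod T T)" and ergM: "is_ergodic M T"
    and diag: "AE w in \<nu>. fst w \<noteq> snd w"
    and A: "A \<in> sets M" and B: "B \<in> sets M" and u: "unit_lipschitz C u" "unit_lipschitz C v"
    and \<phi>[measurable]: "\<phi> \<in> measurable M L" and \<delta>: "\<delta> > 0" and e: "e > 0"
  shows "\<exists>\<psi>\<in>measurable M L. rho \<phi> \<psi> < \<delta> \<and> (\<exists>n\<ge>1. defect A B u v \<psi> n < e)"
proof -
  obtain D where D: "D > 0" "\<And>g h. g \<in> carrier G \<Longrightarrow> h \<in> carrier G \<Longrightarrow> d g h \<le> D"
    using dist_bounded by blast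
  have point: "AE y in M. \<forall>j k. (T ^^ j) x \<noteq> (T ^^ k) y" if "x \<in> space M" for x
    by (rule AE_distinct_orbits_point[OF diag that])
  have diffuse: "AE y in M. y \<noteq> x" if "x \<in> space M" for x
    using point[OF that] by eventually_elim (metis funpow_0)
  \<comment> \<open>The new cocycle will differ from \<open>\<phi>\<close> only on the preimage of
    \<open>A0\<close>, and by at most \<open>D\<close>, which bounds \<open>rho\<close> by
    \<open>D * measure M A0\<close>.\<close>
  obtain A0 where A0[measurable]: "A0 \<in> sets M" "0 < measure M A0" "measure M A0 < \<delta> / D"
    using small_positive_set[OF diffuse, of "\<delta> / D"] \<delta> D(1) by auto
  obtain b c where b[measurable]: "b \<in> measurable M M" and c[measurable]: "c \<in> measurable M L"
    and orbit: "\<And>x y. x \<in> space M \<Longrightarrow> y \<in> space M \<Longrightarrow> b x = b y \<Longrightarrow> \<exists>j k. (T ^^ j) x = (T ^^ k) y"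
    and step: "AE y in M. T y \<notin> A0 \<longrightarrow> b (T y) = b y \<and> c (T y) = \<phi> y \<otimes>\<^bsub>G\<^esub> c y"
    using skyscraper[OF ergM \<phi> A0(1,2)] by blast
  obtain a :: "nat \<Rightarrow> 'y set" where a: "\<And>i. a i \<in> sets M"
    "\<And>x y. x \<in> space M \<Longrightarrow> y \<in> space M \<Longrightarrow> x \<noteq> y \<Longrightarrow> \<exists>i. x \<in> a i \<and> y \<notin> a i"
    using separating_sequence by blast
  \<comment> \<open>Reading the label at the base point keeps it constant along the orbit between
    visits to \<open>A0\<close>.\<close>
  define k where "k n y = cell a n (b y)" for n y
  have km: "k n \<in> measurable M (count_space (Pow {..<n}))" for n
    unfolding k_def by (rule measurable_compose[OF b cell_measurable[OF a(1)]])
  have kd: "eventually (\<lambda>n. k n x \<noteq> k n y) sequentially" if xy: "x \<in> space M" "y \<in> space M" "b x \<noteq> b y" for x y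
  proof -
    obtain i where "b x \<in> a i" "b y \<notin> a i"
      using a(2)[of "b x" "b y"] measurable_space[OF b] xy by blast
    then show ?thesis unfolding k_def by (rule cell_eventually_distinct)
  qed
  interpret NN: prob_space "\<nu> \<Otimes>\<^sub>M \<nu>"
    by (rule prob_space_pair) (rule \<nu>.prob_space_axioms)+
  interpret NNp: pair_sigma_finite \<nu> \<nu> ..
  have within: "AE w in \<nu>. b (fst w) \<noteq> b (snd w)"
    using AE_distinct_orbits[OF diag] AE_space
  proof eventually_elim
    case (elim w)
    then show ?case using orbit[of "fst w" "snd w"] by auto
  qed
  have to_point: "AE y in M. b x \<noteq> b y" if x: "x \<in> space M" for x
    using point[OF x] AE_space
  proof eventually_elim
    case (elim y)
    then show ?case using orbit[OF x, of y] by blast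
  qed
  \<comment> \<open>For coordinates of two independent pairs only the marginal of the second one
    matters, and it is \<open>M\<close>: once the first point is fixed, almost no point shares its
    base point.\<close>
  have cross: "AE q in \<nu> \<Otimes>\<^sub>M \<nu>. b (s (fst q)) \<noteq> b (t (snd q))"
    if s[measurable]: "s \<in> measurable \<nu> M" and t[measurable]: "t \<in> measurable \<nu> M"
      and AEt: "\<And>P. AE y in M. P y \<Longrightarrow> AE w in \<nu>. P (t w)" for s t
  proof (rule NNp.AE_pair_measure)
    have [measurable]: "Measurable.pred (\<nu> \<Otimes>\<^sub>M \<nu>) (\<lambda>q. b (s (fst q)) = b (t (snd q)))"
      by (rule equal_pred) measurable
    show "{q \<in> space (\<nu> \<Otimes>\<^sub>M \<nu>). b (s (fst q)) \<noteq> b (t (snd q))} \<in> sets (\<nu> \<Otimes>\<^sub>M \<nu>)" by measurable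
    show "AE w in \<nu>. AE w' in \<nu>. b (s (fst (w, w'))) \<noteq> b (t (snd (w, w')))"
    proof (rule AE_I2)
      fix w assume "w \<in> space \<nu>"
      then have "s w \<in> space M" by (rule measurable_space[OF s])
      from AEt[OF to_point[OF this]] show "AE w' in \<nu>. b (s (fst (w, w'))) \<noteq> b (t (snd (w, w')))" by simp
    qed
  qed
  define bad where "bad n = {q \<in> space (\<nu> \<Otimes>\<^sub>M \<nu>).
      \<not> distinct [k n (fst (fst q)), k n (snd (fst q)), k n (fst (snd q)), k n (snd (snd q))]}" for n
  have badm: "bad n \<in> sets (\<nu> \<Otimes>\<^sub>M \<nu>)" for n
  proof -
    have eqm[measurable]: "Measurable.pred (\<nu> \<Otimes>\<^sub>M \<nu>) (\<lambda>q. k n (h q) = k n (h' q))"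
      if h: "h \<in> measurable (\<nu> \<Otimes>\<^sub>M \<nu>) M" "h' \<in> measurable (\<nu> \<Otimes>\<^sub>M \<nu>) M" for h h'
      by (rule pred_eq_finite_count_space[OF _ measurable_compose[OF h(1) km] measurable_compose[OF h(2) km]]) simp
    show ?thesis unfolding bad_def distinct.simps list.set insert_iff empty_iff by measurable
  qed
  have "(\<lambda>n. measure (\<nu> \<Otimes>\<^sub>M \<nu>) (bad n)) \<longlonglongrightarrow> 0"
  proof -
    \<comment> \<open>Four points give six comparisons of base points, two within the pairs and four
      across. Where all six base points comparisons are strict, the refining partitions eventually
      separate them.\<close>
    have "(\<lambda>n. \<integral>q. indicator (bad n) q \<partial>(\<nu> \<Otimes>\<^sub>M \<nu>)) \<longlonglongrightarrow> (\<integral>q. 0 \<partial>(\<nu> \<Otimes>\<^sub>M \<nu>) :: real)"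
    proof (rule integral_dominated_convergence[where w="\<lambda>_. 1"])
      have 1: "AE q in \<nu> \<Otimes>\<^sub>M \<nu>. b (fst (fst q)) \<noteq> b (snd (fst q))"
        by (rule AE_pair_fstI[OF \<nu>.prob_space_axioms within])
      have 2: "AE q in \<nu> \<Otimes>\<^sub>M \<nu>. b (fst (snd q)) \<noteq> b (snd (snd q))"
        by (rule AE_pair_sndI[OF \<nu>.prob_space_axioms \<nu>.prob_space_axioms within])
      have 3: "AE q in \<nu> \<Otimes>\<^sub>M \<nu>. b (fst (fst q)) \<noteq> b (fst (snd q))" by (rule cross) (auto intro: AE_\<nu>_fst)
      have 4: "AE q in \<nu> \<Otimes>\<^sub>M \<nu>. b (fst (fst q)) \<noteq> b (snd (snd q))" by (rule cross) (auto intro: AE_\<nu>_snd)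
      have 5: "AE q in \<nu> \<Otimes>\<^sub>M \<nu>. b (snd (fst q)) \<noteq> b (fst (snd q))" by (rule cross) (auto intro: AE_\<nu>_fst)
      have 6: "AE q in \<nu> \<Otimes>\<^sub>M \<nu>. b (snd (fst q)) \<noteq> b (snd (snd q))" by (rule cross) (auto intro: AE_\<nu>_snd)
      show "AE q in \<nu> \<Otimes>\<^sub>M \<nu>. (\<lambda>n. indicator (bad n) q :: real) \<longlonglongrightarrow> 0"
        using 1 2 3 4 5 6 AE_space
      proof eventually_elim
        case (elim q)
        have sp: "fst (fst q) \<in> space M" "snd (fst q) \<in> space M" "fst (snd q) \<in> space M" "snd (snd q) \<in> space M"
          using elim(7) by (auto simp: space_pair_measure)
        have "eventually (\<lambda>n. q \<notin> bad n) sequentially"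
          using kd[OF sp(1,2) elim(1)] kd[OF sp(3,4) elim(2)] kd[OF sp(1,3) elim(3)]
            kd[OF sp(1,4) elim(4)] kd[OF sp(2,3) elim(5)] kd[OF sp(2,4) elim(6)]
          by eventually_elim (simp add: bad_def)
        then have "eventually (\<lambda>n. indicator (bad n) q = (0::real)) sequentially"
          by eventually_elim simp
        then show ?case by (rule tendsto_eventually)
      qed
    qed (use badm in \<open>auto simp: indicator_def\<close>)
    moreover have "(\<integral>q. indicator (bad n) q \<partial>(\<nu> \<Otimes>\<^sub>M \<nu>)) = measure (\<nu> \<Otimes>\<^sub>M \<nu>) (bad n)" for n
      using sets.Int_space_eq2[OF badm] by simp
    ultimately show ?thesis by simp
  qed
  then have "eventually (\<lambda>n. measure (\<nu> \<Otimes>\<^sub>M \<nu>) (bad n) < e\<^sup>2) sequentially"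
    using e by (intro order_tendstoD(2)) auto
  then obtain n0 where n0: "measure (\<nu> \<Otimes>\<^sub>M \<nu>) (bad n0) < e\<^sup>2" using eventually_happens by force
  have fin: "finite (Pow {..<n0})" by simp
  obtain g \<omega> where g: "g = (\<lambda>y. c y \<otimes>\<^bsub>G\<^esub> \<omega> (k n0 y))" "g \<in> measurable M L"
    and \<omega>: "\<And>i. i \<in> Pow {..<n0} \<Longrightarrow> \<omega> i \<in> carrier G"
    and small: "(\<integral>x. \<bar>(\<integral>w. twisted A B u v g x w \<partial>\<nu>) - (\<integral>x. test A B u v x \<partial>V)\<bar> \<partial>(L \<Otimes>\<^sub>M L)) < e"
    by (rule random_transfer_function[OF A B u c fin km e n0[unfolded bad_def]]) (rule that)
  have "eventually (\<lambda>n. defect A B u v (coboundary g) n < e) sequentially"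
    using defect_coboundary_tendsto[OF erg\<nu> A B u g(2)] small by (rule order_tendstoD(2))
  then have "eventually (\<lambda>n. n \<ge> 1 \<and> defect A B u v (coboundary g) n < e) sequentially"
    using eventually_ge_at_top[of 1] by eventually_elim simp
  then have ex: "\<exists>n\<ge>1. defect A B u v (coboundary g) n < e" using eventually_happens by force
  note gm[measurable] = g(2)
  have "AE y in M. d (\<phi> y) (coboundary g y) \<le> D * indicator (T -` A0 \<inter> space M) y"
    using step AE_space
  proof eventually_elim
    case (elim y)
    have cl: "\<phi> y \<in> carrier G" "coboundary g y \<in> carrier G" "c y \<in> carrier G" "g y \<in> carrier G"
      by (rule measurable_L_closed[OF \<phi> elim(2)], rule measurable_L_closed[OF coboundary_measurable[OF g(2)] elim(2)],
          rule measurable_L_closed[OF c elim(2)], rule measurable_L_closed[OF g(2) elim(2)])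
    have kP: "\<omega> (k n0 y) \<in> carrier G" by (rule \<omega>) (auto simp: k_def cell_def)
    show ?case
    proof (cases "T y \<in> A0")
      case True
      then show ?thesis using D(2)[OF cl(1,2)] elim(2) by simp
    next
      case False
      then have "k n0 (T y) = k n0 y" "c (T y) = \<phi> y \<otimes>\<^bsub>G\<^esub> c y" using elim(1) by (auto simp: k_def)
      \<comment> \<open>The random factor stands on the right of \<open>c\<close> and is the same at
        \<open>y\<close> and \<open>T y\<close>, so left multiplication by \<open>\<phi> y\<close>
        passes from \<open>c\<close> to \<open>g\<close>.\<close>
      then have "g (T y) = \<phi> y \<otimes>\<^bsub>G\<^esub> g y" using cl kP unfolding g(1) by (simp add: m_assoc)
      then have "coboundary g y = \<phi> y" using cl by (simp add: coboundary_def m_assoc)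
      then show ?thesis using cl D(1) by simp
    qed
  qed
  then have "rho \<phi> (coboundary g) \<le> (\<integral>y. D * indicator (T -` A0 \<inter> space M) y \<partial>M)"
    unfolding rho_def
  proof (rule integral_mono_AE[rotated 2])
    show "integrable M (\<lambda>y. d (\<phi> y) (coboundary g y))" by (rule dist_integrable) measurable
    show "integrable M (\<lambda>y. D * indicator (T -` A0 \<inter> space M) y)"
      by (rule M.integrable_const_bound[of _ D]) (use D(1) in \<open>auto simp: indicator_def\<close>)
  qed
  also have "\<dots> = D * measure M (T -` A0 \<inter> space M)" by simp
  also have "measure M (T -` A0 \<inter> space M) = measure (distr M M T) A0" by (subst measure_distr) auto
  also have "\<dots> = measure M A0" using T_mp by (simp add: measure_preserving_def)
  also have "D * measure M A0 < \<delta>" using A0(3) D(1) by (simp add: field_simps)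
  finally show ?thesis using ex gm by (intro bexI[of _ "coboundary g"]) auto
qed

end

section \<open>The fibre square of the skew product\<close>

text \<open>By Tonelli, a mixture may be multiplied by a fixed measure before or after mixing. This
  yields the disintegration of \<open>M \<Otimes>\<^sub>M L\<close> and the description of
  \<open>V\<close> over \<open>N\<close>.\<close>

lemma bind_pair_measure:
  assumes N: "prob_space N" and L: "prob_space L" and K: "K \<in> measurable N (prob_algebra M)"
  shows "(N \<bind> K) \<Otimes>\<^sub>M L = N \<bind> (\<lambda>z. K z \<Otimes>\<^sub>M L)"
proof -
  interpret N: prob_space N by fact
  interpret L: prob_space L by fact
  have Nin: "N \<in> space (prob_algebra N)" using N by (simp add: space_prob_algebra)
  have KL: "(\<lambda>z. K z \<Otimes>\<^sub>M L) \<in> measurable N (prob_algebra (M \<Otimes>\<^sub>M L))"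
    using L by (intro measurable_pair_prob[OF K] measurable_const) (simp add: space_prob_algebra)
  have s1: "sets (N \<bind> K) = sets M" by (rule sets_bind'[OF Nin K])
  have s2: "sets (N \<bind> (\<lambda>z. K z \<Otimes>\<^sub>M L)) = sets (M \<Otimes>\<^sub>M L)" by (rule sets_bind'[OF Nin KL])
  show ?thesis
  proof (rule measure_eqI)
    show "sets ((N \<bind> K) \<Otimes>\<^sub>M L) = sets (N \<bind> (\<lambda>z. K z \<Otimes>\<^sub>M L))"
      unfolding s2 by (rule sets_pair_measure_cong[OF s1 refl])
    fix Q assume "Q \<in> sets ((N \<bind> K) \<Otimes>\<^sub>M L)"
    then have Q: "Q \<in> sets (M \<Otimes>\<^sub>M L)" using sets_pair_measure_cong[OF s1 refl] by blast
    have "emeasure ((N \<bind> K) \<Otimes>\<^sub>M L) Q = (\<integral>\<^sup>+x. emeasure L (Pair x -` Q) \<partial>(N \<bind> K))"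
      using Q sets_pair_measure_cong[OF s1 refl] by (intro L.emeasure_pair_measure_alt) blast
    also have "\<dots> = (\<integral>\<^sup>+z. \<integral>\<^sup>+x. emeasure L (Pair x -` Q) \<partial>K z \<partial>N)"
      by (rule nn_integral_bind[OF L.measurable_emeasure_Pair[OF Q] measurable_prob_algebraD[OF K]])
    also have "\<dots> = (\<integral>\<^sup>+z. emeasure (K z \<Otimes>\<^sub>M L) Q \<partial>N)"
    proof (rule nn_integral_cong)
      fix z assume "z \<in> space N"
      then have "sets (K z) = sets M" using measurable_space[OF K] by (simp add: space_prob_algebra)
      then have "Q \<in> sets (K z \<Otimes>\<^sub>M L)" using Q sets_pair_measure_cong[OF _ refl] by blast
      then show "(\<integral>\<^sup>+x. emeasure L (Pair x -` Q) \<partial>K z) = emeasure (K z \<Otimes>\<^sub>M L) Q"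
        by (rule L.emeasure_pair_measure_alt[symmetric])
    qed
    also have "\<dots> = emeasure (N \<bind> (\<lambda>z. K z \<Otimes>\<^sub>M L)) Q"
      by (rule emeasure_bind_prob_algebra[OF Nin KL Q, symmetric])
    finally show "emeasure ((N \<bind> K) \<Otimes>\<^sub>M L) Q = emeasure (N \<bind> (\<lambda>z. K z \<Otimes>\<^sub>M L)) Q" .
  qed
qed

definition shuffle :: "('a \<times> 'b) \<times> ('c \<times> 'd) \<Rightarrow> ('a \<times> 'c) \<times> ('b \<times> 'd)" where
  "shuffle z = ((fst (fst z), fst (snd z)), (snd (fst z), snd (snd z)))"

lemma shuffle_measurable[measurable]:
  "shuffle \<in> measurable ((P \<Otimes>\<^sub>M P') \<Otimes>\<^sub>M (Q \<Otimes>\<^sub>M Q')) ((P \<Otimes>\<^sub>M Q) \<Otimes>\<^sub>M (P' \<Otimes>\<^sub>M Q'))"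
  unfolding shuffle_def by measurable

text \<open>Repeated use of Tonelli; the only exchange is that of the second base integration with
  the first fibre integration.\<close>

lemma emeasure_shuffle:
  assumes "prob_space P" "prob_space Q" and A[measurable]: "A \<in> sets ((P \<Otimes>\<^sub>M Q) \<Otimes>\<^sub>M (P \<Otimes>\<^sub>M Q))"
  shows "emeasure ((P \<Otimes>\<^sub>M P) \<Otimes>\<^sub>M (Q \<Otimes>\<^sub>M Q)) (shuffle -` A \<inter> space ((P \<Otimes>\<^sub>M P) \<Otimes>\<^sub>M (Q \<Otimes>\<^sub>M Q)))
    = emeasure ((P \<Otimes>\<^sub>M Q) \<Otimes>\<^sub>M (P \<Otimes>\<^sub>M Q)) A"
proof -
  interpret P: prob_space P by fact
  interpret Q: prob_space Q by fact
  interpret QQ: prob_space "Q \<Otimes>\<^sub>M Q" by (rule prob_space_pair) fact+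
  interpret PQ: prob_space "P \<Otimes>\<^sub>M Q" by (rule prob_space_pair) fact+
  interpret S: pair_sigma_finite P Q ..
  define F where "F = (indicator A :: _ \<Rightarrow> ennreal)"
  have F[measurable]: "F \<in> borel_measurable ((P \<Otimes>\<^sub>M Q) \<Otimes>\<^sub>M (P \<Otimes>\<^sub>M Q))" by (simp add: F_def)
  have "emeasure ((P \<Otimes>\<^sub>M P) \<Otimes>\<^sub>M (Q \<Otimes>\<^sub>M Q)) (shuffle -` A \<inter> space ((P \<Otimes>\<^sub>M P) \<Otimes>\<^sub>M (Q \<Otimes>\<^sub>M Q))) =
      emeasure (distr ((P \<Otimes>\<^sub>M P) \<Otimes>\<^sub>M (Q \<Otimes>\<^sub>M Q)) ((P \<Otimes>\<^sub>M Q) \<Otimes>\<^sub>M (P \<Otimes>\<^sub>M Q)) shuffle) A"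
    by (rule emeasure_distr[symmetric]) measurable
  also have "\<dots> = (\<integral>\<^sup>+z. F z \<partial>distr ((P \<Otimes>\<^sub>M P) \<Otimes>\<^sub>M (Q \<Otimes>\<^sub>M Q)) ((P \<Otimes>\<^sub>M Q) \<Otimes>\<^sub>M (P \<Otimes>\<^sub>M Q)) shuffle)"
    by (simp add: F_def)
  also have "\<dots> = (\<integral>\<^sup>+z. F (shuffle z) \<partial>((P \<Otimes>\<^sub>M P) \<Otimes>\<^sub>M (Q \<Otimes>\<^sub>M Q)))"
    by (rule nn_integral_distr) measurable
  also have "\<dots> = (\<integral>\<^sup>+w. \<integral>\<^sup>+x. F (shuffle (w, x)) \<partial>(Q \<Otimes>\<^sub>M Q) \<partial>(P \<Otimes>\<^sub>M P))"
    by (rule QQ.nn_integral_fst[symmetric]) measurable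
  also have "\<dots> = (\<integral>\<^sup>+y. \<integral>\<^sup>+y'. \<integral>\<^sup>+x. F (shuffle ((y, y'), x)) \<partial>(Q \<Otimes>\<^sub>M Q) \<partial>P \<partial>P)"
    by (rule P.nn_integral_fst[symmetric]) measurable
  also have "\<dots> = (\<integral>\<^sup>+y. \<integral>\<^sup>+y'. \<integral>\<^sup>+h. \<integral>\<^sup>+h'. F ((y, h), (y', h')) \<partial>Q \<partial>Q \<partial>P \<partial>P)"
  proof (intro nn_integral_cong)
    fix y y' assume [measurable]: "y \<in> space P" "y' \<in> space P"
    have "(\<integral>\<^sup>+h. \<integral>\<^sup>+h'. F (shuffle ((y, y'), (h, h'))) \<partial>Q \<partial>Q) = (\<integral>\<^sup>+x. F (shuffle ((y, y'), x)) \<partial>(Q \<Otimes>\<^sub>M Q))"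
      by (rule Q.nn_integral_fst) measurable
    then show "(\<integral>\<^sup>+x. F (shuffle ((y, y'), x)) \<partial>(Q \<Otimes>\<^sub>M Q)) = (\<integral>\<^sup>+h. \<integral>\<^sup>+h'. F ((y, h), (y', h')) \<partial>Q \<partial>Q)"
      by (simp add: shuffle_def)
  qed
  also have "\<dots> = (\<integral>\<^sup>+y. \<integral>\<^sup>+h. \<integral>\<^sup>+y'. \<integral>\<^sup>+h'. F ((y, h), (y', h')) \<partial>Q \<partial>P \<partial>Q \<partial>P)"
  proof (rule nn_integral_cong)
    fix y assume [measurable]: "y \<in> space P"
    show "(\<integral>\<^sup>+y'. \<integral>\<^sup>+h. \<integral>\<^sup>+h'. F ((y, h), (y', h')) \<partial>Q \<partial>Q \<partial>P) =
        (\<integral>\<^sup>+h. \<integral>\<^sup>+y'. \<integral>\<^sup>+h'. F ((y, h), (y', h')) \<partial>Q \<partial>P \<partial>Q)"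
      by (rule S.Fubini'[symmetric]) measurable
  qed
  also have "\<dots> = (\<integral>\<^sup>+y. \<integral>\<^sup>+h. \<integral>\<^sup>+b. F ((y, h), b) \<partial>(P \<Otimes>\<^sub>M Q) \<partial>Q \<partial>P)"
  proof (intro nn_integral_cong)
    fix y h assume [measurable]: "y \<in> space P" "h \<in> space Q"
    show "(\<integral>\<^sup>+y'. \<integral>\<^sup>+h'. F ((y, h), (y', h')) \<partial>Q \<partial>P) = (\<integral>\<^sup>+b. F ((y, h), b) \<partial>(P \<Otimes>\<^sub>M Q))"
      by (rule Q.nn_integral_fst) measurable
  qed
  also have "\<dots> = (\<integral>\<^sup>+a. \<integral>\<^sup>+b. F (a, b) \<partial>(P \<Otimes>\<^sub>M Q) \<partial>(P \<Otimes>\<^sub>M Q))"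
    by (rule Q.nn_integral_fst) measurable
  also have "\<dots> = (\<integral>\<^sup>+z. F z \<partial>((P \<Otimes>\<^sub>M Q) \<Otimes>\<^sub>M (P \<Otimes>\<^sub>M Q)))"
    by (rule PQ.nn_integral_fst) measurable
  finally show ?thesis by (simp add: F_def)
qed

context group_extension_setting
begin

lemma skew_product_is_system:
  assumes \<phi>[measurable]: "\<phi> \<in> measurable M L"
  shows "is_system (M \<Otimes>\<^sub>M L) (skew_product G T \<phi>)"
proof -
  define \<tau> where "\<tau> = the_inv_into (space M) T"
  have bij: "bij_betw T (space M) (space M)" and \<tau>m[measurable]: "\<tau> \<in> measurable M M"
    using sysM by (auto simp: is_system_def \<tau>_def)
  have \<tau>T: "\<tau> (T y) = y" if "y \<in> space M" for y
    unfolding \<tau>_def by (rule the_inv_into_f_f[OF T_inj that])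
  have T\<tau>: "T (\<tau> y) = y" if "y \<in> space M" for y
    unfolding \<tau>_def by (rule f_the_inv_into_f_bij_betw[OF bij that])
  define f where "f = skew_product G T \<phi>"
  \<comment> \<open>The inverse undoes the fibre translation made at the previous base point, so
    \<open>\<phi>\<close> is evaluated at \<open>\<tau> (fst z)\<close>.\<close>
  define f' where "f' z = (\<tau> (fst z), inv\<^bsub>G\<^esub> (\<phi> (\<tau> (fst z))) \<otimes>\<^bsub>G\<^esub> snd z)" for z
  have f'm: "f' \<in> measurable (M \<Otimes>\<^sub>M L) (M \<Otimes>\<^sub>M L)" unfolding f'_def by measurable
  have mp: "measure_preserving (M \<Otimes>\<^sub>M L) f"
    unfolding f_def skew_product_def
  proof (rule measure_preserving_skew[OF M.prob_space_axioms L.prob_space_axioms T_mp])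
    show "(\<lambda>(y, g). \<phi> y \<otimes>\<^bsub>G\<^esub> g) \<in> measurable (M \<Otimes>\<^sub>M L) L" unfolding case_prod_beta' by measurable
    show "distr L L ((\<otimes>\<^bsub>G\<^esub>) (\<phi> y)) = L" if "y \<in> space M" for y
      using haar_left[OF measurable_L_closed[OF \<phi> that]] by simp
  qed
  have sp: "space (M \<Otimes>\<^sub>M L) = space M \<times> carrier G" by (simp add: space_pair_measure space_L)
  have 1: "f' (f z) = z" "f z \<in> space (M \<Otimes>\<^sub>M L)" if "z \<in> space (M \<Otimes>\<^sub>M L)" for z
    using that \<tau>T measurable_L_closed[OF \<phi>] measurable_space[OF T_measurable]
    by (auto simp: sp f_def f'_def skew_product_def m_assoc[symmetric])
  have 2: "f (f' z) = z" "f' z \<in> space (M \<Otimes>\<^sub>M L)" if "z \<in> space (M \<Otimes>\<^sub>M L)" for z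
    using that T\<tau> measurable_L_closed[OF \<phi>] measurable_space[OF \<tau>m]
    by (auto simp: sp f_def f'_def skew_product_def m_assoc[symmetric])
  have bijf: "bij_betw f (space (M \<Otimes>\<^sub>M L)) (space (M \<Otimes>\<^sub>M L))"
    by (rule bij_betwI[where g=f']) (use 1 2 in auto)
  have "the_inv_into (space (M \<Otimes>\<^sub>M L)) f z = f' z" if "z \<in> space (M \<Otimes>\<^sub>M L)" for z
    by (rule the_inv_into_f_eq) (use bijf 2[OF that] in \<open>auto simp: bij_betw_def\<close>)
  then have "the_inv_into (space (M \<Otimes>\<^sub>M L)) f \<in> measurable (M \<Otimes>\<^sub>M L) (M \<Otimes>\<^sub>M L)"
    using measurable_cong[of "M \<Otimes>\<^sub>M L" "the_inv_into (space (M \<Otimes>\<^sub>M L)) f" f'] f'm by simp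
  then show ?thesis
    using standard_probability_space_pair[OF standard_M standard_L] mp bijf
    unfolding is_system_def measure_preserving_def f_def by blast
qed

text \<open>The factor map forgets the group coordinate, so the conditional measure over
  \<open>z\<close> is multiplied by the full Haar measure.\<close>

lemma skew_product_disintegrated:
  assumes \<phi>: "\<phi> \<in> measurable M L"
  shows "disintegrated_extension (M \<Otimes>\<^sub>M L) (skew_product G T \<phi>) N S (p \<circ> fst) (\<lambda>z. K z \<Otimes>\<^sub>M L)"
proof
  have "distr (M \<Otimes>\<^sub>M L) N (p \<circ> fst) = distr (distr (M \<Otimes>\<^sub>M L) M fst) N p"
    by (rule distr_distr[symmetric]) measurable
  also have "\<dots> = N" by (simp add: L.distr_pair_fst distr_p)
  finally have d: "distr (M \<Otimes>\<^sub>M L) N (p \<circ> fst) = N" .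
  have "AE x in M \<Otimes>\<^sub>M L. p (T (fst x)) = S (p (fst x))"
    by (rule AE_pair_fstI[OF L.prob_space_axioms equivariant])
  then have "AE x in M \<Otimes>\<^sub>M L. (p \<circ> fst) (skew_product G T \<phi> x) = S ((p \<circ> fst) x)"
    by eventually_elim (simp add: skew_product_def case_prod_beta')
  then show "is_extension (M \<Otimes>\<^sub>M L) (skew_product G T \<phi>) N S (p \<circ> fst)"
    using skew_product_is_system[OF \<phi>] sysN d unfolding is_extension_def by auto
  have "(\<lambda>z. K z \<Otimes>\<^sub>M L) \<in> measurable N (prob_algebra (M \<Otimes>\<^sub>M L))"
    using L.prob_space_axioms
    by (intro measurable_pair_prob[OF K_kernel] measurable_const) (simp add: space_prob_algebra)
  moreover have "AE z in N. AE x in K z \<Otimes>\<^sub>M L. (p \<circ> fst) x = z"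
    using K_fibre unfolding o_def by eventually_elim (rule AE_pair_fstI[OF L.prob_space_axioms])
  moreover have "M \<Otimes>\<^sub>M L = N \<bind> (\<lambda>z. K z \<Otimes>\<^sub>M L)"
    using bind_pair_measure[OF N.prob_space_axioms L.prob_space_axioms K_kernel] M_eq by simp
  ultimately show "is_disintegration (M \<Otimes>\<^sub>M L) N (p \<circ> fst) (\<lambda>z. K z \<Otimes>\<^sub>M L)"
    unfolding is_disintegration_def by blast
qed

text \<open>Both sides are mixtures over \<open>N\<close>, and for each \<open>z\<close> the claim
  is \<open>emeasure_shuffle\<close> for \<open>K z\<close> and \<open>L\<close>.\<close>

lemma distr_V_shuffle:
  "distr V ((M \<Otimes>\<^sub>M L) \<Otimes>\<^sub>M (M \<Otimes>\<^sub>M L)) shuffle = fibre_square N (\<lambda>z. K z \<Otimes>\<^sub>M L)"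
proof -
  have KL: "(\<lambda>z. K z \<Otimes>\<^sub>M L) \<in> measurable N (prob_algebra (M \<Otimes>\<^sub>M L))"
    using L.prob_space_axioms
    by (intro measurable_pair_prob[OF K_kernel] measurable_const) (simp add: space_prob_algebra)
  have KKL: "(\<lambda>z. (K z \<Otimes>\<^sub>M K z) \<Otimes>\<^sub>M (L \<Otimes>\<^sub>M L)) \<in> measurable N (prob_algebra ((M \<Otimes>\<^sub>M M) \<Otimes>\<^sub>M (L \<Otimes>\<^sub>M L)))"
    using LL.prob_space_axioms
    by (intro measurable_pair_prob[OF KK_kernel] measurable_const) (simp add: space_prob_algebra)
  have Veq: "V = N \<bind> (\<lambda>z. (K z \<Otimes>\<^sub>M K z) \<Otimes>\<^sub>M (L \<Otimes>\<^sub>M L))"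
    unfolding fibre_square_def
    by (rule bind_pair_measure[OF N.prob_space_axioms LL.prob_space_axioms KK_kernel])
  have sV: "sets V = sets ((M \<Otimes>\<^sub>M M) \<Otimes>\<^sub>M (L \<Otimes>\<^sub>M L))"
    by (rule sets_pair_measure_cong[OF sets_\<nu> refl])
  have shm: "shuffle \<in> measurable V ((M \<Otimes>\<^sub>M L) \<Otimes>\<^sub>M (M \<Otimes>\<^sub>M L))"
    using shuffle_measurable measurable_cong_sets[OF sV refl] by blast
  note KK2 = measurable_pair_prob[OF KL KL]
  show ?thesis
  proof (rule measure_eqI)
    show "sets (distr V ((M \<Otimes>\<^sub>M L) \<Otimes>\<^sub>M (M \<Otimes>\<^sub>M L)) shuffle) = sets (fibre_square N (\<lambda>z. K z \<Otimes>\<^sub>M L))"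
      unfolding fibre_square_def sets_distr by (rule sets_bind'[OF N_in KK2, symmetric])
    fix Q assume "Q \<in> sets (distr V ((M \<Otimes>\<^sub>M L) \<Otimes>\<^sub>M (M \<Otimes>\<^sub>M L)) shuffle)"
    then have Q: "Q \<in> sets ((M \<Otimes>\<^sub>M L) \<Otimes>\<^sub>M (M \<Otimes>\<^sub>M L))" by simp
    define Q' where "Q' = shuffle -` Q \<inter> space V"
    have Q': "Q' \<in> sets ((M \<Otimes>\<^sub>M M) \<Otimes>\<^sub>M (L \<Otimes>\<^sub>M L))"
      unfolding Q'_def sV[symmetric] by (rule measurable_sets[OF shm Q])
    have "emeasure (distr V ((M \<Otimes>\<^sub>M L) \<Otimes>\<^sub>M (M \<Otimes>\<^sub>M L)) shuffle) Q = emeasure V Q'"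
      unfolding Q'_def by (rule emeasure_distr[OF shm Q])
    also have "\<dots> = (\<integral>\<^sup>+z. emeasure ((K z \<Otimes>\<^sub>M K z) \<Otimes>\<^sub>M (L \<Otimes>\<^sub>M L)) Q' \<partial>N)"
      unfolding Veq by (rule emeasure_bind_prob_algebra[OF N_in KKL Q'])
    also have "\<dots> = (\<integral>\<^sup>+z. emeasure ((K z \<Otimes>\<^sub>M L) \<Otimes>\<^sub>M (K z \<Otimes>\<^sub>M L)) Q \<partial>N)"
    proof (rule nn_integral_cong)
      fix z assume z: "z \<in> space N"
      have "space V = space ((K z \<Otimes>\<^sub>M K z) \<Otimes>\<^sub>M (L \<Otimes>\<^sub>M L))"
        by (simp add: space_pair_measure K_space[OF z])
      moreover have "Q \<in> sets ((K z \<Otimes>\<^sub>M L) \<Otimes>\<^sub>M (K z \<Otimes>\<^sub>M L))"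
        using Q sets_pair_measure_cong[OF sets_pair_measure_cong[OF K_sets[OF z] refl]
          sets_pair_measure_cong[OF K_sets[OF z] refl]] by blast
      ultimately show "emeasure ((K z \<Otimes>\<^sub>M K z) \<Otimes>\<^sub>M (L \<Otimes>\<^sub>M L)) Q' = emeasure ((K z \<Otimes>\<^sub>M L) \<Otimes>\<^sub>M (K z \<Otimes>\<^sub>M L)) Q"
        unfolding Q'_def using emeasure_shuffle[OF K_prob[OF z] L.prob_space_axioms] by simp
    qed
    also have "\<dots> = emeasure (fibre_square N (\<lambda>z. K z \<Otimes>\<^sub>M L)) Q"
      unfolding fibre_square_def by (rule emeasure_bind_prob_algebra[OF N_in KK2 Q, symmetric])
    finally show "emeasure (distr V ((M \<Otimes>\<^sub>M L) \<Otimes>\<^sub>M (M \<Otimes>\<^sub>M L)) shuffle) Q =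
        emeasure (fibre_square N (\<lambda>z. K z \<Otimes>\<^sub>M L)) Q" .
  qed
qed

text \<open>\<open>shuffle\<close> intertwines \<open>skew \<phi>\<close> with the square of the
  skew product and carries \<open>V\<close> to its fibre square, so invariant sets pull back with
  the same measure.\<close>

lemma relatively_weakly_mixing_skew_product:
  assumes \<phi>: "\<phi> \<in> measurable M L" and erg: "is_ergodic V (skew \<phi>)"
  shows "relatively_weakly_mixing (M \<Otimes>\<^sub>M L) (skew_product G T \<phi>) N S (p \<circ> fst)"
proof -
  define f where "f = skew_product G T \<phi>"
  interpret E: disintegrated_extension "M \<Otimes>\<^sub>M L" f N S "p \<circ> fst" "\<lambda>z. K z \<Otimes>\<^sub>M L"
    unfolding f_def by (rule skew_product_disintegrated[OF \<phi>])
  let ?W = "(M \<Otimes>\<^sub>M L) \<Otimes>\<^sub>M (M \<Otimes>\<^sub>M L)"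
  have shm: "shuffle \<in> measurable V ?W"
    using shuffle_measurable measurable_cong_sets[OF sets_pair_measure_cong[OF sets_\<nu> refl] refl] by blast
  have inter: "shuffle (skew \<phi> x) = map_prod f f (shuffle x)" for x
    by (simp add: shuffle_def skew_def f_def skew_product_def case_prod_beta')
  have "is_ergodic E.\<nu> (map_prod f f)"
    unfolding is_ergodic_def
  proof (intro ballI impI)
    fix A assume "A \<in> sets E.\<nu>" and inv: "AE x in E.\<nu>. map_prod f f x \<in> A \<longleftrightarrow> x \<in> A"
    then have A: "A \<in> sets ?W" by simp
    define B where "B = shuffle -` A \<inter> space V"
    have B: "B \<in> sets V" unfolding B_def by (rule measurable_sets[OF shm A])
    have "AE x in distr V ?W shuffle. map_prod f f x \<in> A \<longleftrightarrow> x \<in> A"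
      unfolding distr_V_shuffle by (rule inv)
    then have "AE x in V. map_prod f f (shuffle x) \<in> A \<longleftrightarrow> shuffle x \<in> A" by (rule AE_distrD[OF shm])
    then have "AE x in V. skew \<phi> x \<in> B \<longleftrightarrow> x \<in> B"
      using AE_space
    proof eventually_elim
      case (elim x)
      have "skew \<phi> x \<in> space V" by (rule measure_preserving_space[OF skew_mp[OF \<phi>] elim(2)])
      then show ?case using elim inter[of x] by (simp add: B_def)
    qed
    then have "measure V B = 0 \<or> measure V B = 1" using erg B unfolding is_ergodic_def by blast
    moreover have "measure E.\<nu> A = measure V B"
      unfolding distr_V_shuffle[symmetric] B_def by (rule measure_distr[OF shm A])
    ultimately show "measure E.\<nu> A = 0 \<or> measure E.\<nu> A = 1" by simp
  qed
  then have "is_ergodic (relative_product (M \<Otimes>\<^sub>M L) N (p \<circ> fst) (\<lambda>z. K z \<Otimes>\<^sub>M L)) (map_prod f f)"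
    using E.is_ergodic_relative_product_iff by blast
  then show ?thesis
    unfolding relatively_weakly_mixing_def f_def[symmetric] using E.ext E.dis by blast
qed

theorem generic_relatively_weakly_mixing:
  assumes erg\<nu>: "is_ergodic \<nu> (map_prod T T)" and ergM: "is_ergodic M T"
    and niso: "\<not> is_isomorphism M T N S p"
  shows "generic_cocycle M X d
    (\<lambda>\<phi>. relatively_weakly_mixing (M \<Otimes>\<^sub>M L) (skew_product G T \<phi>) N S (p \<circ> fst))"
proof -
  have diag: "AE w in \<nu>. fst w \<noteq> snd w" by (rule diagonal_null[OF erg\<nu> niso])
  obtain BM where BM: "countable BM" "Int_stable BM" "space M \<in> BM" "BM \<subseteq> sets M"
    "sets M = sigma_sets (space M) BM"
    using standard_probability_space_pi_system[OF standard_M] by metis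
  obtain BX where BX: "countable BX" "\<And>W. W \<in> BX \<Longrightarrow> openin X W" "Int_stable BX" "topspace X \<in> BX"
    "sets (borel_of X) = sigma_sets (topspace X) BX"
    using second_countable_pi_base[OF second_countable] by metis
  \<comment> \<open>Baire's theorem allows countably many conditions: rectangles from countable
    generators, bump levels \<open>j\<close>, and tolerances \<open>1 / real (Suc m)\<close> in
    place of all \<open>e\<close>.\<close>
  define I where "I = BM \<times> BM \<times> BX \<times> BX \<times> (UNIV :: nat set) \<times> (UNIV :: nat set)"
  define U where "U i = (case i of (A, B, W, W', j, m) \<Rightarrow>
      good_classes A B (bump W j) (bump W' j) (1 / real (Suc m)))" for i :: "'y set \<times> 'y set \<times> 'g set \<times> 'g set \<times> nat \<times> nat"
  have lip: "unit_lipschitz (real j) (bump W j)" if "W \<in> BX" for W j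
    using bump_unit_lipschitz openin_subset[OF BX(2)[OF that]] topspace_X by blast
  show ?thesis
  proof (rule generic_cocycleI[of I U])
    show "countable I" unfolding I_def using BM(1) BX(1) by auto
    show "openin C.mtopology (U i)" if i: "i \<in> I" for i
    proof -
      obtain A B W W' j m where ie: "i = (A, B, W, W', j, m)" by (cases i)
      have AB: "A \<in> sets M" "B \<in> sets M" "W \<in> BX" "W' \<in> BX" using i BM(4) by (auto simp: ie I_def)
      show ?thesis
        using good_classes_open[OF AB(1,2) lip[OF AB(3)] lip[OF AB(4)]] by (simp add: U_def ie)
    qed
    fix i \<phi> and e :: real assume i: "i \<in> I" and \<phi>: "\<phi> \<in> measurable M L" and e: "e > 0"
    obtain A B W W' j m where ie: "i = (A, B, W, W', j, m)" by (cases i)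
    have AB: "A \<in> sets M" "B \<in> sets M" "W \<in> BX" "W' \<in> BX" using i BM(4) by (auto simp: ie I_def)
    have m: "1 / real (Suc m) > 0" by simp
    obtain \<psi> where \<psi>: "\<psi> \<in> measurable M L" "rho \<phi> \<psi> < e"
      "\<exists>n\<ge>1. defect A B (bump W j) (bump W' j) \<psi> n < 1 / real (Suc m)"
      using good_cocycles_dense[OF erg\<nu> ergM diag AB(1,2) lip[OF AB(3)] lip[OF AB(4)] \<phi> e m] by blast
    have "cocycle_class M X \<psi> \<in> U i"
      using good_classes_iff[OF AB(1,2) lip[OF AB(3)] lip[OF AB(4)] \<psi>(1)] \<psi>(3) by (simp add: U_def ie)
    then show "\<exists>\<psi>\<in>measurable M L. rho \<phi> \<psi> < e \<and> cocycle_class M X \<psi> \<in> U i" using \<psi> by blast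
  next
    fix \<phi> assume \<phi>: "\<phi> \<in> measurable M L" and good: "\<And>i. i \<in> I \<Longrightarrow> cocycle_class M X \<phi> \<in> U i"
    have "is_ergodic V (skew \<phi>)"
    proof (rule skew_ergodicI[OF BM(2-5), of BX])
      fix A B W W' j and e :: real
      assume AB: "A \<in> BM" "B \<in> BM" "W \<in> BX" "W' \<in> BX" and e: "e > 0"
      obtain m where m: "1 / real (Suc m) < e" using e nat_approx_posE by blast
      have "cocycle_class M X \<phi> \<in> U (A, B, W, W', j, m)" by (rule good) (use AB in \<open>auto simp: I_def\<close>)
      then have "\<exists>n\<ge>1. defect A B (bump W j) (bump W' j) \<phi> n < 1 / real (Suc m)"
        using good_classes_iff[OF subsetD[OF BM(4) AB(1)] subsetD[OF BM(4) AB(2)] lip[OF AB(3)] lip[OF AB(4)] \<phi>]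
        unfolding U_def by simp
      then show "\<exists>n\<ge>1. defect A B (bump W j) (bump W' j) \<phi> n < e" using m less_trans by blast
    qed (use BX \<phi> sets_L topspace_X in auto)
    then show "relatively_weakly_mixing (M \<Otimes>\<^sub>M L) (skew_product G T \<phi>) N S (p \<circ> fst)"
      by (rule relatively_weakly_mixing_skew_product[OF \<phi>])
  qed
qed

end

section \<open>The one-point base\<close>

lemma prob_space_one_point: "prob_space one_point"
  using is_system_one_point by (rule is_system_prob_space)

text \<open>A kernel on a one-point space is a single measure, and the disintegration identity
  forces it to be \<open>M\<close>.\<close>

lemma fibre_square_one_point:
  assumes dis: "is_disintegration M one_point (\<lambda>_. ()) K"
  shows "fibre_square one_point K = M \<Otimes>\<^sub>M M"
proof -
  have K: "K \<in> measurable one_point (prob_algebra M)" and M: "M = one_point \<bind> K"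
    using dis by (auto simp: is_disintegration_def)
  have s: "space one_point = UNIV" by (simp add: one_point_def)
  have "K () \<in> space (prob_algebra M)" using measurable_space[OF K] s by simp
  then have P: "prob_space (K ())" by (simp add: space_prob_algebra)
  have c: "K = (\<lambda>_. K ())" by (simp add: fun_eq_iff)
  have "one_point \<bind> (\<lambda>_. K ()) = K ()"
    by (rule bind_const'[OF prob_space_one_point prob_space_imp_subprob_space[OF P]])
  then have KM: "K () = M" using M c by metis
  have "fibre_square one_point K = one_point \<bind> (\<lambda>_. M \<Otimes>\<^sub>M M)"
    unfolding fibre_square_def using KM by (intro arg_cong2[where f=bind]) (auto simp: fun_eq_iff)
  also have "\<dots> = M \<Otimes>\<^sub>M M"
    by (rule bind_const'[OF prob_space_one_point]) (use P KM prob_space_pair prob_space_imp_subprob_space in metis)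
  finally show ?thesis .
qed

lemma relatively_weakly_mixing_one_point_iff:
  "relatively_weakly_mixing M T one_point id (\<lambda>_. ()) \<longleftrightarrow> weakly_mixing M T"
proof
  assume R: "relatively_weakly_mixing M T one_point id (\<lambda>_. ())"
  then obtain K where ext: "is_extension M T one_point id (\<lambda>_. ())"
    and dis: "is_disintegration M one_point (\<lambda>_. ()) K"
    and erg: "is_ergodic (relative_product M one_point (\<lambda>_. ()) K) (map_prod T T)"
    by (auto simp: relatively_weakly_mixing_def)
  interpret disintegrated_extension M T one_point id "\<lambda>_. ()" K by unfold_locales fact+
  show "weakly_mixing M T"
    using erg is_ergodic_relative_product_iff fibre_square_one_point[OF dis] sysM
    by (simp add: weakly_mixing_def)
next
  assume W: "weakly_mixing M T"
  then have sys: "is_system M T" and erg: "is_ergodic (M \<Otimes>\<^sub>M M) (map_prod T T)"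
    by (auto simp: weakly_mixing_def)
  note ext = is_extension_one_point[OF sys]
  have P: "prob_space M" using sys by (rule is_system_prob_space)
  have dis: "is_disintegration M one_point (\<lambda>_. ()) (\<lambda>_. M)"
    unfolding is_disintegration_def
    using P bind_const'[OF prob_space_one_point prob_space_imp_subprob_space[OF P]]
    by (auto simp: space_prob_algebra)
  interpret disintegrated_extension M T one_point id "\<lambda>_. ()" "\<lambda>_. M" by unfold_locales fact+
  show "relatively_weakly_mixing M T one_point id (\<lambda>_. ())"
    unfolding relatively_weakly_mixing_def
    using ext dis is_ergodic_relative_product_iff fibre_square_one_point[OF dis] erg by metis
qed

text \<open>The strip \<open>A \<times> space M\<close> over an invariant \<open>A\<close> is
  invariant in the product and has the same measure.\<close>

lemma weakly_mixing_imp_ergodic: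
  assumes "weakly_mixing M T"
  shows "is_ergodic M T"
  unfolding is_ergodic_def
proof (intro ballI impI)
  have sys: "is_system M T" and erg: "is_ergodic (M \<Otimes>\<^sub>M M) (map_prod T T)"
    using assms by (auto simp: weakly_mixing_def)
  interpret M: prob_space M using sys by (rule is_system_prob_space)
  have T: "T \<in> measurable M M" using sys by (simp add: is_system_def)
  fix A assume A: "A \<in> sets M" and inv: "AE x in M. T x \<in> A \<longleftrightarrow> x \<in> A"
  have "AE w in M \<Otimes>\<^sub>M M. T (fst w) \<in> A \<longleftrightarrow> fst w \<in> A"
    by (rule AE_pair_fstI[OF M.prob_space_axioms inv])
  then have "AE w in M \<Otimes>\<^sub>M M. map_prod T T w \<in> A \<times> space M \<longleftrightarrow> w \<in> A \<times> space M"
    using AE_space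
  proof eventually_elim
    case (elim w)
    then show ?case using measurable_space[OF T] by (cases w) (auto simp: space_pair_measure)
  qed
  then have "measure (M \<Otimes>\<^sub>M M) (A \<times> space M) = 0 \<or> measure (M \<Otimes>\<^sub>M M) (A \<times> space M) = 1"
    using erg A unfolding is_ergodic_def by auto
  moreover have "measure (M \<Otimes>\<^sub>M M) (A \<times> space M) = measure M A"
    using A by (simp add: measure_def M.emeasure_pair_measure_Times M.emeasure_space_1)
  ultimately show "measure M A = 0 \<or> measure M A = 1" by simp
qed

lemma generic_cocycle_mono:
  assumes "generic_cocycle M X d P" "\<And>\<phi>. P \<phi> \<Longrightarrow> Q \<phi>"
  shows "generic_cocycle M X d Q"
  using assms unfolding generic_cocycle_def by blast

text \<open>The second part inherits nontriviality from the first, and it cannot hold otherwise: a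
  one-point \<open>Y\<close> is weakly mixing, but its skew products are rotations of
  \<open>G\<close>, which are weakly mixing only for trivial \<open>G\<close>.\<close>

theorem theorem6p2:
  fixes M :: "'y measure" and T :: "'y \<Rightarrow> 'y"
    and N :: "'z measure" and S :: "'z \<Rightarrow> 'z" and p :: "'y \<Rightarrow> 'z"
    and G :: "('g, 'm) monoid_scheme" and X :: "'g topology"
    and L :: "'g measure" and d :: "'g \<Rightarrow> 'g \<Rightarrow> real"
  assumes "topological_group G X" and "compact_space X" and "Hausdorff_space X"
    and "second_countable X"
    and "haar_measure G X L"
    and "bi_invariant_metric G X d"
  shows "(nontrivial_extension M T N S p \<and> is_ergodic M T \<and> is_ergodic N S \<and>
            relatively_weakly_mixing M T N S p \<longrightarrow>
          generic_cocycle M X d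
            (\<lambda>\<phi>. relatively_weakly_mixing (M \<Otimes>\<^sub>M L) (skew_product G T \<phi>) N S (p \<circ> fst)))
       \<and> (weakly_mixing M T \<and> nontrivial_extension M T one_point id (\<lambda>_. ()) \<longrightarrow>
          generic_cocycle M X d (\<lambda>\<phi>. weakly_mixing (M \<Otimes>\<^sub>M L) (skew_product G T \<phi>)))"
proof -
  \<comment> \<open>The base and its type are left open, because the claim is used for
    \<open>N\<close> and again for \<open>one_point\<close>.\<close>
  have main: "generic_cocycle M X d
      (\<lambda>\<phi>. relatively_weakly_mixing (M \<Otimes>\<^sub>M L) (skew_product G T \<phi>) N S (p \<circ> fst))"
    if niso: "\<not> is_isomorphism M T N S p" and erg: "is_ergodic M T"
      and rwm: "relatively_weakly_mixing M T N S p"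
    for N :: "'w measure" and S p
  proof -
    obtain K where ext: "is_extension M T N S p" and dis: "is_disintegration M N p K"
      and ergK: "is_ergodic (relative_product M N p K) (map_prod T T)"
      using rwm by (auto simp: relatively_weakly_mixing_def)
    have "prob_space M" using ext is_system_prob_space by (auto simp: is_extension_def)
    then interpret group_extension_setting G X L d M T N S p K
      using assms ext dis
      by (intro group_extension_setting.intro cocycle_space.intro compact_metric_group.intro
          disintegrated_extension.intro)
    show ?thesis
      using generic_relatively_weakly_mixing[OF _ erg niso] ergK is_ergodic_relative_product_iff by blast
  qed
  have "generic_cocycle M X d (\<lambda>\<phi>. weakly_mixing (M \<Otimes>\<^sub>M L) (skew_product G T \<phi>))"
    if wm: "weakly_mixing M T" and nt: "nontrivial_extension M T one_point id (\<lambda>_. ())"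
  proof (rule generic_cocycle_mono[OF main])
    show "\<not> is_isomorphism M T one_point id (\<lambda>_. ())" using nt by (simp add: nontrivial_extension_def)
    show "is_ergodic M T" by (rule weakly_mixing_imp_ergodic[OF wm])
    show "relatively_weakly_mixing M T one_point id (\<lambda>_. ())"
      using wm by (simp add: relatively_weakly_mixing_one_point_iff)
    fix \<phi> assume "relatively_weakly_mixing (M \<Otimes>\<^sub>M L) (skew_product G T \<phi>) one_point id ((\<lambda>_. ()) \<circ> fst)"
    moreover have "(\<lambda>_. ()) \<circ> fst = (\<lambda>_. ())" by (simp add: fun_eq_iff)
    ultimately show "weakly_mixing (M \<Otimes>\<^sub>M L) (skew_product G T \<phi>)"
      by (simp add: relatively_weakly_mixing_one_point_iff)
  qed
  then show ?thesis using main by (auto simp: nontrivial_extension_def)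
qed

end
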